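(* Let $m,n\ge1$ be integers, $d=m+n$, let $A$ be a real $m\times n$ matrix, and let $\psi:(0,\infty)\to(0,\infty)$ be non-increasing and dyadically regular (i.e. there exist $\varrho\in(0,1)$ and an integer $k_0\ge0$ with $\psi(2^{k+1})\le\varrho\,\psi(2^k)$ for all $k\ge k_0$). For $k\ge0$ put \[ R_k=\bigl(2^{kn}\psi(2^k)^m\bigr)^{1/d},\qquad t_k=\frac{mn}{d}\log\frac{2^k}{\psi(2^k)}. \] Then, uniformly in $k\ge0$, \[ M_A(\psi(2^k),2^k)\asymp\prod_{i=1}^{d}\min\{R_k,\lambda_i(a_{t_k}\Lambda_A)\}. \] Consequently, $\mathcal L^m(W_A(\psi))=0$ if $\sum_{k=0}^\infty\prod_{i=1}^{d}\min\{R_k,\lambda_i(a_{t_k}\Lambda_A)\}<\infty$, and $\mathcal L^m(W_A(\psi))=1$ if this series diverges.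
   Context: Norms $|\cdot|$ are supremum norms; $\mathbb T^m=\mathbb R^m/\mathbb Z^m$; $|\mathbf x|_{\mathbb Z^m}:=\min_{\mathbf p\in\mathbb Z^m}|\mathbf x-\mathbf p|$; $\mathcal L^m$ is normalized Lebesgue measure on $\mathbb T^m$. $W_A(\psi)$ is the set of $\mathbf b\in\mathbb T^m$ such that $|A\mathbf q-\mathbf b|_{\mathbb Z^m}<\psi(|\mathbf q|)$ holds for infinitely many distinct $\mathbf q\in\mathbb Z^n\setminus\{\mathbf 0\}$. For $r,T>0$, \[ N_A(r,T):=\#\{(\mathbf p,\mathbf q)\in\mathbb Z^m\times\mathbb Z^n: |A\mathbf q-\mathbf p|\le r,\ |\mathbf q|\le T\},\qquad M_A(r,T):=\frac{r^mT^n}{N_A(r,T)}. \] The lattice and flow are \[ \Lambda_A=u_A\mathbb Z^d,\quad u_A=\begin{pmatrix}I_m&A\\0&I_n\end{pmatrix},\quad a_t=\begin{pmatrix}e^{t/m}I_m&0\\0&e^{-t/n}I_n\end{pmatrix}\quad(t\in\mathbb R). \] For a lattice $\Lambda\subset\mathbb R^d$ and $1\le i\le d$, $\lambda_i(\Lambda):=\inf\{\rho>0:\Lambda\cap[-\rho,\rho]^d\text{ contains } i \text{ linearly independent vectors}\}$. $X\asymp Y$ means $C^{-1}Y\le X\le CY$ for a constant $C>0$ which may depend on $m,n,A,\psi$ (but here not on $k$). *)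

theory Defs
  imports "HOL-Probability.Probability"
begin

text \<open>Supremum norms are rendered by the library constant \<^const>\<open>infnorm\<close>;
  the dimensions are \<open>m = CARD('m)\<close>, \<open>n = CARD('n)\<close>, and
  \<open>\<real>\<^sup>d\<close> with \<open>d = m + n\<close> is the type \<open>real ^ ('m + 'n)\<close>.\<close>

definition int_vecs :: "(real ^ 'n::finite) set" where
  "int_vecs = {x. \<forall>i. x $ i \<in> \<int>}"

lemma int_vecs_0: "0 \<in> int_vecs"
  and int_vecs_minus: "x \<in> int_vecs \<Longrightarrow> - x \<in> int_vecs"
  and int_vecs_add: "x \<in> int_vecs \<Longrightarrow> y \<in> int_vecs \<Longrightarrow> x + y \<in> int_vecs"
  by (auto simp: int_vecs_def)

subsection \<open>The torus\<close>

quotient_type 'm torus = "real ^ ('m::finite)" / "\<lambda>x y. x - y \<in> int_vecs"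
  morphisms rep_torus to_torus
proof (rule equivpI)
  show "reflp (\<lambda>x y::real^'m. x - y \<in> int_vecs)"
    by (simp add: reflp_def int_vecs_0)
  show "symp (\<lambda>x y::real^'m. x - y \<in> int_vecs)"
    using int_vecs_minus by (fastforce simp: symp_def)
  show "transp (\<lambda>x y::real^'m. x - y \<in> int_vecs)"
    using int_vecs_add by (fastforce simp: transp_def)
qed

text \<open>Normalized Lebesgue measure on the torus: the image of Lebesgue measure on the
  unit cube, on the sigma-algebra of all sets whose preimage in \<open>\<real>\<^sup>m\<close> is Lebesgue measurable.\<close>

definition torus_measure :: "('m::finite) torus measure" where
  "torus_measure = distr (lebesgue_on (cbox 0 1))
     (sigma UNIV {B. to_torus -` B \<in> sets lebesgue}) to_torus"

lemma measurable_to_torus: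
  "(to_torus :: real ^ ('m::finite) \<Rightarrow> 'm torus) \<in> measurable (lebesgue_on (cbox 0 1))
     (sigma UNIV {B. to_torus -` B \<in> sets lebesgue})"
proof (rule measurable_measure_of)
  fix B :: "'m torus set" assume "B \<in> {B. to_torus -` B \<in> sets lebesgue}"
  then show "to_torus -` B \<inter> space (lebesgue_on (cbox 0 1)) \<in> sets (lebesgue_on (cbox 0 1))"
    by (auto simp: sets_restrict_space)
qed auto

lemma prob_space_torus_measure: "prob_space (torus_measure :: ('m::finite) torus measure)"
proof -
  have "prob_space (lebesgue_on (cbox 0 (1 :: real ^ 'm)))"
  proof
    have "emeasure lborel (cbox 0 (1 :: real ^ 'm)) = 1"
      by (subst emeasure_lborel_cbox) (auto simp: Basis_vec_def inner_axis intro!: prod.neutral)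
    then show "emeasure (lebesgue_on (cbox 0 1)) (space (lebesgue_on (cbox 0 (1::real^'m)))) = 1"
      by (simp add: emeasure_restrict_space)
  qed
  then show ?thesis
    unfolding torus_measure_def by (rule prob_space.prob_space_distr[OF _ measurable_to_torus])
qed

text \<open>The infimum is attained, i.e. it is a minimum.\<close>

definition dist_int_vecs :: "real ^ 'm::finite \<Rightarrow> real" where
  "dist_int_vecs x = (INF p\<in>int_vecs. infnorm (x - p))"

text \<open>The condition on \<open>b\<close> is invariant under translation by integer vectors, so the
  image under \<open>to_torus\<close> consists exactly of the points all of whose representatives satisfy it.\<close>

definition W_set :: "real ^ 'n ^ 'm \<Rightarrow> (real \<Rightarrow> real) \<Rightarrow> ('m::finite) torus set" where
  "W_set A \<psi> = to_torus `
     {b. infinite {q \<in> int_vecs. q \<noteq> 0 \<and> dist_int_vecs (A *v q - b) < \<psi> (infnorm q)}}"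

subsection \<open>Counting functions\<close>

definition N_count :: "real ^ 'n ^ 'm \<Rightarrow> real \<Rightarrow> real \<Rightarrow> nat" where
  "N_count A r T = card {(p, q). p \<in> (int_vecs :: (real ^ 'm) set) \<and> q \<in> (int_vecs :: (real ^ 'n) set)
     \<and> infnorm (A *v q - p) \<le> r \<and> infnorm q \<le> T}"

definition M_ratio :: "real ^ 'n ^ 'm \<Rightarrow> real \<Rightarrow> real \<Rightarrow> real" where
  "M_ratio A r T = r ^ CARD('m) * T ^ CARD('n) / real (N_count A r T)"

subsection \<open>Lattice, flow and successive minima\<close>

definition u_mat :: "real ^ 'n ^ 'm \<Rightarrow> real ^ ('m::finite + 'n::finite) ^ ('m + 'n)" where
  "u_mat A = (\<chi> i j. case (i, j) of
       (Inl i', Inl j') \<Rightarrow> if i' = j' then 1 else 0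
     | (Inl i', Inr j') \<Rightarrow> A $ i' $ j'
     | (Inr i', Inl j') \<Rightarrow> 0
     | (Inr i', Inr j') \<Rightarrow> if i' = j' then 1 else 0)"

definition a_mat :: "real \<Rightarrow> real ^ ('m::finite + 'n::finite) ^ ('m + 'n)" where
  "a_mat t = (\<chi> i j. if i = j
     then (case i of Inl _ \<Rightarrow> exp (t / real CARD('m)) | Inr _ \<Rightarrow> exp (- t / real CARD('n)))
     else 0)"

definition Lambda :: "real ^ 'n ^ 'm \<Rightarrow> (real ^ ('m::finite + 'n::finite)) set" where
  "Lambda A = (\<lambda>x. u_mat A *v x) ` int_vecs"

definition successive_min :: "nat \<Rightarrow> (real ^ 'd::finite) set \<Rightarrow> real" where
  "successive_min i \<Lambda> = Inf {\<rho>. \<rho> > 0 \<and>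
     (\<exists>S. S \<subseteq> \<Lambda> \<inter> cbox (\<chi> j. - \<rho>) (\<chi> j. \<rho>) \<and> card S = i \<and> independent S)}"

subsection \<open>Parameters attached to the approximation function\<close>

definition dyadically_regular :: "(real \<Rightarrow> real) \<Rightarrow> bool" where
  "dyadically_regular \<psi> \<longleftrightarrow>
     (\<exists>\<rho>. 0 < \<rho> \<and> \<rho> < 1 \<and> (\<exists>k0::nat. \<forall>k\<ge>k0. \<psi> (2 ^ (k + 1)) \<le> \<rho> * \<psi> (2 ^ k)))"

definition R_param :: "nat \<Rightarrow> nat \<Rightarrow> (real \<Rightarrow> real) \<Rightarrow> nat \<Rightarrow> real" where
  "R_param m n \<psi> k = (2 ^ (k * n) * \<psi> (2 ^ k) ^ m) powr (1 / real (m + n))"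

definition t_param :: "nat \<Rightarrow> nat \<Rightarrow> (real \<Rightarrow> real) \<Rightarrow> nat \<Rightarrow> real" where
  "t_param m n \<psi> k = real (m * n) / real (m + n) * ln (2 ^ k / \<psi> (2 ^ k))"

definition minima_product :: "real ^ 'n::finite ^ 'm::finite \<Rightarrow> (real \<Rightarrow> real) \<Rightarrow> nat \<Rightarrow> real" where
  "minima_product A \<psi> k = (\<Prod>i = 1..CARD('m) + CARD('n).
     min (R_param CARD('m) CARD('n) \<psi> k)
         (successive_min i ((\<lambda>x. a_mat (t_param CARD('m) CARD('n) \<psi> k) *v x) ` Lambda A)))"

end

theory Submission
  imports Defs
begin

text \<open>
  The lattice points counted by \<open>N\<^sub>A(r, T)\<close> lie in a box which the diagonal flow turns into a cube of
  half side \<open>R\<close>, and a lattice has about \<open>\<Prod>i. max 1 (R / \<lambda>\<^sub>i)\<close> points in such a cube.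

  Let \<open>U(r, T)\<close> be the union of the cubes of radius \<open>r\<close> around the points \<open>A q\<close> with \<open>\<bar>q\<bar> \<le> T\<close>.
  A point of \<open>U(r, T)\<close> is covered about \<open>N\<^sub>A(r, T)\<close> times by the cubes of twice the size, so
  \<open>U(r, T)\<close> has measure about \<open>M\<^sub>A(r, T)\<close>, which gives the convergence case by Borel--Cantelli.
  In the same way, with \<open>r\<^sub>k = \<psi>(2\<^sup>k)\<close>, \<open>T\<^sub>k = 2\<^sup>k\<close>, \<open>U\<^sub>k = U(r\<^sub>k, T\<^sub>k)\<close> and \<open>M\<^sub>k = M\<^sub>A(r\<^sub>k, T\<^sub>k)\<close>,
  the measure of \<open>U\<^sub>k \<inter> U\<^sub>l\<close> for \<open>k < l\<close> is at most a constant times \<open>M\<^sub>k M\<^sub>l / M\<^sub>A(r\<^sub>k, T\<^sub>l)\<close>.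
  If the lattice points in the box with sides \<open>r\<^sub>k, T\<^sub>l\<close> span the space, then \<open>M\<^sub>A(r\<^sub>k, T\<^sub>l)\<close> is bounded
  below and the pair is quasi-independent. Otherwise these points lie in a hyperplane, and passing to
  smaller sides loses a factor in only \<open>d - 1\<close> directions; as both \<open>r\<close> and \<open>1/T\<close> decay geometrically,
  the bound becomes \<open>\<delta>\<^bsup>l-k\<^esup> (M\<^sub>k + M\<^sub>l)\<close>. The indices split into four classes such that one of these two
  bounds holds for all pairs in a class. A second moment argument then yields a limsup set of positive
  measure; as divergence makes the points \<open>A q\<close> dense in the torus, translating by them gives full measure.
\<close>

subsection \<open>Counting points of discrete subgroups in boxes\<close>

text \<open>For \<open>k < l\<close> the box with sides \<open>r_k, T_l\<close> is compared with two
  smaller boxes: the one with sides \<open>r_l, T_l\<close>, which shrinks only in the first factor,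
  and the one with sides \<open>r_k, T_k\<close>, which shrinks only in the second. When the lattice
  points of the large box are orthogonal to \<open>w\<close>, the first comparison gains
  \<open>\<delta> ^ (l - k)\<close> if \<open>w\<close> is stuck at scale \<open>l\<close>, the
  second if \<open>w\<close> is not stuck at scale \<open>k\<close>. Only the pattern "stuck at
  \<open>k\<close>, not stuck at \<open>l\<close>" escapes, so stuckness is one of the two bits that
  define the four classes. A class must be read off from a single index, so one \<open>w\<close> has
  to serve many pairs. Therefore the indices are cut greedily into blocks, each with its own
  hyperplane, such that the boxes of pairs from blocks that are neither equal nor adjacent span. The
  parity of the block number is the second bit: it excludes pairs from adjacent blocks, over which
  neither argument has control.\<close>

text \<open>Pigeonhole on the integer parts of the functions \<open>h i\<close>: subtracting one
  fixed member embeds each cell into \<open>Y\<close>, and an interval \<open>[-Z, Z]\<close> meets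
  at most \<open>2 * Z + 2\<close> unit cells. The three upper bounds for lattice points below
  differ in the choice of \<open>h\<close>.\<close>

lemma card_le_cells:
  fixes h :: "'i \<Rightarrow> 'a::ab_group_add \<Rightarrow> real"
  assumes I: "finite I" and Y: "finite Y" and Z: "\<And>i. i \<in> I \<Longrightarrow> 0 \<le> Z i"
    and bd: "\<And>x i. x \<in> X \<Longrightarrow> i \<in> I \<Longrightarrow> \<bar>h i x\<bar> \<le> Z i"
    and cell: "\<And>x x'. \<lbrakk>x \<in> X; x' \<in> X; \<And>i. i \<in> I \<Longrightarrow> \<bar>h i x - h i x'\<bar> < 1\<rbrakk> \<Longrightarrow> x - x' \<in> Y"
  shows "real (card X) \<le> (\<Prod>i\<in>I. 2 * Z i + 2) * real (card Y)"
proof -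
  define C where "C = PiE I (\<lambda>i. {-\<lceil>Z i\<rceil>..\<lfloor>Z i\<rfloor>})"
  define F where "F x = restrict (\<lambda>i. \<lfloor>h i x\<rfloor>) I" for x
  have FC: "F x \<in> C" if "x \<in> X" for x
    unfolding C_def F_def
  proof (rule restrict_PiE_iff[THEN iffD2], intro ballI)
    fix i assume i: "i \<in> I"
    have "-Z i \<le> h i x" "h i x \<le> Z i" using bd[OF that i] by auto
    then show "\<lfloor>h i x\<rfloor> \<in> {-\<lceil>Z i\<rceil>..\<lfloor>Z i\<rfloor>}"
      by (auto intro: floor_mono) (metis floor_minus floor_mono ceiling_def minus_minus)
  qed
  have finC: "finite C" unfolding C_def using I by (intro finite_PiE) auto
  have fib: "finite {x\<in>X. F x = c} \<and> card {x\<in>X. F x = c} \<le> card Y" for c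
  proof (cases "{x\<in>X. F x = c} = {}")
    case True
    then show ?thesis by (metis card.empty finite.emptyI zero_le)
  next
    case False
    then obtain x0 where x0: "x0 \<in> X" "F x0 = c" by auto
    have sub: "(\<lambda>x. x - x0) ` {x\<in>X. F x = c} \<subseteq> Y"
    proof clarify
      fix x assume x: "x \<in> X" "c = F x"
      show "x - x0 \<in> Y"
      proof (rule cell[OF x(1) x0(1)])
        fix i assume i: "i \<in> I"
        have "\<lfloor>h i x\<rfloor> = \<lfloor>h i x0\<rfloor>"
          using x x0 i unfolding F_def by (metis restrict_apply')
        then show "\<bar>h i x - h i x0\<bar> < 1" by linarith
      qed
    qed
    have inj: "inj_on (\<lambda>x. x - x0) {x\<in>X. F x = c}" by (auto simp: inj_on_def)
    have "finite {x\<in>X. F x = c}"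
      using inj sub Y by (meson finite_imageD finite_subset)
    moreover have "card {x\<in>X. F x = c} \<le> card Y"
      using inj sub Y by (meson card_inj_on_le)
    ultimately show ?thesis ..
  qed
  have "X = (\<Union>c\<in>C. {x\<in>X. F x = c})" using FC by auto
  then have "card X \<le> (\<Sum>c\<in>C. card {x\<in>X. F x = c})" using card_UN_le[OF finC] by metis
  also have "\<dots> \<le> (\<Sum>c\<in>C. card Y)" by (rule sum_mono) (use fib in blast)
  also have "\<dots> = card C * card Y" by simp
  finally have 1: "real (card X) \<le> real (card C) * real (card Y)"
    by (simp only: of_nat_mult[symmetric] of_nat_le_iff)
  have "real (card C) = (\<Prod>i\<in>I. real (nat (\<lfloor>Z i\<rfloor> + \<lceil>Z i\<rceil> + 1)))"
    unfolding C_def by (subst card_PiE[OF I]) (simp add: algebra_simps)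
  also have "\<dots> \<le> (\<Prod>i\<in>I. 2 * Z i + 2)"
  proof (rule prod_mono, intro conjI)
    fix i assume "i \<in> I"
    then have "0 \<le> \<lfloor>Z i\<rfloor> + \<lceil>Z i\<rceil> + 1" using Z by force
    then have "real (nat (\<lfloor>Z i\<rfloor> + \<lceil>Z i\<rceil> + 1)) = real_of_int (\<lfloor>Z i\<rfloor> + \<lceil>Z i\<rceil> + 1)"
      by simp
    then show "real (nat (\<lfloor>Z i\<rfloor> + \<lceil>Z i\<rceil> + 1)) \<le> 2 * Z i + 2"
      using of_int_floor_le[of "Z i"] of_int_ceiling_le_add_one[of "Z i"] by linarith
  qed auto
  finally show ?thesis
    using 1 by (meson dual_order.trans mult_right_mono of_nat_0_le_iff)
qed

definition sbox :: "('d \<Rightarrow> real) \<Rightarrow> (real ^ 'd::finite) set" where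
  "sbox s = {v. \<forall>i. \<bar>v $ i\<bar> \<le> s i}"

lemma sbox_iff: "v \<in> sbox s \<longleftrightarrow> (\<forall>i. \<bar>v $ i\<bar> \<le> s i)"
  by (simp add: sbox_def)

lemma sbox_mono: "(\<And>i. s i \<le> s' i) \<Longrightarrow> sbox s \<subseteq> sbox s'"
  unfolding sbox_def by (auto intro: order_trans)

lemma sbox_const: "sbox (\<lambda>_. R) = cbox (\<chi> j. - R) (\<chi> j. R)"
  by (auto simp: sbox_iff mem_box_cart abs_le_iff minus_le_iff)

locale discrete_subgroup =
  fixes L :: "(real ^ 'd::finite) set"
  assumes zero: "0 \<in> L"
    and diff: "x \<in> L \<Longrightarrow> y \<in> L \<Longrightarrow> x - y \<in> L"
    and fin: "finite (L \<inter> sbox s)"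
begin

definition count :: "('d \<Rightarrow> real) \<Rightarrow> nat" where
  "count s = card (L \<inter> sbox s)"

lemma minus: "x \<in> L \<Longrightarrow> - x \<in> L"
  using diff[OF zero] by simp

lemma add: "x \<in> L \<Longrightarrow> y \<in> L \<Longrightarrow> x + y \<in> L"
  using diff[OF _ minus] by fastforce

lemma of_nat_scale: "x \<in> L \<Longrightarrow> real n *\<^sub>R x \<in> L"
  by (induction n) (auto simp: zero scaleR_left_distrib intro: add)

lemma of_int_scale: "x \<in> L \<Longrightarrow> real_of_int n *\<^sub>R x \<in> L"
proof (cases n rule: int_cases2)
  case (nonneg k)
  then show ?thesis if "x \<in> L" using of_nat_scale[OF that, of k] by simp
next
  case (nonpos k)
  then show ?thesis if "x \<in> L" using minus[OF of_nat_scale[OF that, of k]] by simp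
qed

lemma sum: "(\<And>i. i \<in> I \<Longrightarrow> f i \<in> L) \<Longrightarrow> sum f I \<in> L"
  by (induction I rule: infinite_finite_induct) (auto simp: zero intro: add)

lemma count_mono: "(\<And>i. s i \<le> s' i) \<Longrightarrow> count s \<le> count s'"
  unfolding count_def using sbox_mono[of s s'] by (intro card_mono fin) auto

lemma count_pos:
  assumes "\<And>i. 0 \<le> s i"
  shows "1 \<le> count s"
proof -
  have "0 \<in> L \<inter> sbox s" using zero assms by (auto simp: sbox_iff)
  then show ?thesis unfolding count_def using fin by (metis Suc_leI One_nat_def card_gt_0_iff empty_iff)
qed

text \<open>Two points in one cell with sides \<open>s i\<close> differ by a lattice point of the
  small box, and a box \<open>K\<close> times as large has at most \<open>2 * K + 2\<close> cells
  per coordinate.\<close>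

lemma count_scale_le:
  assumes s: "\<And>i. 0 < s i" and K: "1 \<le> K"
  shows "real (count (\<lambda>i. K * s i)) \<le> (2 * K + 2) ^ CARD('d) * real (count s)"
proof -
  have "real (card (L \<inter> sbox (\<lambda>i. K * s i)))
      \<le> (\<Prod>i\<in>(UNIV::'d set). 2 * K + 2) * real (card (L \<inter> sbox s))"
  proof (rule card_le_cells[where h = "\<lambda>i x. x $ i / s i"])
    fix x i assume "x \<in> L \<inter> sbox (\<lambda>i. K * s i)"
    then show "\<bar>x $ i / s i\<bar> \<le> K" using s[of i] by (auto simp: sbox_iff field_simps)
  next
    fix x x' assume x: "x \<in> L \<inter> sbox (\<lambda>i. K * s i)" "x' \<in> L \<inter> sbox (\<lambda>i. K * s i)"
      and c: "\<And>i. i \<in> (UNIV::'d set) \<Longrightarrow> \<bar>x $ i / s i - x' $ i / s i\<bar> < 1"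
    have "\<bar>(x - x') $ i\<bar> \<le> s i" for i
    proof -
      have "\<bar>(x - x') $ i\<bar> / s i < 1"
        using c[of i] s[of i] by (simp add: diff_divide_distrib[symmetric])
      then show ?thesis using s[of i] by (simp add: field_simps)
    qed
    then show "x - x' \<in> L \<inter> sbox s" using x diff by (auto simp: sbox_iff)
  qed (use K fin in auto)
  then show ?thesis by (simp add: count_def)
qed

text \<open>A normal vector \<open>w\<close> determines the coordinate \<open>i0\<close> from the others up to the scale of
  the small box, so only the remaining coordinates contribute cells.\<close>

lemma count_hyperplane_le:
  assumes s: "\<And>i. 0 < s' i" "\<And>i. s' i \<le> s i"
    and w: "\<And>v. v \<in> L \<inter> sbox s \<Longrightarrow> w \<bullet> v = 0" "w \<noteq> 0"
    and i0: "\<And>i. \<bar>w $ i\<bar> * s' i \<le> \<bar>w $ i0\<bar> * s' i0"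
  shows "real (count s) * (s i0 / s' i0)
           \<le> 4 ^ CARD('d) * (2 * CARD('d) + 2) ^ CARD('d) * (\<Prod>i\<in>UNIV. s i / s' i) * real (count s')"
proof -
  define d where "d = real CARD('d)"
  have d1: "1 \<le> d" unfolding d_def by (simp add: Suc_leI)
  have wi0: "w $ i0 \<noteq> 0"
  proof
    assume "w $ i0 = 0"
    then have "\<bar>w $ i\<bar> * s' i \<le> 0" for i using i0[of i] by simp
    then have "w $ i = 0" for i using s(1)[of i] by (metis abs_not_less_zero linorder_neqE mult_pos_pos not_less zero_less_abs_iff)
    then show False using w(2) by (simp add: vec_eq_iff)
  qed
  \<comment> \<open>Orthogonality to \<open>w\<close> bounds coordinate \<open>i0\<close> of a
    difference only by the sum of the other \<open>d - 1\<close> terms. This is why the small box is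
    enlarged by \<open>d\<close>, an enlargement that \<open>count_scale_le\<close> undoes
    below.\<close>
  have "real (card (L \<inter> sbox s))
      \<le> (\<Prod>i\<in>UNIV - {i0}. 2 * (s i / s' i) + 2) * real (card (L \<inter> sbox (\<lambda>i. d * s' i)))"
  proof (rule card_le_cells[where h = "\<lambda>i x. x $ i / s' i"])
    fix x i assume "x \<in> L \<inter> sbox s"
    then show "\<bar>x $ i / s' i\<bar> \<le> s i / s' i" using s(1)[of i] by (auto simp: sbox_iff field_simps)
  next
    fix i show "0 \<le> s i / s' i" using s(1)[of i] s(2)[of i] by simp
  next
    fix x x' assume x: "x \<in> L \<inter> sbox s" "x' \<in> L \<inter> sbox s"
      and c: "\<And>i. i \<in> UNIV - {i0} \<Longrightarrow> \<bar>x $ i / s' i - x' $ i / s' i\<bar> < 1"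
    define y where "y = x - x'"
    have yi: "\<bar>y $ i\<bar> \<le> s' i" if "i \<noteq> i0" for i
    proof -
      have "\<bar>y $ i\<bar> / s' i < 1"
        using c[of i] s(1)[of i] that by (simp add: diff_divide_distrib[symmetric] y_def)
      then show ?thesis using s(1)[of i] by (simp add: field_simps)
    qed
    have "w \<bullet> y = 0" unfolding y_def using w(1) x by (simp add: inner_diff_right)
    moreover have "w \<bullet> y = w $ i0 * y $ i0 + (\<Sum>i\<in>UNIV - {i0}. w $ i * y $ i)"
      unfolding inner_vec_def inner_real_def by (rule sum.remove) auto
    ultimately have "w $ i0 * y $ i0 = - (\<Sum>i\<in>UNIV - {i0}. w $ i * y $ i)"
      by linarith
    then have "\<bar>w $ i0\<bar> * \<bar>y $ i0\<bar> = \<bar>\<Sum>i\<in>UNIV - {i0}. w $ i * y $ i\<bar>"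
      by (simp only: abs_mult[symmetric] abs_minus_cancel)
    also have "\<dots> \<le> (\<Sum>i\<in>UNIV - {i0}. \<bar>w $ i * y $ i\<bar>)"
      by (rule sum_abs)
    also have "\<dots> \<le> (\<Sum>i\<in>UNIV - {i0}. \<bar>w $ i0\<bar> * s' i0)"
    proof (rule sum_mono)
      fix i assume "i \<in> UNIV - {i0}"
      then have "\<bar>w $ i\<bar> * \<bar>y $ i\<bar> \<le> \<bar>w $ i\<bar> * s' i" using yi[of i] by (intro mult_left_mono) auto
      then show "\<bar>w $ i * y $ i\<bar> \<le> \<bar>w $ i0\<bar> * s' i0" using i0[of i] by (simp add: abs_mult)
    qed
    also have "\<dots> \<le> \<bar>w $ i0\<bar> * (d * s' i0)"
    proof -
      have "0 \<le> \<bar>w $ i0\<bar> * s' i0" using s(1)[of i0] by simp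
      then have "(d - 1) * (\<bar>w $ i0\<bar> * s' i0) \<le> d * (\<bar>w $ i0\<bar> * s' i0)"
        by (intro mult_right_mono) auto
      moreover have "real (card (UNIV - {i0})) = d - 1" unfolding d_def by simp
      ultimately show ?thesis by (simp only: sum_constant mult_ac)
    qed
    finally have yi0: "\<bar>y $ i0\<bar> \<le> d * s' i0" using wi0 by simp
    have "\<bar>y $ i\<bar> \<le> d * s' i" for i
    proof (cases "i = i0")
      case False
      moreover have "s' i \<le> d * s' i" using mult_right_mono[OF d1, of "s' i"] s(1)[of i] by simp
      ultimately show ?thesis using yi[of i] by linarith
    qed (use yi0 in simp)
    then show "x - x' \<in> L \<inter> sbox (\<lambda>i. d * s' i)"
      using x diff by (auto simp: sbox_iff y_def)
  qed (use fin in auto)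
  also have "\<dots> \<le> (\<Prod>i\<in>UNIV - {i0}. 4 * (s i / s' i)) * ((2 * d + 2) ^ CARD('d) * real (count s'))"
  proof (rule mult_mono)
    have "0 \<le> 2 * (s i / s' i) + 2 \<and> 2 * (s i / s' i) + 2 \<le> 4 * (s i / s' i)" for i
    proof -
      have "1 \<le> s i / s' i" using s(1)[of i] s(2)[of i] by simp
      then show ?thesis by linarith
    qed
    then show "(\<Prod>i\<in>UNIV - {i0}. 2 * (s i / s' i) + 2) \<le> (\<Prod>i\<in>UNIV - {i0}. 4 * (s i / s' i))"
      by (intro prod_mono) blast
    show "real (card (L \<inter> sbox (\<lambda>i. d * s' i))) \<le> (2 * d + 2) ^ CARD('d) * real (count s')"
      using count_scale_le[OF s(1) d1] by (simp add: count_def)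
    show "0 \<le> (\<Prod>i\<in>UNIV - {i0}. 4 * (s i / s' i))"
    proof (rule prod_nonneg)
      fix i show "0 \<le> 4 * (s i / s' i)" using s(1)[of i] s(2)[of i] by simp
    qed
  qed auto
  finally have 1: "real (count s) \<le> (\<Prod>i\<in>UNIV - {i0}. 4 * (s i / s' i)) * ((2 * d + 2) ^ CARD('d) * real (count s'))"
    by (simp add: count_def)
  have sp: "0 < s i / s' i" for i using s(1)[of i] s(2)[of i] by simp
  \<comment> \<open>Multiplying by \<open>4 * (s i0 / s' i0)\<close> completes the product over all
    coordinates; the quotient on the left is the gain.\<close>
  have "real (count s) * (s i0 / s' i0)
      \<le> (\<Prod>i\<in>UNIV - {i0}. 4 * (s i / s' i)) * ((2 * d + 2) ^ CARD('d) * real (count s')) * (4 * (s i0 / s' i0))"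
    using 1 sp[of i0] by (intro mult_mono 1) (auto intro: order_trans[OF _ 1])
  also have "\<dots> = (\<Prod>i\<in>UNIV. 4 * (s i / s' i)) * ((2 * d + 2) ^ CARD('d) * real (count s'))"
  proof -
    have "(\<Prod>i\<in>UNIV. 4 * (s i / s' i)) = 4 * (s i0 / s' i0) * (\<Prod>i\<in>UNIV - {i0}. 4 * (s i / s' i))"
      by (rule prod.remove) auto
    then show ?thesis by (simp only: mult_ac)
  qed
  also have "(\<Prod>i\<in>UNIV. 4 * (s i / s' i)) = 4 ^ CARD('d) * (\<Prod>i\<in>UNIV. s i / s' i)"
    by (simp add: prod.distrib del: times_divide_eq_right)
  finally show ?thesis by (simp add: d_def mult_ac add_ac)
qed

end

subsection \<open>Successive minima\<close>

lemma infnorm_le_iff_cart: "infnorm (x :: real ^ 'd::finite) \<le> r \<longleftrightarrow> (\<forall>i. \<bar>x $ i\<bar> \<le> r)"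
proof
  assume "infnorm x \<le> r"
  then show "\<forall>i. \<bar>x $ i\<bar> \<le> r" using component_le_infnorm_cart order_trans by blast
next
  assume *: "\<forall>i. \<bar>x $ i\<bar> \<le> r"
  show "infnorm x \<le> r"
    unfolding infnorm_cart using * by (intro cSup_least) auto
qed

context discrete_subgroup
begin

lemma sbox_const_iff: "v \<in> sbox (\<lambda>_. R) \<longleftrightarrow> infnorm v \<le> R"
  by (simp add: sbox_iff infnorm_le_iff_cart)

text \<open>Only finitely many norms of points of \<open>L\<close> lie in
  \<open>(\<rho>, \<rho> + 1]\<close>, so there is room above \<rho>. This makes the infimum in
  \<open>successive_min\<close> attained.\<close>

lemma sbox_gap:
  obtains \<rho>' where "\<rho> < \<rho>'" "L \<inter> sbox (\<lambda>_. \<rho>') = L \<inter> sbox (\<lambda>_. \<rho>)"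
proof -
  define F where "F = infnorm ` {v \<in> L \<inter> sbox (\<lambda>_. \<rho> + 1). \<rho> < infnorm v}"
  have F: "finite F" unfolding F_def by (intro finite_imageI finite_subset[OF _ fin[of "\<lambda>_. \<rho> + 1"]]) auto
  define m where "m = Min (insert (\<rho> + 1) F)"
  have m: "\<rho> < m" "m \<le> \<rho> + 1" unfolding m_def using F by (auto simp: F_def)
  have "L \<inter> sbox (\<lambda>_. (\<rho> + m) / 2) = L \<inter> sbox (\<lambda>_. \<rho>)"
  proof (intro equalityI subsetI)
    fix v assume v: "v \<in> L \<inter> sbox (\<lambda>_. (\<rho> + m) / 2)"
    then have vn: "infnorm v \<le> (\<rho> + m) / 2" by (simp add: sbox_const_iff)
    have "infnorm v \<le> \<rho>"
    proof (rule ccontr)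
      assume a: "\<not> infnorm v \<le> \<rho>"
      have "infnorm v \<le> \<rho> + 1" using vn m by simp
      then have "infnorm v \<in> F" using v a unfolding F_def by (auto simp: sbox_const_iff)
      then have "m \<le> infnorm v" unfolding m_def using F by simp
      then show False using vn m by simp
    qed
    then show "v \<in> L \<inter> sbox (\<lambda>_. \<rho>)" using v by (simp add: sbox_const_iff)
  next
    fix v assume v: "v \<in> L \<inter> sbox (\<lambda>_. \<rho>)"
    then show "v \<in> L \<inter> sbox (\<lambda>_. (\<rho> + m) / 2)" using m by (simp add: sbox_const_iff)
  qed
  then show ?thesis using that[of "(\<rho> + m) / 2"] m by simp
qed

text \<open>Cells are cut along an orthonormal basis of the span, so the number of directions is the
  dimension and not \<open>CARD('d)\<close>. Width \<open>R' / d\<close> forces a difference inside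
  a cell to have norm at most \<open>R'\<close>, and inner products with the basis are at most
  \<open>d * R\<close>; together this is the factor \<open>d ^ 2\<close>.\<close>

lemma count_dim_le:
  assumes R: "0 < R'" "R' \<le> R" and j: "dim (L \<inter> sbox (\<lambda>_. R)) \<le> j"
  shows "real (count (\<lambda>_. R)) \<le> (4 * CARD('d)\<^sup>2 * (R / R')) ^ j * real (count (\<lambda>_. R'))"
proof -
  define d where "d = real CARD('d)"
  have d1: "1 \<le> d" unfolding d_def by (simp add: Suc_leI)
  define V where "V = span (L \<inter> sbox (\<lambda>_. R))"
  obtain B where B: "B \<subseteq> V" "pairwise orthogonal B" "\<And>x. x \<in> B \<Longrightarrow> norm x = 1"
    "independent B" "card B = dim V" "span B = V"
    using orthonormal_basis_subspace[of V] unfolding V_def by (metis subspace_span)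
  have finB: "finite B" using B(4) independent_imp_finite by blast
  have cB: "card B \<le> j" using B(5) j unfolding V_def by simp
  have cBd: "real (card B) \<le> d" using B(5) dim_subset_UNIV[of V] unfolding d_def by simp
  have R0: "0 < R" using R by simp
  have normx: "norm x \<le> d * R" if "x \<in> sbox (\<lambda>_. R)" for x :: "real ^ 'd"
  proof -
    have "norm x \<le> (\<Sum>i\<in>UNIV. \<bar>x $ i\<bar>)" by (rule norm_le_l1_cart)
    also have "\<dots> \<le> (\<Sum>i\<in>(UNIV::'d set). R)" using that by (intro sum_mono) (auto simp: sbox_iff)
    finally show ?thesis by (simp add: d_def)
  qed
  have "real (card (L \<inter> sbox (\<lambda>_. R)))
      \<le> (\<Prod>b\<in>B. 2 * (d\<^sup>2 * (R / R')) + 2) * real (card (L \<inter> sbox (\<lambda>_. R')))"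
  proof (rule card_le_cells[where h = "\<lambda>b x. (x \<bullet> b) / (R' / d)"])
    show "finite B" by (rule finB)
    show "finite (L \<inter> sbox (\<lambda>_. R'))" by (rule fin)
    show "0 \<le> d\<^sup>2 * (R / R')" using R R0 by simp
  next
    fix x b assume x: "x \<in> L \<inter> sbox (\<lambda>_. R)" and b: "b \<in> B"
    have "\<bar>x \<bullet> b\<bar> \<le> d * R"
      using Cauchy_Schwarz_ineq2[of x b] B(3)[OF b] normx[of x] x by simp
    then have "\<bar>x \<bullet> b\<bar> / (R' / d) \<le> d * R / (R' / d)" using R d1 by (intro divide_right_mono) auto
    also have "\<dots> = d\<^sup>2 * (R / R')" by (simp add: power2_eq_square)
    finally show "\<bar>(x \<bullet> b) / (R' / d)\<bar> \<le> d\<^sup>2 * (R / R')" using R d1 by (simp add: abs_mult)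
  next
    fix x x' assume x: "x \<in> L \<inter> sbox (\<lambda>_. R)" "x' \<in> L \<inter> sbox (\<lambda>_. R)"
      and c: "\<And>b. b \<in> B \<Longrightarrow> \<bar>(x \<bullet> b) / (R' / d) - (x' \<bullet> b) / (R' / d)\<bar> < 1"
    define y where "y = x - x'"
    have yB: "y \<in> span B" unfolding y_def B(6) V_def using x by (intro span_diff span_base)
    have yb: "\<bar>y \<bullet> b\<bar> \<le> R' / d" if "b \<in> B" for b
    proof -
      have "\<bar>(y \<bullet> b) / (R' / d)\<bar> < 1"
        using c[OF that] unfolding y_def by (simp only: inner_diff_left diff_divide_distrib)
      moreover have "\<bar>(y \<bullet> b) / (R' / d)\<bar> = \<bar>y \<bullet> b\<bar> / (R' / d)" using R d1 by (simp add: abs_mult)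
      moreover have "0 < R' / d" using R d1 by simp
      ultimately show ?thesis by (simp only: divide_less_eq_1_pos less_imp_le)
    qed
    have "norm y = norm (\<Sum>b\<in>B. (y \<bullet> b) *\<^sub>R b)"
      using orthonormal_basis_expand[OF B(2,3) yB finB] by simp
    also have "\<dots> \<le> (\<Sum>b\<in>B. R' / d)"
      using yb B(3) by (intro sum_norm_le) auto
    also have "\<dots> = real (card B) * (R' / d)" by simp
    also have "\<dots> \<le> d * (R' / d)" using cBd R d1 by (intro mult_right_mono) auto
    also have "\<dots> = R'" using d1 by simp
    finally have "\<bar>y $ i\<bar> \<le> R'" for i using component_le_norm_cart[of y i] by linarith
    then show "x - x' \<in> L \<inter> sbox (\<lambda>_. R')" using x diff unfolding y_def by (auto simp: sbox_iff)
  qed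
  also have "(\<Prod>b\<in>B. 2 * (d\<^sup>2 * (R / R')) + 2) = (2 * (d\<^sup>2 * (R / R')) + 2) ^ card B"
    by simp
  also have "(2 * (d\<^sup>2 * (R / R')) + 2) ^ card B \<le> (4 * d\<^sup>2 * (R / R')) ^ j"
  proof -
    define X where "X = d\<^sup>2 * (R / R')"
    have "1 * 1 \<le> X" unfolding X_def using d1 R by (intro mult_mono) auto
    then have X1: "1 \<le> X" by simp
    have X4: "4 * d\<^sup>2 * (R / R') = 4 * X" by (simp add: X_def)
    have "(2 * X + 2) ^ card B \<le> (4 * X) ^ card B"
      by (rule power_mono) (use X1 in auto)
    also have "\<dots> \<le> (4 * X) ^ j" by (rule power_increasing) (use X1 cB in auto)
    finally have "(2 * X + 2) ^ card B \<le> (4 * X) ^ j" .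
    then show ?thesis unfolding X4 X_def[symmetric] .
  qed
  finally show ?thesis
    by (simp add: count_def d_def mult_right_mono)
qed

end

locale full_lattice = discrete_subgroup L for L :: "(real ^ 'd::finite) set" +
  assumes full: "span L = UNIV"
begin

lemma full_dim_sbox:
  obtains \<rho> where "0 < \<rho>" "dim (L \<inter> sbox (\<lambda>_. \<rho>)) = CARD('d)"
proof -
  obtain B where B: "B \<subseteq> L" "independent B" "L \<subseteq> span B" "card B = dim L"
    using basis_exists by blast
  have finB: "finite B" using B(2) independent_imp_finite by blast
  define \<rho> where "\<rho> = 1 + (\<Sum>v\<in>B. infnorm v)"
  have p: "0 < \<rho>" unfolding \<rho>_def by (smt (verit) infnorm_pos_le sum_nonneg)
  have "infnorm v \<le> \<rho>" if "v \<in> B" for v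
    using member_le_sum[OF that _ finB, of infnorm] infnorm_pos_le unfolding \<rho>_def by fastforce
  then have "B \<subseteq> L \<inter> sbox (\<lambda>_. \<rho>)" using B by (auto simp: sbox_const_iff)
  then have "card B \<le> dim (L \<inter> sbox (\<lambda>_. \<rho>))" using B(2) independent_card_le_dim by blast
  moreover have "dim L = CARD('d)" using full by (metis DIM_cart DIM_real dim_UNIV dim_span mult_1_right)
  ultimately have "dim (L \<inter> sbox (\<lambda>_. \<rho>)) = CARD('d)"
    using B(4) dim_subset_UNIV[of "L \<inter> sbox (\<lambda>_. \<rho>)"] by simp
  then show ?thesis using that p by blast
qed

text \<open>By \<open>sbox_gap\<close> the infimum is attained, so the minima are the radii at which
  the dimension spanned in a cube jumps. Later arguments use this form.\<close>

lemma successive_min_le_iff: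
  assumes i: "1 \<le> i" "i \<le> CARD('d)" and \<rho>: "0 < \<rho>"
  shows "successive_min i L \<le> \<rho> \<longleftrightarrow> i \<le> dim (L \<inter> sbox (\<lambda>_. \<rho>))"
proof -
  define P where "P = {\<rho>. \<rho> > 0 \<and> (\<exists>S. S \<subseteq> L \<inter> cbox (\<chi> j. - \<rho>) (\<chi> j. \<rho>) \<and> card S = i \<and> independent S)}"
  have P_iff: "\<rho> \<in> P \<longleftrightarrow> i \<le> dim (L \<inter> sbox (\<lambda>_. \<rho>))" if "0 < \<rho>" for \<rho>
  proof
    assume "\<rho> \<in> P"
    then show "i \<le> dim (L \<inter> sbox (\<lambda>_. \<rho>))"
      unfolding P_def sbox_const using independent_card_le_dim by blast
  next
    assume i: "i \<le> dim (L \<inter> sbox (\<lambda>_. \<rho>))"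
    obtain B where B: "B \<subseteq> L \<inter> sbox (\<lambda>_. \<rho>)" "independent B" "card B = dim (L \<inter> sbox (\<lambda>_. \<rho>))"
      using basis_exists by metis
    obtain S where "S \<subseteq> B" "card S = i" using obtain_subset_with_card_n i B(3) by metis
    then show "\<rho> \<in> P" unfolding P_def using that B independent_mono
      by (auto simp: sbox_const intro!: exI[of _ S])
  qed
  have sm: "successive_min i L = Inf P" unfolding successive_min_def P_def by simp
  have bdd: "bdd_below P" unfolding P_def by (intro bdd_belowI[of _ 0]) auto
  obtain \<rho>0 where \<rho>0: "0 < \<rho>0" "dim (L \<inter> sbox (\<lambda>_. \<rho>0)) = CARD('d)" using full_dim_sbox by blast
  then have ne: "P \<noteq> {}" using P_iff[of \<rho>0] i by auto
  show ?thesis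
  proof
    assume le: "successive_min i L \<le> \<rho>"
    show "i \<le> dim (L \<inter> sbox (\<lambda>_. \<rho>))"
    proof (rule ccontr)
      assume n: "\<not> i \<le> dim (L \<inter> sbox (\<lambda>_. \<rho>))"
      obtain \<rho>' where \<rho>': "\<rho> < \<rho>'" "L \<inter> sbox (\<lambda>_. \<rho>') = L \<inter> sbox (\<lambda>_. \<rho>)" using sbox_gap by blast
      have "\<rho>' \<le> x" if x: "x \<in> P" for x
      proof (rule ccontr)
        assume "\<not> \<rho>' \<le> x"
        then have "L \<inter> sbox (\<lambda>_. x) \<subseteq> L \<inter> sbox (\<lambda>_. \<rho>')" using sbox_mono[of "\<lambda>_. x" "\<lambda>_. \<rho>'"] by auto
        then have "dim (L \<inter> sbox (\<lambda>_. x)) \<le> dim (L \<inter> sbox (\<lambda>_. \<rho>))" using \<rho>' dim_subset by metis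
        moreover have "0 < x" using x unfolding P_def by simp
        ultimately show False using P_iff[of x] x n by simp
      qed
      then have "\<rho>' \<le> Inf P" using ne by (intro cInf_greatest)
      then show False using le \<rho>' sm by simp
    qed
  next
    assume "i \<le> dim (L \<inter> sbox (\<lambda>_. \<rho>))"
    then have "\<rho> \<in> P" using P_iff[OF \<rho>] by simp
    then show "successive_min i L \<le> \<rho>" unfolding sm using bdd by (rule cInf_lower)
  qed
qed

lemma dim_small:
  obtains \<epsilon> where "0 < \<epsilon>" "dim (L \<inter> sbox (\<lambda>_. \<epsilon>)) = 0"
proof -
  obtain \<epsilon> where e: "0 < \<epsilon>" "L \<inter> sbox (\<lambda>_. \<epsilon>) = L \<inter> sbox (\<lambda>_. 0)" using sbox_gap by blast
  have "sbox (\<lambda>_. 0) \<subseteq> {0 :: real ^ 'd}" by (auto simp: sbox_iff vec_eq_iff)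
  then have "dim (L \<inter> sbox (\<lambda>_. \<epsilon>)) = 0" unfolding e(2) dim_eq_0 by blast
  then show ?thesis using that e by blast
qed

lemma successive_min_pos:
  assumes i: "1 \<le> i" "i \<le> CARD('d)"
  shows "0 < successive_min i L"
proof -
  obtain \<epsilon> where e: "0 < \<epsilon>" "dim (L \<inter> sbox (\<lambda>_. \<epsilon>)) = 0" using dim_small by blast
  then have "\<not> successive_min i L \<le> \<epsilon>" using successive_min_le_iff[OF i, of \<epsilon>] i by linarith
  then show ?thesis using e by simp
qed

lemma successive_min_mono:
  assumes i: "1 \<le> i" "i \<le> i'" "i' \<le> CARD('d)"
  shows "successive_min i L \<le> successive_min i' L"
proof -
  have p: "0 < successive_min i' L" using successive_min_pos[of i'] i by simp
  then have "i' \<le> dim (L \<inter> sbox (\<lambda>_. successive_min i' L))"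
    using successive_min_le_iff[of i' "successive_min i' L"] i by simp
  then show ?thesis using successive_min_le_iff[of i, OF _ _ p] i by simp
qed

text \<open>The induction variable \<open>j\<close> bounds the dimension spanned at radius
  \<open>R\<close>. If that dimension is \<open>j + 1\<close>, the radius is lowered below the
  minimum \<open>l\<close> of index \<open>j + 1\<close>, where it is at most \<open>j\<close>. The
  price \<open>(R / l) ^ (j + 1)\<close> turns each factor \<open>l / successive_min i L\<close>
  into \<open>R / successive_min i L\<close> and supplies the new factor.\<close>

lemma count_le_prod_aux:
  assumes "j \<le> CARD('d)" "0 < R" "dim (L \<inter> sbox (\<lambda>_. R)) \<le> j"
  shows "real (count (\<lambda>_. R)) \<le> (8 * CARD('d)\<^sup>2) ^ (CARD('d) * j) * (\<Prod>i=1..j. max 1 (R / successive_min i L))"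
  using assms
proof (induction j arbitrary: R)
  case 0
  have "v = 0" if v: "v \<in> L \<inter> sbox (\<lambda>_. R)" for v
  proof -
    have "dim (L \<inter> sbox (\<lambda>_. R)) = 0" using 0 by simp
    then show "v = 0" using v unfolding dim_eq_0 by auto
  qed
  then have "L \<inter> sbox (\<lambda>_. R) \<subseteq> {0}" by blast
  then have "count (\<lambda>_. R) \<le> card {0 :: real ^ 'd}" unfolding count_def by (rule card_mono[rotated]) simp
  then show ?case by simp
next
  case (Suc j)
  define K :: real where "K = 8 * CARD('d)\<^sup>2"
  have d1: "1 \<le> CARD('d)" by (simp add: Suc_leI)
  then have K1: "1 \<le> K" unfolding K_def by (metis (no_types, lifting) le_numeral_extra(4) mult_le_mono nat_mult_1 of_nat_1 of_nat_le_iff one_le_numeral one_le_power)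
  let ?l = "\<lambda>i. successive_min i L"
  let ?m = "\<lambda>i. max 1 (R / ?l i)"
  show ?case
  proof (cases "dim (L \<inter> sbox (\<lambda>_. R)) \<le> j")
    case True
    have "real (count (\<lambda>_. R)) \<le> K ^ (CARD('d) * j) * (\<Prod>i=1..j. ?m i)"
      using Suc.IH[of R] Suc.prems True unfolding K_def by simp
    also have "\<dots> \<le> K ^ (CARD('d) * Suc j) * (\<Prod>i=1..Suc j. ?m i)"
    proof (intro mult_mono power_increasing K1)
      have "(\<Prod>i=1..j. ?m i) * 1 \<le> (\<Prod>i=1..j. ?m i) * ?m (Suc j)"
        by (intro mult_left_mono prod_nonneg) auto
      then show "(\<Prod>i=1..j. ?m i) \<le> (\<Prod>i=1..Suc j. ?m i)" by simp
    qed (use K1 in \<open>auto intro!: prod_nonneg\<close>)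
    finally show ?thesis unfolding K_def by simp
  next
    case False
    define l where "l = ?l (Suc j)"
    have j: "Suc j \<le> CARD('d)" using Suc.prems by simp
    have lR: "l \<le> R" unfolding l_def using successive_min_le_iff[of "Suc j" R] False j Suc.prems by simp
    have l0: "0 < l" unfolding l_def using successive_min_pos[of "Suc j"] j by simp
    have dl: "dim (L \<inter> sbox (\<lambda>_. l / 2)) \<le> j"
      using successive_min_le_iff[of "Suc j" "l / 2"] j l0 unfolding l_def by simp
    have lm: "0 < ?l i" "?l i \<le> l" if "i \<in> {1..j}" for i
      using that j successive_min_pos[of i] successive_min_mono[of i "Suc j"] unfolding l_def by auto
    \<comment> \<open>The radius \<open>l / 2\<close> lies strictly below the minimum
      \<open>l\<close>; the factor 2 lost here is why \<open>K\<close> has 8 in place of 4.\<close>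
    have "real (count (\<lambda>_. R)) \<le> (4 * CARD('d)\<^sup>2 * (R / (l / 2))) ^ Suc j * real (count (\<lambda>_. l / 2))"
      using count_dim_le[of "l / 2" R "Suc j"] l0 lR Suc.prems by simp
    also have "\<dots> \<le> (4 * CARD('d)\<^sup>2 * (R / (l / 2))) ^ Suc j
        * (K ^ (CARD('d) * j) * (\<Prod>i=1..j. max 1 (l / 2 / ?l i)))"
      using Suc.IH[of "l / 2"] dl j l0 lR unfolding K_def by (intro mult_left_mono) auto
    also have "4 * CARD('d)\<^sup>2 * (R / (l / 2)) = K * (R / l)" unfolding K_def by simp
    also have "(K * (R / l)) ^ Suc j * (K ^ (CARD('d) * j) * (\<Prod>i=1..j. max 1 (l / 2 / ?l i)))
       \<le> (K ^ CARD('d) * (R / l) ^ Suc j) * (K ^ (CARD('d) * j) * (\<Prod>i=1..j. l / ?l i))"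
    proof (intro mult_mono prod_mono conjI)
      show "(K * (R / l)) ^ Suc j \<le> K ^ CARD('d) * (R / l) ^ Suc j"
        unfolding power_mult_distrib using K1 j l0 lR by (intro mult_right_mono power_increasing) auto
    next
      fix i assume i: "i \<in> {1..j}"
      have "1 \<le> l / ?l i" using lm[OF i] by simp
      moreover have "l / 2 / ?l i \<le> l / ?l i" by (rule divide_right_mono) (use lm[OF i] l0 in auto)
      ultimately show "max 1 (l / 2 / ?l i) \<le> l / ?l i" by simp
    qed (use K1 l0 lR in \<open>auto intro!: prod_nonneg mult_nonneg_nonneg\<close>)
    also have "\<dots> = K ^ (CARD('d) * Suc j) * ((R / l) * ((\<Prod>i=1..j. R / l) * (\<Prod>i=1..j. l / ?l i)))"
      by (simp add: power_add mult_ac)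
    also have "(\<Prod>i=1..j. R / l) * (\<Prod>i=1..j. l / ?l i) = (\<Prod>i=1..j. R / ?l i)"
      unfolding prod.distrib[symmetric] using l0 by (intro prod.cong) auto
    also have "K ^ (CARD('d) * Suc j) * (R / l * (\<Prod>i=1..j. R / ?l i))
      \<le> K ^ (CARD('d) * Suc j) * (?m (Suc j) * (\<Prod>i=1..j. ?m i))"
    proof (intro mult_left_mono mult_mono prod_mono conjI)
      show "R / l \<le> ?m (Suc j)" unfolding l_def by simp
      show "0 \<le> (\<Prod>i=1..j. R / ?l i)" using lm l0 lR by (intro prod_nonneg) (auto intro!: divide_nonneg_pos)
      show "0 \<le> R / ?l i" if "i \<in> {1..j}" for i using lm[OF that] l0 lR by auto
    qed (use K1 in auto)
    also have "\<dots> = K ^ (CARD('d) * Suc j) * (\<Prod>i=1..Suc j. ?m i)" by (simp add: mult_ac)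
    finally show ?thesis unfolding K_def of_nat_power .
  qed
qed

text \<open>Greedy choice: the cube of radius \<open>successive_min (Suc j) L\<close> spans
  dimension at least \<open>j + 1\<close>, hence contains a lattice vector outside the span of the
  \<open>j\<close> vectors already found.\<close>

lemma minimal_vectors:
  assumes "j \<le> CARD('d)"
  shows "\<exists>v. (\<forall>i\<in>{1..j}. v i \<in> L \<and> infnorm (v i) \<le> successive_min i L)
     \<and> inj_on v {1..j} \<and> independent (v ` {1..j})"
  using assms
proof (induction j)
  case 0
  then show ?case by (simp add: independent_empty)
next
  case (Suc j)
  then obtain v where v: "\<forall>i\<in>{1..j}. v i \<in> L \<and> infnorm (v i) \<le> successive_min i L"
    "inj_on v {1..j}" "independent (v ` {1..j})" by auto
  let ?l = "successive_min (Suc j) L"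
  have "0 < ?l" using successive_min_pos[of "Suc j"] Suc.prems by simp
  then have d: "Suc j \<le> dim (L \<inter> sbox (\<lambda>_. ?l))"
    using successive_min_le_iff[of "Suc j" ?l] Suc.prems by simp
  have "\<not> L \<inter> sbox (\<lambda>_. ?l) \<subseteq> span (v ` {1..j})"
  proof
    assume "L \<inter> sbox (\<lambda>_. ?l) \<subseteq> span (v ` {1..j})"
    then have "dim (L \<inter> sbox (\<lambda>_. ?l)) \<le> card (v ` {1..j})" by (intro dim_le_card) auto
    also have "\<dots> \<le> j" using card_image_le[of "{1..j}" v] by simp
    finally show False using d by simp
  qed
  then obtain x where x: "x \<in> L" "infnorm x \<le> ?l" "x \<notin> span (v ` {1..j})"
    unfolding subset_iff Int_iff sbox_const_iff by blast
  then have nx: "x \<notin> v ` {1..j}" by (metis span_base)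
  define v' where "v' = v(Suc j := x)"
  have im: "v' ` {1..j} = v ` {1..j}" unfolding v'_def by (intro image_cong) auto
  have s: "{1..Suc j} = insert (Suc j) {1..j}" by auto
  have "independent (v' ` {1..Suc j})"
    unfolding s image_insert im using independent_insertI[OF x(3) v(3)] by (simp add: v'_def)
  moreover have "inj_on v' {1..Suc j}"
  proof -
    have "inj_on v' {1..j}" unfolding v'_def
      by (rule inj_on_fun_updI[OF v(2)]) (rule nx)
    moreover have "v' (Suc j) \<notin> v' ` {1..j}" unfolding im using nx by (simp add: v'_def)
    ultimately show ?thesis unfolding s by (simp add: inj_on_insert)
  qed
  moreover have "\<forall>i\<in>{1..Suc j}. v' i \<in> L \<and> infnorm (v' i) \<le> successive_min i L"
    using v(1) x by (auto simp: v'_def)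
  ultimately show ?case by blast
qed

text \<open>The combinations of \<open>minimal_vectors\<close> with natural coefficients at most
  \<open>R / (d * successive_min i L)\<close> are distinct by independence, and they stay in the
  cube because each of the \<open>d\<close> summands takes at most \<open>R / d\<close>.\<close>

lemma prod_le_count:
  assumes R: "0 < R"
  shows "(\<Prod>i=1..CARD('d). max 1 (R / successive_min i L)) \<le> CARD('d) ^ CARD('d) * real (count (\<lambda>_. R))"
proof -
  define d where "d = CARD('d)"
  have d1: "1 \<le> d" unfolding d_def by (simp add: Suc_leI)
  let ?l = "\<lambda>i. successive_min i L"
  obtain v where v: "\<forall>i\<in>{1..d}. v i \<in> L \<and> infnorm (v i) \<le> ?l i" "inj_on v {1..d}" "independent (v ` {1..d})"
    using minimal_vectors[of d] unfolding d_def by auto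
  have l0: "0 < ?l i" if "i \<in> {1..d}" for i using that successive_min_pos[of i] unfolding d_def by simp
  define n where "n i = nat \<lfloor>R / (d * ?l i)\<rfloor>" for i
  have n: "real (n i) * ?l i \<le> R / d" if "i \<in> {1..d}" for i
  proof -
    have "real (n i) \<le> R / (d * ?l i)" unfolding n_def using R l0[OF that] by simp
    then have "real (n i) * ?l i \<le> R / (d * ?l i) * ?l i" using l0[OF that] by (intro mult_right_mono) auto
    then show ?thesis using l0[OF that] by simp
  qed
  define F where "F c = (\<Sum>i=1..d. real (c i) *\<^sub>R v i)" for c :: "nat \<Rightarrow> nat"
  define C where "C = PiE {1..d} (\<lambda>i. {0..n i})"
  have "F ` C \<subseteq> L \<inter> sbox (\<lambda>_. R)"
  proof clarify
    fix c assume c: "c \<in> C"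
    have ci: "c i \<le> n i" if "i \<in> {1..d}" for i using c that unfolding C_def by (auto simp: PiE_def Pi_def)
    have "F c \<in> L" unfolding F_def using v(1) by (intro sum of_nat_scale) auto
    moreover have "\<bar>F c $ k\<bar> \<le> R" for k
    proof -
      have "\<bar>F c $ k\<bar> = \<bar>\<Sum>i=1..d. real (c i) * v i $ k\<bar>" unfolding F_def by simp
      also have "\<dots> \<le> (\<Sum>i=1..d. \<bar>real (c i) * v i $ k\<bar>)" by (rule sum_abs)
      also have "\<dots> \<le> (\<Sum>i=1..d. R / d)"
      proof (rule sum_mono)
        fix i assume i: "i \<in> {1..d}"
        have "\<bar>v i $ k\<bar> \<le> ?l i" using component_le_infnorm_cart[of "v i" k] v(1) i by fastforce
        then have "real (c i) * \<bar>v i $ k\<bar> \<le> real (n i) * ?l i" using ci[OF i] by (intro mult_mono) auto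
        then show "\<bar>real (c i) * v i $ k\<bar> \<le> R / d" using n[OF i] by (simp add: abs_mult)
      qed
      also have "\<dots> = R" using d1 by simp
      finally show ?thesis .
    qed
    ultimately show "F c \<in> L \<inter> sbox (\<lambda>_. R)" by (simp add: sbox_iff)
  qed
  moreover have "inj_on F C"
  proof (rule inj_onI)
    fix c c' assume c: "c \<in> C" "c' \<in> C" and eq: "F c = F c'"
    have "(\<Sum>i=1..d. (real (c i) - real (c' i)) *\<^sub>R v i) = 0"
      using eq unfolding F_def by (simp add: scaleR_left_diff_distrib sum_subtractf)
    also have "(\<Sum>i=1..d. (real (c i) - real (c' i)) *\<^sub>R v i)
        = (\<Sum>x\<in>v ` {1..d}. (real (c (the_inv_into {1..d} v x)) - real (c' (the_inv_into {1..d} v x))) *\<^sub>R x)"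
      by (subst sum.reindex[OF v(2)]) (auto intro!: sum.cong simp: the_inv_into_f_f[OF v(2)] simp del: One_nat_def)
    finally have z: "(\<Sum>x\<in>v ` {1..d}. (real (c (the_inv_into {1..d} v x)) - real (c' (the_inv_into {1..d} v x))) *\<^sub>R x) = 0"
      by simp
    have ci: "c i = c' i" if i: "i \<in> {1..d}" for i
    proof -
      have "real (c (the_inv_into {1..d} v (v i))) - real (c' (the_inv_into {1..d} v (v i))) = 0"
        by (rule independentD[OF v(3) _ subset_refl z imageI[OF i]]) simp
      then show ?thesis unfolding the_inv_into_f_f[OF v(2) i] by simp
    qed
    show "c = c'" using c unfolding C_def by (rule PiE_ext) (rule ci)
  qed
  ultimately have "card C \<le> count (\<lambda>_. R)" unfolding count_def using fin by (metis card_inj_on_le)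
  moreover have "card C = (\<Prod>i=1..d. n i + 1)" unfolding C_def by (subst card_PiE) auto
  moreover have "(\<Prod>i=1..d. max 1 (R / ?l i)) \<le> (\<Prod>i=1..d. real d * real (n i + 1))"
  proof (intro prod_mono conjI)
    fix i assume i: "i \<in> {1..d}"
    have "R / (d * ?l i) \<le> real (n i + 1)" unfolding n_def by linarith
    then have "real d * (R / (d * ?l i)) \<le> real d * real (n i + 1)" by (intro mult_left_mono) auto
    moreover have "real d * (R / (d * ?l i)) = R / ?l i" using d1 by simp
    moreover have "1 * 1 \<le> real d * real (n i + 1)" using d1 by (intro mult_mono) auto
    ultimately show "max 1 (R / ?l i) \<le> real d * real (n i + 1)" by simp
  qed auto
  moreover have "(\<Prod>i=1..d. real d * real (n i + 1)) = real d ^ d * real (\<Prod>i=1..d. n i + 1)"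
    by (simp only: prod.distrib of_nat_prod) simp
  ultimately have "(\<Prod>i=1..d. max 1 (R / ?l i)) \<le> real d ^ d * real (card C)" by simp
  also have "\<dots> \<le> real d ^ d * real (count (\<lambda>_. R))" using \<open>card C \<le> count (\<lambda>_. R)\<close> by (intro mult_left_mono) auto
  finally show ?thesis by (simp add: d_def)
qed

text \<open>Both bounds follow from \<open>min R l * max 1 (R / l) = R\<close>.\<close>

lemma minima_product_bounds:
  fixes R :: real
  assumes R: "0 < R"
  shows "(\<Prod>i=1..CARD('d). min R (successive_min i L)) * real (count (\<lambda>_. R))
           \<le> (8 * CARD('d)\<^sup>2) ^ (CARD('d) * CARD('d)) * R ^ CARD('d)"
    and "R ^ CARD('d)
           \<le> CARD('d) ^ CARD('d) * ((\<Prod>i=1..CARD('d). min R (successive_min i L)) * real (count (\<lambda>_. R)))"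
proof -
  let ?d = "CARD('d)"
  let ?l = "\<lambda>i. successive_min i L"
  let ?min = "\<Prod>i=1..?d. min R (?l i)" and ?max = "\<Prod>i=1..?d. max 1 (R / ?l i)"
  have l0: "0 < ?l i" if "i \<in> {1..?d}" for i using that successive_min_pos[of i] by simp
  have mm: "min R (?l i) * max 1 (R / ?l i) = R" if "i \<in> {1..?d}" for i
    using l0[OF that] R by (auto simp: min_def max_def)
  have "?min * ?max = (\<Prod>i=1..?d. R)"
    unfolding prod.distrib[symmetric] by (rule prod.cong[OF refl mm])
  then have eq: "?min * ?max = R ^ ?d" by simp
  have min0: "0 \<le> ?min" using l0 R by (intro prod_nonneg) (simp add: less_imp_le)
  have "real (count (\<lambda>_. R)) \<le> (8 * ?d\<^sup>2) ^ (?d * ?d) * ?max"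
    by (rule count_le_prod_aux) (use R dim_subset_UNIV[of "L \<inter> sbox (\<lambda>_. R)"] in auto)
  then have "?min * real (count (\<lambda>_. R)) \<le> ?min * ((8 * ?d\<^sup>2) ^ (?d * ?d) * ?max)"
    using min0 by (rule mult_left_mono)
  then show "?min * real (count (\<lambda>_. R)) \<le> (8 * ?d\<^sup>2) ^ (?d * ?d) * R ^ ?d"
    unfolding eq[symmetric] by (simp only: mult_ac)
  have "?min * ?max \<le> ?min * (?d ^ ?d * real (count (\<lambda>_. R)))"
    using prod_le_count[OF R] min0 by (rule mult_left_mono)
  then show "R ^ ?d \<le> ?d ^ ?d * (?min * real (count (\<lambda>_. R)))"
    unfolding eq[symmetric] by (simp only: mult_ac)
qed

end

subsection \<open>Integer vectors\<close>

lemma int_vecs_eq_range: "int_vecs = range (\<lambda>f :: 'd::finite \<Rightarrow> int. \<chi> i. real_of_int (f i))"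
proof (intro equalityI subsetI)
  fix x :: "real ^ 'd" assume "x \<in> int_vecs"
  then have "x = (\<chi> i. real_of_int ((\<lambda>i. \<lfloor>x $ i\<rfloor>) i))"
    by (auto simp: int_vecs_def vec_eq_iff Ints_def)
  then show "x \<in> range (\<lambda>f :: 'd \<Rightarrow> int. \<chi> i. real_of_int (f i))" by (rule range_eqI[where x = "\<lambda>i. \<lfloor>x $ i\<rfloor>"])
qed (auto simp: int_vecs_def)

lemma countable_int_vecs: "countable (int_vecs :: (real ^ 'd::finite) set)"
  unfolding int_vecs_eq_range by simp

lemma finite_int_vecs_sbox: "finite (int_vecs \<inter> sbox s :: (real ^ 'd::finite) set)"
proof (rule finite_subset)
  show "int_vecs \<inter> sbox s \<subseteq> (\<lambda>f. \<chi> i. real_of_int (f i)) ` (PiE UNIV (\<lambda>i::'d. {-\<lceil>s i\<rceil>..\<lceil>s i\<rceil>}))"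
  proof clarify
    fix x :: "real ^ 'd" assume x: "x \<in> int_vecs" "x \<in> sbox s"
    then obtain f where f: "x = (\<chi> i. real_of_int (f i))" unfolding int_vecs_eq_range by auto
    have "f i \<in> {-\<lceil>s i\<rceil>..\<lceil>s i\<rceil>}" for i
    proof -
      have "\<bar>real_of_int (f i)\<bar> \<le> s i" using x(2) unfolding f sbox_iff by simp
      then have "real_of_int \<bar>f i\<bar> \<le> s i" by simp
      then have "\<bar>f i\<bar> \<le> \<lceil>s i\<rceil>" by linarith
      then show ?thesis by auto
    qed
    then show "x \<in> (\<lambda>f. \<chi> i. real_of_int (f i)) ` (PiE UNIV (\<lambda>i::'d. {-\<lceil>s i\<rceil>..\<lceil>s i\<rceil>}))"
      unfolding f by (intro imageI) (simp add: PiE_UNIV_domain)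
  qed
  show "finite ((\<lambda>f. \<chi> i. real_of_int (f i)) ` (PiE UNIV (\<lambda>i::'d. {-\<lceil>s i\<rceil>..\<lceil>s i\<rceil>})) :: (real ^ 'd) set)"
    by (intro finite_imageI finite_PiE) auto
qed

lemma card_int_vecs_sbox:
  fixes T :: real
  assumes "0 \<le> T"
  shows "card (int_vecs \<inter> sbox (\<lambda>_. T) :: (real ^ 'd::finite) set) = nat (2 * \<lfloor>T\<rfloor> + 1) ^ CARD('d)"
proof -
  let ?g = "\<lambda>f :: 'd \<Rightarrow> int. (\<chi> i. real_of_int (f i)) :: real ^ 'd"
  have inj: "inj ?g" by (auto simp: inj_def vec_eq_iff)
  have k: "\<bar>real_of_int k\<bar> \<le> T \<longleftrightarrow> k \<in> {-\<lfloor>T\<rfloor>..\<lfloor>T\<rfloor>}" for k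
    by (auto simp: abs_le_iff le_floor_iff minus_le_iff)
  have "x \<in> int_vecs \<inter> sbox (\<lambda>_. T) \<longleftrightarrow> x \<in> ?g ` (PiE UNIV (\<lambda>_. {-\<lfloor>T\<rfloor>..\<lfloor>T\<rfloor>}))" for x
  proof -
    have "x \<in> int_vecs \<inter> sbox (\<lambda>_. T) \<longleftrightarrow> (\<exists>f. x = ?g f \<and> (\<forall>i. \<bar>real_of_int (f i)\<bar> \<le> T))"
      unfolding int_vecs_eq_range by (auto simp: sbox_iff)
    also have "\<dots> \<longleftrightarrow> x \<in> ?g ` (PiE UNIV (\<lambda>_. {-\<lfloor>T\<rfloor>..\<lfloor>T\<rfloor>}))"
      unfolding k PiE_UNIV_domain image_def mem_Collect_eq Bex_def Pi_iff by (rule ex_cong1) auto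
    finally show ?thesis .
  qed
  then have "int_vecs \<inter> sbox (\<lambda>_. T) = ?g ` (PiE UNIV (\<lambda>_. {-\<lfloor>T\<rfloor>..\<lfloor>T\<rfloor>}))"
    by (rule set_eqI)
  then have "card (int_vecs \<inter> sbox (\<lambda>_. T) :: (real ^ 'd) set) = card (PiE (UNIV :: 'd set) (\<lambda>_. {-\<lfloor>T\<rfloor>..\<lfloor>T\<rfloor>}))"
    using inj by (simp add: card_image inj_on_subset)
  also have "\<dots> = nat (2 * \<lfloor>T\<rfloor> + 1) ^ CARD('d)" by (subst card_PiE) (simp_all add: algebra_simps)
  finally show ?thesis .
qed

lemma card_int_vecs_sbox_bounds:
  fixes T :: real
  assumes "0 \<le> T"
  shows "T ^ CARD('d) \<le> real (card (int_vecs \<inter> sbox (\<lambda>_. T) :: (real ^ 'd::finite) set))"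
    and "real (card (int_vecs \<inter> sbox (\<lambda>_. T) :: (real ^ 'd::finite) set)) \<le> (2 * T + 1) ^ CARD('d)"
proof -
  have f0: "0 \<le> \<lfloor>T\<rfloor>" using assms by simp
  then have n: "real (nat (2 * \<lfloor>T\<rfloor> + 1)) = 2 * real_of_int \<lfloor>T\<rfloor> + 1" by simp
  have "T \<le> 2 * real_of_int \<lfloor>T\<rfloor> + 1" using f0 by linarith
  then show "T ^ CARD('d) \<le> real (card (int_vecs \<inter> sbox (\<lambda>_. T) :: (real ^ 'd) set))"
    unfolding card_int_vecs_sbox[OF assms] of_nat_power n using assms by (intro power_mono) auto
  have "2 * real_of_int \<lfloor>T\<rfloor> + 1 \<le> 2 * T + 1" by simp
  then show "real (card (int_vecs \<inter> sbox (\<lambda>_. T) :: (real ^ 'd) set)) \<le> (2 * T + 1) ^ CARD('d)"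
    unfolding card_int_vecs_sbox[OF assms] of_nat_power n using f0 by (intro power_mono) auto
qed

subsection \<open>The lattice\<close>

text \<open>The image of \<open>(p, q)\<close> under \<open>u_mat A\<close>. Here \<open>p\<close>
  enters with a plus sign, whereas \<open>N_count\<close> subtracts it; hence the passage from
  \<open>p\<close> to \<open>- p\<close> later on.\<close>

definition lat_pt :: "real ^ 'n::finite ^ 'm::finite \<Rightarrow> real ^ 'm \<Rightarrow> real ^ 'n \<Rightarrow> real ^ ('m + 'n)" where
  "lat_pt A p q = (\<chi> k. case k of Inl i \<Rightarrow> (A *v q) $ i + p $ i | Inr j \<Rightarrow> q $ j)"

lemma lat_pt_nth [simp]:
  "lat_pt A p q $ Inl i = (A *v q) $ i + p $ i" "lat_pt A p q $ Inr j = q $ j"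
  by (simp_all add: lat_pt_def)

lemma all_sum_iff: "(\<forall>k :: 'a + 'b. P k) \<longleftrightarrow> (\<forall>i. P (Inl i)) \<and> (\<forall>j. P (Inr j))"
  by (metis sum.exhaust)

lemma lat_pt_eq_iff: "lat_pt A p q = lat_pt A p' q' \<longleftrightarrow> p = p' \<and> q = q'"
proof
  assume *: "lat_pt A p q = lat_pt A p' q'"
  then have "q = q'" by (simp add: vec_eq_iff all_sum_iff)
  with * show "p = p' \<and> q = q'" by (simp add: vec_eq_iff all_sum_iff)
qed simp

lemma sum_UNIV_Plus: "(\<Sum>k\<in>(UNIV :: ('a::finite + 'b::finite) set). f k) = (\<Sum>i\<in>UNIV. f (Inl i)) + (\<Sum>j\<in>UNIV. f (Inr j))"
  unfolding UNIV_Plus_UNIV[symmetric] by (subst sum.Plus) auto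

lemma u_mat_mult:
  "u_mat A *v x = lat_pt A (\<chi> i. x $ Inl i) (\<chi> j. x $ Inr j)"
  by (auto simp: vec_eq_iff all_sum_iff matrix_vector_mult_def u_mat_def sum_UNIV_Plus
      if_distrib[of "\<lambda>x. x * _"] cong: if_cong)

lemma Lambda_eq: "Lambda A = (\<lambda>(p, q). lat_pt A p q) ` (int_vecs \<times> int_vecs)"
proof (intro equalityI subsetI)
  fix v assume "v \<in> Lambda A"
  then obtain x where x: "x \<in> int_vecs" "v = u_mat A *v x" unfolding Lambda_def by auto
  then show "v \<in> (\<lambda>(p, q). lat_pt A p q) ` (int_vecs \<times> int_vecs)"
    unfolding u_mat_mult
    by (intro rev_image_eqI[of "(\<chi> i. x $ Inl i, \<chi> j. x $ Inr j)"]) (auto simp: int_vecs_def)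
next
  fix v assume "v \<in> (\<lambda>(p, q). lat_pt A p q) ` (int_vecs \<times> int_vecs)"
  then obtain p q where pq: "p \<in> int_vecs" "q \<in> int_vecs" "v = lat_pt A p q" by auto
  define x :: "real ^ ('a + 'b)" where "x = (\<chi> k. case k of Inl i \<Rightarrow> p $ i | Inr j \<Rightarrow> q $ j)"
  have "v = u_mat A *v x" unfolding u_mat_mult pq(3) by (simp add: x_def)
  moreover have "x \<in> int_vecs" using pq by (auto simp: int_vecs_def x_def all_sum_iff)
  ultimately show "v \<in> Lambda A" unfolding Lambda_def by blast
qed

lemma lat_pt_in_Lambda: "p \<in> int_vecs \<Longrightarrow> q \<in> int_vecs \<Longrightarrow> lat_pt A p q \<in> Lambda A"
  unfolding Lambda_eq by blast

lemma countable_Lambda: "countable (Lambda A)"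
  unfolding Lambda_eq by (intro countable_image countable_SIGMA countable_int_vecs)

lemma int_vecs_diff: "x \<in> int_vecs \<Longrightarrow> y \<in> int_vecs \<Longrightarrow> x - y \<in> int_vecs"
  by (auto simp: int_vecs_def)

lemma axis_int_vecs: "axis i 1 \<in> int_vecs"
  by (auto simp: int_vecs_def axis_def)

lemma discrete_subgroup_Lambda:
  fixes A :: "real ^ 'n::finite ^ 'm::finite"
  shows "discrete_subgroup (Lambda A)"
proof
  have "lat_pt A 0 0 = 0" by (auto simp: vec_eq_iff all_sum_iff)
  then show "0 \<in> Lambda A" using lat_pt_in_Lambda[OF int_vecs_0 int_vecs_0, of A] by simp
next
  fix x y assume "x \<in> Lambda A" "y \<in> Lambda A"
  then obtain p q p' q' where *: "x = lat_pt A p q" "y = lat_pt A p' q'"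
    "p \<in> int_vecs" "q \<in> int_vecs" "p' \<in> int_vecs" "q' \<in> int_vecs" unfolding Lambda_eq by auto
  have "x - y = lat_pt A (p - p') (q - q')"
    unfolding * by (auto simp: vec_eq_iff all_sum_iff matrix_vector_mult_diff_distrib)
  then show "x - y \<in> Lambda A" using * by (auto intro!: lat_pt_in_Lambda int_vecs_diff)
next
  fix s :: "'m + 'n \<Rightarrow> real"
  define Q where "Q = int_vecs \<inter> sbox (\<lambda>j. s (Inr j))"
  define P where "P q = int_vecs \<inter> sbox (\<lambda>i. s (Inl i) + \<bar>(A *v q) $ i\<bar>)" for q
  show "finite (Lambda A \<inter> sbox s)"
  proof (rule finite_subset)
    show "Lambda A \<inter> sbox s \<subseteq> (\<lambda>(q, p). lat_pt A p q) ` (SIGMA q:Q. P q)"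
    proof clarify
      fix v assume v: "v \<in> Lambda A" "v \<in> sbox s"
      then obtain p q where pq: "v = lat_pt A p q" "p \<in> int_vecs" "q \<in> int_vecs" unfolding Lambda_eq by auto
      have b: "\<And>i. \<bar>(A *v q) $ i + p $ i\<bar> \<le> s (Inl i)" "\<And>j. \<bar>q $ j\<bar> \<le> s (Inr j)"
        using v(2) unfolding pq sbox_iff all_sum_iff by simp_all
      have "\<bar>p $ i\<bar> \<le> s (Inl i) + \<bar>(A *v q) $ i\<bar>" for i using b(1)[of i] by linarith
      then have "q \<in> Q" "p \<in> P q" using pq b(2) unfolding Q_def P_def by (auto simp: sbox_iff)
      then show "v \<in> (\<lambda>(q, p). lat_pt A p q) ` (SIGMA q:Q. P q)" unfolding pq by force
    qed
    show "finite ((\<lambda>(q, p). lat_pt A p q) ` (SIGMA q:Q. P q))"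
      unfolding Q_def P_def by (intro finite_imageI finite_SigmaI finite_int_vecs_sbox)
  qed
qed

lemma axis_in_span_imp_UNIV:
  fixes S :: "(real ^ 'd::finite) set"
  assumes "\<And>k. axis k 1 \<in> span S"
  shows "span S = UNIV"
proof -
  have "x \<in> span S" for x
  proof -
    have "x = (\<Sum>k\<in>UNIV. x $ k *\<^sub>R axis k 1)"
      using basis_expansion[of x] by (simp add: scalar_mult_eq_scaleR)
    also have "\<dots> \<in> span S" by (intro span_sum span_scale assms)
    finally show ?thesis .
  qed
  then show ?thesis by blast
qed

lemma span_Lambda: "span (Lambda A) = UNIV"
proof (rule axis_in_span_imp_UNIV)
  have Inl: "axis (Inl i) 1 \<in> span (Lambda A)" for i
  proof -
    have "axis (Inl i) 1 = lat_pt A (axis i 1) 0"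
      by (auto simp: vec_eq_iff all_sum_iff axis_def)
    then show ?thesis using lat_pt_in_Lambda[OF axis_int_vecs int_vecs_0] by (metis span_base)
  qed
  fix k
  show "axis k 1 \<in> span (Lambda A)"
  proof (cases k)
    case (Inr j)
    have "axis (Inr j) 1 = lat_pt A 0 (axis j 1) - (\<Sum>i\<in>UNIV. A $ i $ j *\<^sub>R axis (Inl i) 1)"
      by (auto simp: vec_eq_iff all_sum_iff axis_def matrix_vector_mult_def if_distrib cong: if_cong)
    also have "\<dots> \<in> span (Lambda A)"
      by (intro span_diff span_sum span_scale Inl span_base lat_pt_in_Lambda axis_int_vecs int_vecs_0)
    finally show ?thesis unfolding Inr .
  qed (use Inl in simp)
qed

section \<open>Boxes adapted to the two factors, and the sets \<open>U(r, T)\<close>\<close>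

definition sides :: "real \<Rightarrow> real \<Rightarrow> 'm + 'n \<Rightarrow> real" where
  "sides r T = case_sum (\<lambda>_. r) (\<lambda>_. T)"

lemma sides_simps [simp]: "sides r T (Inl i) = r" "sides r T (Inr j) = T"
  by (simp_all add: sides_def)

lemma mult_sides: "c * sides r T k = sides (c * r) (c * T) k"
  by (cases k) auto

lemma sides_mono: "r \<le> r' \<Longrightarrow> T \<le> T' \<Longrightarrow> sides r T k \<le> sides r' T' k"
  by (cases k) auto

lemma sbox_sides_iff: "v \<in> sbox (sides r T) \<longleftrightarrow> (\<forall>i. \<bar>v $ Inl i\<bar> \<le> r) \<and> (\<forall>j. \<bar>v $ Inr j\<bar> \<le> T)"
  by (simp add: sbox_iff all_sum_iff)

definition emb :: "real ^ 'm::finite \<Rightarrow> real ^ ('m + 'n::finite)" where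
  "emb b = (\<chi> k. case k of Inl i \<Rightarrow> b $ i | Inr j \<Rightarrow> 0)"

lemma emb_nth [simp]: "emb b $ Inl i = b $ i" "emb b $ Inr j = 0"
  by (simp_all add: emb_def)

definition fst_part :: "real ^ ('m::finite + 'n::finite) \<Rightarrow> real ^ 'm" where
  "fst_part v = (\<chi> i. v $ Inl i)"

lemma fst_part_nth [simp]: "fst_part v $ i = v $ Inl i"
  by (simp add: fst_part_def)

definition cube :: "real ^ 'm::finite \<Rightarrow> real \<Rightarrow> (real ^ 'm) set" where
  "cube y r = {b. \<forall>i. \<bar>y $ i - b $ i\<bar> \<le> r}"

lemma cube_iff: "b \<in> cube y r \<longleftrightarrow> (\<forall>i. \<bar>y $ i - b $ i\<bar> \<le> r)"
  by (simp add: cube_def)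

lemma cube_eq_cbox: "cube y r = cbox (\<chi> i. y $ i - r) (\<chi> i. y $ i + r)"
  by (auto simp: cube_def mem_box_cart abs_le_iff algebra_simps)

lemma borel_cube [measurable]: "cube y r \<in> sets borel"
  unfolding cube_eq_cbox by simp

lemma emeasure_cube: "0 \<le> r \<Longrightarrow> emeasure lborel (cube y r :: (real ^ 'm::finite) set) = ennreal ((2 * r) ^ CARD('m))"
  unfolding cube_eq_cbox
  by (subst emeasure_lborel_cbox) (auto simp: Basis_vec_def inner_axis image_image prod.UNION_disjoint axis_eq_axis
      intro!: arg_cong[of _ _ ennreal])

definition approx_set :: "real ^ 'n::finite ^ 'm::finite \<Rightarrow> real \<Rightarrow> real \<Rightarrow> (real ^ 'm) set" where
  "approx_set A r T = {b. \<exists>v\<in>Lambda A. v - emb b \<in> sbox (sides r T)}"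

lemma diff_emb_sbox_iff:
  "v - emb b \<in> sbox (sides r T) \<longleftrightarrow> b \<in> cube (fst_part v) r \<and> (\<forall>j. \<bar>v $ Inr j\<bar> \<le> T)"
  by (auto simp: sbox_sides_iff cube_iff)

lemma borel_approx_set [measurable]: "approx_set A r T \<in> sets borel"
proof -
  have "approx_set A r T = (\<Union>v\<in>{v\<in>Lambda A. \<forall>j. \<bar>v $ Inr j\<bar> \<le> T}. cube (fst_part v) r)"
    unfolding approx_set_def diff_emb_sbox_iff by auto
  also have "\<dots> \<in> sets borel"
    by (intro sets.countable_UN' borel_cube countable_subset[OF _ countable_Lambda[of A]]) auto
  finally show ?thesis .
qed

lemma approx_set_periodic:
  assumes "p \<in> int_vecs"
  shows "b + p \<in> approx_set A r T \<longleftrightarrow> b \<in> approx_set A r T"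
proof -
  have *: "b + p \<in> approx_set A r T" if b: "b \<in> approx_set A r T" and p: "p \<in> int_vecs" for b p
  proof -
    obtain p' q where v: "p' \<in> int_vecs" "q \<in> int_vecs" "lat_pt A p' q - emb b \<in> sbox (sides r T)"
      using b unfolding approx_set_def Lambda_eq by auto
    have "lat_pt A (p' + p) q - emb (b + p) = lat_pt A p' q - emb b"
      by (auto simp: vec_eq_iff all_sum_iff)
    then show ?thesis unfolding approx_set_def mem_Collect_eq
      by (intro bexI[of _ "lat_pt A (p' + p) q"] lat_pt_in_Lambda int_vecs_add v p) (simp only: v)
  qed
  show ?thesis using *[of b p] *[of "b + p" "- p"] assms int_vecs_minus by auto
qed

section \<open>Lattice points near an arbitrary point\<close>

context discrete_subgroup
begin

lemma finite_near: "finite {v \<in> L. v - w \<in> sbox s}"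
proof (rule finite_subset[OF _ fin])
  show "{v \<in> L. v - w \<in> sbox s} \<subseteq> L \<inter> sbox (\<lambda>i. s i + \<bar>w $ i\<bar>)"
  proof
    fix v assume "v \<in> {v \<in> L. v - w \<in> sbox s}"
    then have v: "v \<in> L" "v - w \<in> sbox s" by auto
    have "\<bar>v $ i\<bar> \<le> s i + \<bar>w $ i\<bar>" for i
    proof -
      have "\<bar>v $ i - w $ i\<bar> \<le> s i" using v(2) by (simp add: sbox_iff)
      then show ?thesis by linarith
    qed
    then show "v \<in> L \<inter> sbox (\<lambda>i. s i + \<bar>w $ i\<bar>)" using v(1) by (simp add: sbox_iff)
  qed
qed

text \<open>Subtracting one of these points sends all of them into the doubled box around 0; the
  bound is uniform in \<open>w\<close>.\<close>

lemma card_near_le: "card {v \<in> L. v - w \<in> sbox s} \<le> count (\<lambda>i. 2 * s i)"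
proof (cases "{v \<in> L. v - w \<in> sbox s} = {}")
  case False
  then obtain v0 where v0: "v0 \<in> L" "v0 - w \<in> sbox s" by auto
  have "(\<lambda>v. v - v0) ` {v \<in> L. v - w \<in> sbox s} \<subseteq> L \<inter> sbox (\<lambda>i. 2 * s i)"
  proof (rule image_subsetI)
    fix v assume "v \<in> {v \<in> L. v - w \<in> sbox s}"
    then have v: "v \<in> L" "v - w \<in> sbox s" by auto
    have "\<bar>(v - v0) $ i\<bar> \<le> 2 * s i" for i
    proof -
      have "\<bar>v $ i - w $ i\<bar> \<le> s i" "\<bar>v0 $ i - w $ i\<bar> \<le> s i" using v v0 by (simp_all add: sbox_iff)
      then show ?thesis unfolding vector_minus_component by linarith
    qed
    then show "v - v0 \<in> L \<inter> sbox (\<lambda>i. 2 * s i)" using v v0 diff by (simp add: sbox_iff)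
  qed
  then show ?thesis unfolding count_def
    by (rule card_inj_on_le[rotated, OF _ fin]) (auto simp: inj_on_def)
next
  case True
  then show ?thesis by (simp only: card.empty zero_le)
qed

text \<open>One lattice point near \<open>w\<close> can be moved by every lattice point of the box
  without leaving the doubled box around \<open>w\<close>.\<close>

lemma card_near_ge:
  assumes v0: "v0 \<in> L" "v0 - w \<in> sbox s"
  shows "count s \<le> card {v \<in> L. v - w \<in> sbox (\<lambda>i. 2 * s i)}"
proof -
  have "(\<lambda>v. v + v0) ` (L \<inter> sbox s) \<subseteq> {v \<in> L. v - w \<in> sbox (\<lambda>i. 2 * s i)}"
  proof (rule image_subsetI)
    fix v assume "v \<in> L \<inter> sbox s"
    then have v: "v \<in> L" "v \<in> sbox s" by auto
    have "\<bar>(v + v0 - w) $ i\<bar> \<le> 2 * s i" for i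
    proof -
      have "\<bar>v $ i\<bar> \<le> s i" "\<bar>v0 $ i - w $ i\<bar> \<le> s i" using v v0 by (simp_all add: sbox_iff)
      then show ?thesis unfolding vector_minus_component vector_add_component by linarith
    qed
    then show "v + v0 \<in> {v \<in> L. v - w \<in> sbox (\<lambda>i. 2 * s i)}" using v v0 add by (simp add: sbox_iff)
  qed
  then show ?thesis unfolding count_def
    by (rule card_inj_on_le[rotated, OF _ finite_near]) (auto simp: inj_on_def)
qed

end

subsection \<open>Measure of the sets of well approximated points\<close>

text \<open>Half-open, so that its integer translates cover every point exactly once;
  \<open>torus_measure\<close> is based on the closed cube, which differs by a null set.\<close>

definition unit_cube :: "(real ^ 'm::finite) set" where
  "unit_cube = {b. \<forall>i. 0 \<le> b $ i \<and> b $ i < 1}"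

lemma borel_unit_cube [measurable]: "unit_cube \<in> sets borel"
proof -
  have "unit_cube = (\<Inter>i. {b :: real ^ 'm. 0 \<le> b $ i} \<inter> {b. b $ i < 1})"
    by (simp add: set_eq_iff unit_cube_def)
  also have "\<dots> \<in> sets borel"
    by (intro sets.finite_INT sets.Int borel_closed borel_open closed_halfspace_component_ge_cart
        open_halfspace_component_lt_cart) auto
  finally show ?thesis .
qed

lemma unit_cube_translate_unique: "\<exists>!p. p \<in> int_vecs \<and> c + p \<in> unit_cube"
proof (rule ex1I)
  let ?p = "\<chi> i. - real_of_int \<lfloor>c $ i\<rfloor>"
  show "?p \<in> int_vecs \<and> c + ?p \<in> unit_cube"
    by (auto simp: int_vecs_def unit_cube_def) linarith
  fix p assume p: "p \<in> int_vecs \<and> c + p \<in> unit_cube"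
  show "p = ?p"
  proof (unfold vec_eq_iff, intro allI)
    fix i
    obtain k where k: "p $ i = real_of_int k" using p by (auto simp: int_vecs_def Ints_def)
    have "0 \<le> c $ i + p $ i" "c $ i + p $ i < 1" using p by (auto simp: unit_cube_def)
    then have "k = - \<lfloor>c $ i\<rfloor>" unfolding k by linarith
    then show "p $ i = ?p $ i" using k by simp
  qed
qed

text \<open>Unfolding: by Tonelli and translation invariance, a sum over integer translates
  integrated over one fundamental domain gives the integral over the whole space. The sum is an
  integral against \<open>count_space\<close>, so no question of convergence arises.\<close>

lemma nn_integral_unfold:
  fixes g :: "real ^ 'm::finite \<Rightarrow> ennreal"
  assumes [measurable]: "g \<in> borel_measurable borel"
  shows "(\<integral>\<^sup>+b. indicator unit_cube b * (\<integral>\<^sup>+p. g (b - p) \<partial>count_space int_vecs) \<partial>lborel) = (\<integral>\<^sup>+b. g b \<partial>lborel)"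
proof -
  have one: "(\<integral>\<^sup>+p. indicator unit_cube (c + p) \<partial>count_space int_vecs) = (1::ennreal)" for c :: "real ^ 'm"
  proof -
    obtain p0 where p0: "p0 \<in> int_vecs" "c + p0 \<in> unit_cube" "\<And>p. p \<in> int_vecs \<Longrightarrow> c + p \<in> unit_cube \<Longrightarrow> p = p0"
      using unit_cube_translate_unique[of c] by blast
    have "(\<integral>\<^sup>+p. indicator unit_cube (c + p) \<partial>count_space int_vecs) = (\<integral>\<^sup>+p. indicator {p0} p \<partial>count_space int_vecs)"
    proof (rule nn_integral_cong)
      fix p assume "p \<in> space (count_space (int_vecs :: (real ^ 'm) set))"
      then have "c + p \<in> unit_cube \<longleftrightarrow> p \<in> {p0}" using p0(1,2) p0(3)[of p] by auto
      then show "indicator unit_cube (c + p) = (indicator {p0} p :: ennreal)" by (simp add: indicator_def)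
    qed
    also have "\<dots> = 1" using p0(1) by (subst nn_integral_indicator) auto
    finally show ?thesis .
  qed
  have "(\<integral>\<^sup>+b. indicator unit_cube b * (\<integral>\<^sup>+p. g (b - p) \<partial>count_space int_vecs) \<partial>lborel)
    = (\<integral>\<^sup>+b. (\<integral>\<^sup>+p. indicator unit_cube b * g (b - p) \<partial>count_space int_vecs) \<partial>lborel)"
    by (simp add: nn_integral_cmult)
  also have "\<dots> = (\<integral>\<^sup>+p. (\<integral>\<^sup>+b. indicator unit_cube b * g (b - p) \<partial>lborel) \<partial>count_space int_vecs)"
    by (rule nn_integral_count_space_nn_integral[OF countable_int_vecs]) measurable
  also have "\<dots> = (\<integral>\<^sup>+p. (\<integral>\<^sup>+b. indicator unit_cube (b + p) * g b \<partial>lborel) \<partial>count_space int_vecs)"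
  proof (rule nn_integral_cong)
    fix p :: "real ^ 'm"
    have "(\<integral>\<^sup>+b. indicator unit_cube b * g (b - p) \<partial>lborel)
        = (\<integral>\<^sup>+b. indicator unit_cube b * g (b - p) \<partial>distr lborel borel ((+) p))"
      by (simp add: lborel_distr_plus)
    also have "\<dots> = (\<integral>\<^sup>+b. indicator unit_cube (p + b) * g (p + b - p) \<partial>lborel)"
      by (rule nn_integral_distr) measurable
    finally show "(\<integral>\<^sup>+b. indicator unit_cube b * g (b - p) \<partial>lborel) = (\<integral>\<^sup>+b. indicator unit_cube (b + p) * g b \<partial>lborel)"
      by (simp add: add.commute)
  qed
  also have "\<dots> = (\<integral>\<^sup>+b. (\<integral>\<^sup>+p. indicator unit_cube (b + p) * g b \<partial>count_space int_vecs) \<partial>lborel)"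
    by (rule nn_integral_count_space_nn_integral[OF countable_int_vecs, symmetric]) measurable
  also have "\<dots> = (\<integral>\<^sup>+b. g b \<partial>lborel)"
    by (simp add: nn_integral_multc one)
  finally show ?thesis .
qed

section \<open>Covering multiplicity and measure\<close>

definition box_count :: "real ^ 'n::finite ^ 'm::finite \<Rightarrow> real \<Rightarrow> real \<Rightarrow> nat" where
  "box_count A r T = card (Lambda A \<inter> sbox (sides r T))"

lemma box_count_eq: "box_count A r T = discrete_subgroup.count (Lambda A) (sides r T)"
  by (simp add: box_count_def discrete_subgroup.count_def[OF discrete_subgroup_Lambda])

lemma box_count_mono: "r \<le> r' \<Longrightarrow> T \<le> T' \<Longrightarrow> box_count A r T \<le> box_count A r' T'"
  unfolding box_count_eq by (intro discrete_subgroup.count_mono discrete_subgroup_Lambda sides_mono)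

lemma box_count_pos: "0 \<le> r \<Longrightarrow> 0 \<le> T \<Longrightarrow> 1 \<le> box_count A r T"
  unfolding box_count_eq
  by (intro discrete_subgroup.count_pos discrete_subgroup_Lambda) (metis sides_mono[of 0 r 0 T] mult_sides mult_zero_left)

lemma box_count_scale_le:
  fixes A :: "real ^ 'n::finite ^ 'm::finite"
  assumes "0 < r" "0 < T" "1 \<le> K"
  shows "real (box_count A (K * r) (K * T)) \<le> (2 * K + 2) ^ (CARD('m) + CARD('n)) * real (box_count A r T)"
proof -
  have "0 < sides r T k" for k :: "'m + 'n" using assms by (cases k) auto
  then show ?thesis
    using discrete_subgroup.count_scale_le[OF discrete_subgroup_Lambda[of A], of "sides r T" K] assms(3)
    by (simp add: box_count_eq mult_sides card_UNIV_sum[symmetric] del: card_UNIV_sum)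
qed

lemma N_count_eq_box_count: "N_count A r T = box_count A r T"
proof -
  let ?S = "{(p, q). p \<in> int_vecs \<and> q \<in> int_vecs \<and> infnorm (A *v q - p) \<le> r \<and> infnorm q \<le> T}"
  have "bij_betw (\<lambda>(p, q). lat_pt A (- p) q) ?S (Lambda A \<inter> sbox (sides r T))"
  proof (rule bij_betw_imageI)
    show "inj_on (\<lambda>(p, q). lat_pt A (- p) q) ?S" by (auto simp: inj_on_def lat_pt_eq_iff)
    show "(\<lambda>(p, q). lat_pt A (- p) q) ` ?S = Lambda A \<inter> sbox (sides r T)"
    proof (intro equalityI subsetI)
      fix v assume "v \<in> (\<lambda>(p, q). lat_pt A (- p) q) ` ?S"
      then show "v \<in> Lambda A \<inter> sbox (sides r T)"
        by (auto simp: sbox_sides_iff infnorm_le_iff_cart intro!: lat_pt_in_Lambda int_vecs_minus)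
    next
      fix v assume v: "v \<in> Lambda A \<inter> sbox (sides r T)"
      then obtain p q where pq: "p \<in> int_vecs" "q \<in> int_vecs" "v = lat_pt A p q" unfolding Lambda_eq by auto
      have "(- p, q) \<in> ?S" using v int_vecs_minus pq by (auto simp: sbox_sides_iff infnorm_le_iff_cart)
      then show "v \<in> (\<lambda>(p, q). lat_pt A (- p) q) ` ?S" using pq by (intro rev_image_eqI[of "(- p, q)"]) auto
    qed
  qed
  then show ?thesis unfolding N_count_def box_count_def by (rule bij_betw_same_card)
qed

text \<open>This puts the covering multiplicity into the shape that
  \<open>nn_integral_unfold\<close> accepts: \<open>q\<close> runs through a finite set and
  \<open>p\<close> becomes the translation.\<close>

lemma card_near_eq_nn_integral:
  fixes A :: "real ^ 'n::finite ^ 'm::finite"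
  shows "of_nat (card {v \<in> Lambda A. v - emb b \<in> sbox (sides r T)})
    = (\<integral>\<^sup>+p. (\<Sum>q\<in>int_vecs \<inter> sbox (\<lambda>_. T). indicator (cube (A *v q) r) (b - p)) \<partial>count_space int_vecs)"
proof -
  define Q :: "(real ^ 'n) set" where "Q = int_vecs \<inter> sbox (\<lambda>_. T)"
  define P where "P q = {p \<in> int_vecs. b - p \<in> cube (A *v q) r}" for q
  have finQ: "finite Q" unfolding Q_def by (rule finite_int_vecs_sbox)
  have finP: "finite (P q)" for q
  proof (rule finite_subset[OF _ finite_int_vecs_sbox])
    show "P q \<subseteq> int_vecs \<inter> sbox (\<lambda>i. r + \<bar>b $ i\<bar> + \<bar>(A *v q) $ i\<bar>)"
    proof
      fix p assume p: "p \<in> P q"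
      have "\<bar>p $ i\<bar> \<le> r + \<bar>b $ i\<bar> + \<bar>(A *v q) $ i\<bar>" for i
      proof -
        have "\<bar>(A *v q) $ i - (b $ i - p $ i)\<bar> \<le> r" using p unfolding P_def cube_iff by simp
        then show ?thesis by linarith
      qed
      then show "p \<in> int_vecs \<inter> sbox (\<lambda>i. r + \<bar>b $ i\<bar> + \<bar>(A *v q) $ i\<bar>)"
        using p by (simp add: P_def sbox_iff)
    qed
  qed
  have mem: "lat_pt A p q - emb b \<in> sbox (sides r T) \<longleftrightarrow> b - p \<in> cube (A *v q) r \<and> q \<in> sbox (\<lambda>_. T)" for p q
    unfolding diff_emb_sbox_iff by (simp add: cube_iff sbox_iff algebra_simps)
  have "bij_betw (\<lambda>(q, p). lat_pt A p q) (SIGMA q:Q. P q) {v \<in> Lambda A. v - emb b \<in> sbox (sides r T)}"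
  proof (rule bij_betw_imageI)
    show "inj_on (\<lambda>(q, p). lat_pt A p q) (SIGMA q:Q. P q)" by (auto simp: inj_on_def lat_pt_eq_iff)
    show "(\<lambda>(q, p). lat_pt A p q) ` (SIGMA q:Q. P q) = {v \<in> Lambda A. v - emb b \<in> sbox (sides r T)}"
    proof (intro equalityI subsetI)
      fix v assume "v \<in> (\<lambda>(q, p). lat_pt A p q) ` (SIGMA q:Q. P q)"
      then obtain p q where "v = lat_pt A p q" "q \<in> Q" "p \<in> P q" by auto
      then show "v \<in> {v \<in> Lambda A. v - emb b \<in> sbox (sides r T)}"
        unfolding Q_def P_def by (simp add: mem lat_pt_in_Lambda)
    next
      fix v assume "v \<in> {v \<in> Lambda A. v - emb b \<in> sbox (sides r T)}"
      then obtain p q where pq: "p \<in> int_vecs" "q \<in> int_vecs" "v = lat_pt A p q" "v - emb b \<in> sbox (sides r T)"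
        unfolding Lambda_eq by auto
      have "q \<in> Q" "p \<in> P q" using pq(1,2,4) unfolding pq(3) mem Q_def P_def by auto
      then show "v \<in> (\<lambda>(q, p). lat_pt A p q) ` (SIGMA q:Q. P q)"
        unfolding pq(3) by (intro rev_image_eqI[of "(q, p)"]) auto
    qed
  qed
  then have "card {v \<in> Lambda A. v - emb b \<in> sbox (sides r T)} = card (SIGMA q:Q. P q)"
    by (rule bij_betw_same_card[symmetric])
  also have "\<dots> = (\<Sum>q\<in>Q. card (P q))" using finQ finP by (intro card_SigmaI) auto
  finally have 1: "card {v \<in> Lambda A. v - emb b \<in> sbox (sides r T)} = (\<Sum>q\<in>Q. card (P q))" .
  have 2: "of_nat (card (P q)) = (\<integral>\<^sup>+p. indicator (cube (A *v q) r) (b - p) \<partial>count_space int_vecs)" for q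
  proof -
    have "(\<integral>\<^sup>+p. indicator (cube (A *v q) r) (b - p) \<partial>count_space int_vecs)
        = (\<integral>\<^sup>+p. indicator (P q) p \<partial>count_space int_vecs)"
      by (rule nn_integral_cong) (simp add: P_def indicator_def)
    also have "\<dots> = emeasure (count_space int_vecs) (P q)"
      by (rule nn_integral_indicator) (auto simp: P_def)
    also have "\<dots> = of_nat (card (P q))"
      by (rule emeasure_count_space_finite[OF _ finP]) (auto simp: P_def)
    finally show ?thesis by (rule sym)
  qed
  show ?thesis
    unfolding 1 of_nat_sum 2 Q_def[symmetric] by (subst nn_integral_sum) auto
qed

text \<open>Periodicity of \<open>S\<close> lets its indicator pass under the sum over translates. A
  general \<open>S\<close> leaves room for inserting a second approximation set later.\<close>

lemma nn_integral_card_near: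
  fixes A :: "real ^ 'n::finite ^ 'm::finite"
  assumes S [measurable]: "S \<in> sets borel" and per: "\<And>b p. p \<in> int_vecs \<Longrightarrow> b + p \<in> S \<longleftrightarrow> b \<in> S"
  shows "(\<integral>\<^sup>+b. indicator (unit_cube \<inter> S) b * of_nat (card {v \<in> Lambda A. v - emb b \<in> sbox (sides r T)}) \<partial>lborel)
    = (\<Sum>q\<in>int_vecs \<inter> sbox (\<lambda>_. T). emeasure lborel (cube (A *v q) r \<inter> S))"
proof -
  define Q :: "(real ^ 'n) set" where "Q = int_vecs \<inter> sbox (\<lambda>_. T)"
  define g :: "real ^ 'm \<Rightarrow> ennreal" where "g b = (\<Sum>q\<in>Q. indicator (cube (A *v q) r \<inter> S) b)" for b
  have [measurable]: "g \<in> borel_measurable borel" unfolding g_def by measurable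
  have *: "indicator (unit_cube \<inter> S) b * of_nat (card {v \<in> Lambda A. v - emb b \<in> sbox (sides r T)})
      = indicator unit_cube b * (\<integral>\<^sup>+p. g (b - p) \<partial>count_space int_vecs)" for b
  proof -
    have S: "indicator S (b - p) = (indicator S b :: ennreal)" if "p \<in> int_vecs" for p
      using per[OF that, of "b - p"] by (simp add: indicator_def)
    have "(\<integral>\<^sup>+p. g (b - p) \<partial>count_space int_vecs)
        = (\<integral>\<^sup>+p. indicator S b * (\<Sum>q\<in>Q. indicator (cube (A *v q) r) (b - p)) \<partial>count_space int_vecs)"
    proof (rule nn_integral_cong)
      fix p assume "p \<in> space (count_space (int_vecs :: (real ^ 'm) set))"
      then have "p \<in> int_vecs" by simp
      then show "g (b - p) = indicator S b * (\<Sum>q\<in>Q. indicator (cube (A *v q) r) (b - p))"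
        unfolding g_def by (simp add: indicator_inter_arith S sum_distrib_left mult.commute)
    qed
    also have "\<dots> = indicator S b * (\<integral>\<^sup>+p. (\<Sum>q\<in>Q. indicator (cube (A *v q) r) (b - p)) \<partial>count_space int_vecs)"
      by (rule nn_integral_cmult) simp
    finally show ?thesis
      unfolding card_near_eq_nn_integral Q_def[symmetric] by (simp add: indicator_inter_arith mult.assoc)
  qed
  have "(\<integral>\<^sup>+b. indicator (unit_cube \<inter> S) b * of_nat (card {v \<in> Lambda A. v - emb b \<in> sbox (sides r T)}) \<partial>lborel)
    = (\<integral>\<^sup>+b. g b \<partial>lborel)"
    unfolding * by (rule nn_integral_unfold) measurable
  also have "\<dots> = (\<Sum>q\<in>Q. \<integral>\<^sup>+b. indicator (cube (A *v q) r \<inter> S) b \<partial>lborel)"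
    unfolding g_def by (rule nn_integral_sum) measurable
  also have "\<dots> = (\<Sum>q\<in>Q. emeasure lborel (cube (A *v q) r \<inter> S))"
    by (intro sum.cong refl nn_integral_indicator) measurable
  finally show ?thesis unfolding Q_def .
qed

lemma mult_sides_fun: "(\<lambda>i. c * sides r T i) = sides (c * r) (c * T)"
  by (rule ext) (rule mult_sides)

text \<open>By \<open>card_near_ge\<close> the multiplicity for the doubled sides is at least
  \<open>box_count A r T\<close> on all of \<open>approx_set A r T\<close>; this is integrated over
  \<open>S\<close>.\<close>

lemma emeasure_approx_set_inter_le:
  fixes A :: "real ^ 'n::finite ^ 'm::finite"
  assumes S [measurable]: "S \<in> sets borel" and per: "\<And>b p. p \<in> int_vecs \<Longrightarrow> b + p \<in> S \<longleftrightarrow> b \<in> S"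
  shows "of_nat (box_count A r T) * emeasure lborel (unit_cube \<inter> (approx_set A r T \<inter> S))
    \<le> (\<Sum>q\<in>int_vecs \<inter> sbox (\<lambda>_. 2 * T). emeasure lborel (cube (A *v q) (2 * r) \<inter> S))"
proof -
  have "of_nat (box_count A r T) * emeasure lborel (unit_cube \<inter> (approx_set A r T \<inter> S))
     = (\<integral>\<^sup>+b. of_nat (box_count A r T) * indicator (unit_cube \<inter> (approx_set A r T \<inter> S)) b \<partial>lborel)"
    by (rule nn_integral_cmult_indicator[symmetric]) measurable
  also have "\<dots> \<le> (\<integral>\<^sup>+b. indicator (unit_cube \<inter> S) b
      * of_nat (card {v \<in> Lambda A. v - emb b \<in> sbox (sides (2 * r) (2 * T))}) \<partial>lborel)"
  proof (rule nn_integral_mono)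
    fix b :: "real ^ 'm"
    show "of_nat (box_count A r T) * indicator (unit_cube \<inter> (approx_set A r T \<inter> S)) b
      \<le> (indicator (unit_cube \<inter> S) b * of_nat (card {v \<in> Lambda A. v - emb b \<in> sbox (sides (2 * r) (2 * T))}) :: ennreal)"
    proof (cases "b \<in> unit_cube \<inter> (approx_set A r T \<inter> S)")
      case True
      then obtain v0 where "v0 \<in> Lambda A" "v0 - emb b \<in> sbox (sides r T)" by (auto simp: approx_set_def)
      then have "box_count A r T \<le> card {v \<in> Lambda A. v - emb b \<in> sbox (sides (2 * r) (2 * T))}"
        using discrete_subgroup.card_near_ge[OF discrete_subgroup_Lambda[of A]]
        unfolding box_count_eq mult_sides_fun[symmetric] by blast
      then show ?thesis using True by (simp add: of_nat_mono)
    qed simp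
  qed
  also have "\<dots> = (\<Sum>q\<in>int_vecs \<inter> sbox (\<lambda>_. 2 * T). emeasure lborel (cube (A *v q) (2 * r) \<inter> S))"
    by (rule nn_integral_card_near[OF S per])
  finally show ?thesis .
qed

text \<open>The cubes have multiplicity at most \<open>box_count A (2 * r) (2 * T)\<close>
  everywhere and 0 outside \<open>approx_set A r T\<close>, so this set cannot be small.\<close>

lemma emeasure_approx_set_ge:
  fixes A :: "real ^ 'n::finite ^ 'm::finite"
  assumes r: "0 \<le> r"
  shows "of_nat (card (int_vecs \<inter> sbox (\<lambda>_. T) :: (real ^ 'n) set)) * ennreal ((2 * r) ^ CARD('m))
     \<le> of_nat (box_count A (2 * r) (2 * T)) * emeasure lborel (unit_cube \<inter> approx_set A r T)"
proof -
  have "of_nat (card (int_vecs \<inter> sbox (\<lambda>_. T) :: (real ^ 'n) set)) * ennreal ((2 * r) ^ CARD('m))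
    = (\<Sum>q\<in>int_vecs \<inter> sbox (\<lambda>_. T). emeasure lborel (cube (A *v q) r \<inter> UNIV))"
    using r by (simp add: emeasure_cube)
  also have "\<dots> = (\<integral>\<^sup>+b. indicator (unit_cube \<inter> UNIV) b * of_nat (card {v \<in> Lambda A. v - emb b \<in> sbox (sides r T)}) \<partial>lborel)"
    by (rule nn_integral_card_near[symmetric]) auto
  also have "\<dots> \<le> (\<integral>\<^sup>+b. of_nat (box_count A (2 * r) (2 * T)) * indicator (unit_cube \<inter> approx_set A r T) b \<partial>lborel)"
  proof (rule nn_integral_mono)
    fix b :: "real ^ 'm"
    have le: "card {v \<in> Lambda A. v - emb b \<in> sbox (sides r T)} \<le> box_count A (2 * r) (2 * T)"
      using discrete_subgroup.card_near_le[OF discrete_subgroup_Lambda[of A]]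
      unfolding box_count_eq mult_sides_fun[symmetric] by blast
    show "indicator (unit_cube \<inter> UNIV) b * of_nat (card {v \<in> Lambda A. v - emb b \<in> sbox (sides r T)})
       \<le> (of_nat (box_count A (2 * r) (2 * T)) * indicator (unit_cube \<inter> approx_set A r T) b :: ennreal)"
    proof (cases "b \<in> unit_cube \<inter> approx_set A r T")
      case True
      then show ?thesis using le by (simp add: of_nat_mono)
    next
      case False
      then have "b \<notin> unit_cube \<or> {v \<in> Lambda A. v - emb b \<in> sbox (sides r T)} = {}"
        by (auto simp: approx_set_def)
      then show ?thesis by (auto simp del: Collect_empty_eq)
    qed
  qed
  also have "\<dots> = of_nat (box_count A (2 * r) (2 * T)) * emeasure lborel (unit_cube \<inter> approx_set A r T)"
    by (rule nn_integral_cmult_indicator) measurable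
  finally show ?thesis .
qed

text \<open>A local form inside one cube, obtained without unfolding: the doubled cubes that reach a
  point of \<open>cube y \<rho>\<close> have centres within \<open>\<rho> + 2 * r\<close> of
  \<open>y\<close>, and \<open>card_near_le\<close> counts the lattice points concerned.\<close>

lemma emeasure_cube_approx_set_le:
  fixes A :: "real ^ 'n::finite ^ 'm::finite"
  assumes r: "0 \<le> r"
  shows "of_nat (box_count A r T) * emeasure lborel (cube y \<rho> \<inter> approx_set A r T)
    \<le> of_nat (box_count A (2 * (\<rho> + 2 * r)) (2 * (2 * T))) * ennreal ((2 * (2 * r)) ^ CARD('m))"
proof -
  define V where "V = {v \<in> Lambda A. v - emb y \<in> sbox (sides (\<rho> + 2 * r) (2 * T))}"
  have finV: "finite V"
    unfolding V_def by (rule discrete_subgroup.finite_near[OF discrete_subgroup_Lambda])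
  have "of_nat (box_count A r T) * emeasure lborel (cube y \<rho> \<inter> approx_set A r T)
     = (\<integral>\<^sup>+b. of_nat (box_count A r T) * indicator (cube y \<rho> \<inter> approx_set A r T) b \<partial>lborel)"
    by (rule nn_integral_cmult_indicator[symmetric]) measurable
  also have "\<dots> \<le> (\<integral>\<^sup>+b. (\<Sum>v\<in>V. indicator (cube (fst_part v) (2 * r)) b) \<partial>lborel)"
  proof (rule nn_integral_mono)
    fix b :: "real ^ 'm"
    show "of_nat (box_count A r T) * indicator (cube y \<rho> \<inter> approx_set A r T) b
      \<le> ((\<Sum>v\<in>V. indicator (cube (fst_part v) (2 * r)) b) :: ennreal)"
    proof (cases "b \<in> cube y \<rho> \<inter> approx_set A r T")
      case True
      then obtain v0 where v0: "v0 \<in> Lambda A" "v0 - emb b \<in> sbox (sides r T)" by (auto simp: approx_set_def)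
      have "box_count A r T \<le> card {v \<in> Lambda A. v - emb b \<in> sbox (sides (2 * r) (2 * T))}"
        using discrete_subgroup.card_near_ge[OF discrete_subgroup_Lambda[of A] v0]
        unfolding box_count_eq mult_sides_fun .
      also have "\<dots> \<le> card {v \<in> V. b \<in> cube (fst_part v) (2 * r)}"
      proof (rule card_mono)
        show "{v \<in> Lambda A. v - emb b \<in> sbox (sides (2 * r) (2 * T))} \<subseteq> {v \<in> V. b \<in> cube (fst_part v) (2 * r)}"
        proof
          fix v assume "v \<in> {v \<in> Lambda A. v - emb b \<in> sbox (sides (2 * r) (2 * T))}"
          then have v: "v \<in> Lambda A" "b \<in> cube (fst_part v) (2 * r)" "\<forall>j. \<bar>v $ Inr j\<bar> \<le> 2 * T"
            unfolding diff_emb_sbox_iff by auto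
          have "y \<in> cube (fst_part v) (\<rho> + 2 * r)"
          proof (unfold cube_iff, intro allI)
            fix i
            have "\<bar>fst_part v $ i - b $ i\<bar> \<le> 2 * r" "\<bar>y $ i - b $ i\<bar> \<le> \<rho>"
              using v(2) True by (simp_all add: cube_iff)
            then show "\<bar>fst_part v $ i - y $ i\<bar> \<le> \<rho> + 2 * r" by linarith
          qed
          then show "v \<in> {v \<in> V. b \<in> cube (fst_part v) (2 * r)}"
            using v unfolding V_def diff_emb_sbox_iff by auto
        qed
      qed (use finV in auto)
      finally have "(of_nat (box_count A r T) :: ennreal) \<le> of_nat (card {v \<in> V. b \<in> cube (fst_part v) (2 * r)})"
        by (rule of_nat_mono)
      also have "\<dots> = (\<Sum>v\<in>V. indicator (cube (fst_part v) (2 * r)) b)"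
        using finV by (simp add: indicator_def sum.If_cases Int_def)
      finally show ?thesis using True by simp
    qed simp
  qed
  also have "\<dots> = (\<Sum>v\<in>V. \<integral>\<^sup>+b. indicator (cube (fst_part v) (2 * r)) b \<partial>lborel)"
    by (rule nn_integral_sum) measurable
  also have "\<dots> = of_nat (card V) * ennreal ((2 * (2 * r)) ^ CARD('m))"
    using r by (simp add: emeasure_cube)
  also have "\<dots> \<le> of_nat (box_count A (2 * (\<rho> + 2 * r)) (2 * (2 * T))) * ennreal ((2 * (2 * r)) ^ CARD('m))"
    unfolding V_def box_count_eq mult_sides_fun[symmetric]
    by (intro mult_right_mono of_nat_mono discrete_subgroup.card_near_le discrete_subgroup_Lambda) auto
  finally show ?thesis .
qed

lemma emeasure_unit_cube: "emeasure lborel (unit_cube :: (real ^ 'm::finite) set) = 1"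
proof (rule antisym)
  have 1: "(\<Prod>b\<in>Basis. (1 - 0 :: real ^ 'm) \<bullet> b) = 1"
    by (intro prod.neutral) (auto simp: Basis_vec_def inner_axis)
  have sub: "unit_cube \<subseteq> cbox 0 (1 :: real ^ 'm)" "box 0 (1 :: real ^ 'm) \<subseteq> unit_cube"
    unfolding unit_cube_def subset_iff mem_box_cart mem_Collect_eq by (simp_all add: less_imp_le)
  have b: "b \<in> Basis \<Longrightarrow> (0 :: real ^ 'm) \<bullet> b \<le> 1 \<bullet> b" for b
    by (auto simp: Basis_vec_def inner_axis)
  have "emeasure lborel (unit_cube :: (real ^ 'm) set) \<le> emeasure lborel (cbox 0 (1 :: real ^ 'm))"
    using sub(1) by (rule emeasure_mono) simp
  also have "\<dots> = 1" using emeasure_lborel_cbox[OF b] 1 by simp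
  finally show "emeasure lborel (unit_cube :: (real ^ 'm) set) \<le> 1" .
  have "1 = emeasure lborel (box 0 (1 :: real ^ 'm))" using emeasure_lborel_box[OF b] 1 by simp
  also have "\<dots> \<le> emeasure lborel (unit_cube :: (real ^ 'm) set)"
    using sub(2) by (rule emeasure_mono) simp
  finally show "1 \<le> emeasure lborel (unit_cube :: (real ^ 'm) set)" .
qed

section \<open>Bounds for the normalized measure\<close>

definition torus_prob :: "(real ^ 'm::finite) measure" where
  "torus_prob = restrict_space lborel unit_cube"

lemma prob_space_torus_prob: "prob_space torus_prob"
  by (rule prob_spaceI) (simp add: torus_prob_def emeasure_restrict_space space_restrict_space emeasure_unit_cube)

definition unit_measure :: "(real ^ 'm::finite) set \<Rightarrow> real" where
  "unit_measure S = measure lborel (unit_cube \<inter> S)"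

lemma emeasure_unit_eq: "S \<in> sets borel \<Longrightarrow> emeasure lborel (unit_cube \<inter> S) = ennreal (unit_measure S)"
  unfolding unit_measure_def
  by (rule emeasure_eq_ennreal_measure) (metis emeasure_mono emeasure_unit_cube ennreal_one_neq_top inf_le1 neq_top_trans sets_lborel borel_unit_cube)

lemma unit_measure_nonneg: "0 \<le> unit_measure S"
  by (simp add: unit_measure_def)

lemma unit_measure_UNIV: "unit_measure UNIV = 1"
  unfolding unit_measure_def by (simp add: measure_def emeasure_unit_cube)

lemma unit_measure_mono: "S \<in> sets borel \<Longrightarrow> S' \<in> sets borel \<Longrightarrow> S \<subseteq> S' \<Longrightarrow> unit_measure S \<le> unit_measure S'"
  unfolding unit_measure_def
  by (rule measure_mono_fmeasurable) (auto simp: fmeasurable_def emeasure_unit_eq)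

lemma unit_measure_le_1: "S \<in> sets borel \<Longrightarrow> unit_measure S \<le> 1"
  using unit_measure_mono[of S UNIV] by (simp add: unit_measure_UNIV)

text \<open>The threshold 1/2 gives \<open>4 * T + 1 <= 6 * T\<close>. It is 1/2 and not 1 because
  the divergence case works with halved dyadic sides.\<close>

lemma six_power_bound:
  fixes T :: real
  assumes "1/2 \<le> T"
  shows "real (card (int_vecs \<inter> sbox (\<lambda>_. 2 * T) :: (real ^ 'n::finite) set)) \<le> 6 ^ CARD('n) * T ^ CARD('n)"
proof -
  have "real (card (int_vecs \<inter> sbox (\<lambda>_. 2 * T) :: (real ^ 'n) set)) \<le> (2 * (2 * T) + 1) ^ CARD('n)"
    using assms by (intro card_int_vecs_sbox_bounds) simp
  also have "\<dots> \<le> (6 * T) ^ CARD('n)" using assms by (intro power_mono) auto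
  finally show ?thesis by (simp add: power_mult_distrib)
qed

lemma unit_measure_approx_set_le:
  fixes A :: "real ^ 'n::finite ^ 'm::finite"
  assumes r: "0 \<le> r" and T: "1/2 \<le> T"
  shows "real (box_count A r T) * unit_measure (approx_set A r T)
    \<le> 6 ^ CARD('n) * 4 ^ CARD('m) * (r ^ CARD('m) * T ^ CARD('n))"
proof -
  have "ennreal (real (box_count A r T) * unit_measure (approx_set A r T))
     = of_nat (box_count A r T) * emeasure lborel (unit_cube \<inter> (approx_set A r T \<inter> UNIV))"
    by (simp add: emeasure_unit_eq ennreal_mult unit_measure_nonneg ennreal_of_nat_eq_real_of_nat)
  also have "\<dots> \<le> (\<Sum>q\<in>int_vecs \<inter> sbox (\<lambda>_. 2 * T). emeasure lborel (cube (A *v q) (2 * r) \<inter> UNIV))"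
    by (rule emeasure_approx_set_inter_le) auto
  also have "\<dots> = ennreal (real (card (int_vecs \<inter> sbox (\<lambda>_. 2 * T) :: (real ^ 'n) set)) * (2 * (2 * r)) ^ CARD('m))"
    using r by (simp add: emeasure_cube ennreal_mult ennreal_of_nat_eq_real_of_nat)
  finally have "real (box_count A r T) * unit_measure (approx_set A r T)
     \<le> real (card (int_vecs \<inter> sbox (\<lambda>_. 2 * T) :: (real ^ 'n) set)) * (2 * (2 * r)) ^ CARD('m)"
    using r by (subst (asm) ennreal_le_iff) auto
  also have "\<dots> \<le> (6 ^ CARD('n) * T ^ CARD('n)) * (2 * (2 * r)) ^ CARD('m)"
    using six_power_bound[OF T] r by (intro mult_right_mono) auto
  also have "\<dots> = 6 ^ CARD('n) * 4 ^ CARD('m) * (r ^ CARD('m) * T ^ CARD('n))"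
    by (simp add: power_mult_distrib)
  finally show ?thesis .
qed

text \<open>The count at doubled sides returns to the original sides at the cost of
  \<open>6 = 2 * K + 2\<close> per coordinate, with \<open>K = 2\<close>.\<close>

lemma unit_measure_approx_set_ge:
  fixes A :: "real ^ 'n::finite ^ 'm::finite"
  assumes r: "0 < r" and T: "0 < T"
  shows "r ^ CARD('m) * T ^ CARD('n)
    \<le> 6 ^ (CARD('m) + CARD('n)) * (real (box_count A r T) * unit_measure (approx_set A r T))"
proof -
  have "ennreal (real (card (int_vecs \<inter> sbox (\<lambda>_. T) :: (real ^ 'n) set)) * (2 * r) ^ CARD('m))
     = of_nat (card (int_vecs \<inter> sbox (\<lambda>_. T) :: (real ^ 'n) set)) * ennreal ((2 * r) ^ CARD('m))"
    using r by (simp add: ennreal_mult ennreal_of_nat_eq_real_of_nat)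
  also have "\<dots> \<le> of_nat (box_count A (2 * r) (2 * T)) * emeasure lborel (unit_cube \<inter> approx_set A r T)"
    using r by (intro emeasure_approx_set_ge) simp
  also have "\<dots> = ennreal (real (box_count A (2 * r) (2 * T)) * unit_measure (approx_set A r T))"
    by (simp add: emeasure_unit_eq ennreal_mult unit_measure_nonneg ennreal_of_nat_eq_real_of_nat)
  finally have 1: "real (card (int_vecs \<inter> sbox (\<lambda>_. T) :: (real ^ 'n) set)) * (2 * r) ^ CARD('m)
     \<le> real (box_count A (2 * r) (2 * T)) * unit_measure (approx_set A r T)"
    by (subst (asm) ennreal_le_iff) (auto simp: unit_measure_nonneg)
  have "r ^ CARD('m) * T ^ CARD('n) \<le> (2 * r) ^ CARD('m) * real (card (int_vecs \<inter> sbox (\<lambda>_. T) :: (real ^ 'n) set))"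
    using r T card_int_vecs_sbox_bounds(1)[of T, where 'd = 'n] by (intro mult_mono power_mono) auto
  also have "\<dots> \<le> real (box_count A (2 * r) (2 * T)) * unit_measure (approx_set A r T)"
    using 1 by (simp add: mult.commute)
  also have "\<dots> \<le> ((2 * 2 + 2) ^ (CARD('m) + CARD('n)) * real (box_count A r T)) * unit_measure (approx_set A r T)"
    using box_count_scale_le[OF r T, of 2 A] by (intro mult_right_mono) (auto simp: unit_measure_nonneg)
  finally show ?thesis by (simp add: mult.assoc)
qed

text \<open>Unfolding the set of scale \<open>r\<close> leaves cubes of radius \<open>2 * r\<close>,
  and the set of scale \<open>r'\<close> is estimated inside each by
  \<open>emeasure_cube_approx_set_le\<close>. That estimate counts lattice points of height about
  \<open>T'\<close> within distance about \<open>r\<close>, which is the origin of the mixed count.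
  The number 18 is \<open>2 * K + 2\<close> for \<open>K = 8\<close>.\<close>

lemma unit_measure_approx_set_Int_le:
  fixes A :: "real ^ 'n::finite ^ 'm::finite"
  assumes r: "0 < r'" "r' \<le> r" and T: "1/2 \<le> T" "1/2 \<le> T'"
  shows "real (box_count A r T) * real (box_count A r' T') * unit_measure (approx_set A r T \<inter> approx_set A r' T')
    \<le> 6 ^ CARD('n) * 4 ^ CARD('m) * 18 ^ (CARD('m) + CARD('n))
       * (T ^ CARD('n) * r' ^ CARD('m) * real (box_count A r T'))"
proof -
  let ?N = "of_nat (box_count A r T) :: ennreal" and ?N' = "of_nat (box_count A r' T') :: ennreal"
  let ?Q = "int_vecs \<inter> sbox (\<lambda>_. 2 * T) :: (real ^ 'n) set"
  let ?B = "real (box_count A (8 * r) (8 * T')) * (4 * r') ^ CARD('m)"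
  have "ennreal (real (box_count A r T) * real (box_count A r' T') * unit_measure (approx_set A r T \<inter> approx_set A r' T'))
     = ?N' * (?N * emeasure lborel (unit_cube \<inter> (approx_set A r T \<inter> approx_set A r' T')))"
    by (simp add: emeasure_unit_eq ennreal_mult unit_measure_nonneg ennreal_of_nat_eq_real_of_nat mult_ac)
  also have "\<dots> \<le> ?N' * (\<Sum>q\<in>?Q. emeasure lborel (cube (A *v q) (2 * r) \<inter> approx_set A r' T'))"
    by (intro mult_left_mono emeasure_approx_set_inter_le approx_set_periodic borel_approx_set) auto
  also have "\<dots> = (\<Sum>q\<in>?Q. ?N' * emeasure lborel (cube (A *v q) (2 * r) \<inter> approx_set A r' T'))"
    by (rule sum_distrib_left)
  also have "\<dots> \<le> (\<Sum>q\<in>?Q. ennreal ?B)"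
  proof (rule sum_mono)
    fix q :: "real ^ 'n"
    have "?N' * emeasure lborel (cube (A *v q) (2 * r) \<inter> approx_set A r' T')
      \<le> of_nat (box_count A (2 * (2 * r + 2 * r')) (2 * (2 * T'))) * ennreal ((2 * (2 * r')) ^ CARD('m))"
      using r by (intro emeasure_cube_approx_set_le) simp
    also have "\<dots> \<le> of_nat (box_count A (8 * r) (8 * T')) * ennreal ((2 * (2 * r')) ^ CARD('m))"
      using r T by (intro mult_right_mono of_nat_mono box_count_mono) auto
    also have "\<dots> = ennreal ?B" using r by (simp add: ennreal_mult ennreal_of_nat_eq_real_of_nat)
    finally show "?N' * emeasure lborel (cube (A *v q) (2 * r) \<inter> approx_set A r' T') \<le> ennreal ?B" .
  qed
  also have "\<dots> = ennreal (real (card ?Q) * ?B)"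
    using r by (simp add: ennreal_mult ennreal_of_nat_eq_real_of_nat)
  finally have "real (box_count A r T) * real (box_count A r' T') * unit_measure (approx_set A r T \<inter> approx_set A r' T')
     \<le> real (card ?Q) * ?B"
    using r by (subst (asm) ennreal_le_iff) auto
  also have "\<dots> \<le> (6 ^ CARD('n) * T ^ CARD('n)) * ((18 ^ (CARD('m) + CARD('n)) * real (box_count A r T')) * (4 * r') ^ CARD('m))"
  proof (intro mult_mono six_power_bound T)
    show "real (box_count A (8 * r) (8 * T')) \<le> 18 ^ (CARD('m) + CARD('n)) * real (box_count A r T')"
      using box_count_scale_le[of r T' 8 A] r T by simp
  qed (use r T in auto)
  finally show ?thesis by (simp add: power_mult_distrib mult_ac)
qed

text \<open>The lattice points of the box contain a basis of the space. Expanding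
  \<open>- emb b\<close> in it and rounding the coefficients down leaves an error that combines at
  most \<open>CARD('m) + CARD('n)\<close> box vectors with coefficients in
  \<open>[0, 1)\<close>.\<close>

lemma rounding_to_lattice:
  fixes A :: "real ^ 'n::finite ^ 'm::finite"
  assumes sp: "span (Lambda A \<inter> sbox (sides r T)) = UNIV"
  shows "b \<in> approx_set A (real (CARD('m) + CARD('n)) * r) (real (CARD('m) + CARD('n)) * T)"
proof -
  let ?d = "CARD('m) + CARD('n)"
  obtain B where B: "B \<subseteq> Lambda A \<inter> sbox (sides r T)" "independent B"
    "Lambda A \<inter> sbox (sides r T) \<subseteq> span B" "card B = dim (Lambda A \<inter> sbox (sides r T))"
    using basis_exists by blast
  have finB: "finite B" using B(2) independent_imp_finite by blast
  have cB: "card B \<le> ?d"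
    using dim_subset_UNIV[of "Lambda A \<inter> sbox (sides r T)"] unfolding B(4) by simp
  have "span B = UNIV" using B(1,3) sp by (metis span_mono span_span top.extremum_uniqueI)
  then obtain u where u: "- emb b = (\<Sum>v\<in>B. u v *\<^sub>R v)"
    using span_finite[OF finB] by (metis (no_types, lifting) UNIV_I image_iff)
  define x where "x = - (\<Sum>v\<in>B. real_of_int \<lfloor>u v\<rfloor> *\<^sub>R v)"
  have xL: "x \<in> Lambda A"
    unfolding x_def using B(1)
    by (intro discrete_subgroup.minus discrete_subgroup.sum discrete_subgroup.of_int_scale discrete_subgroup_Lambda) auto
  have eq: "x - emb b = (\<Sum>v\<in>B. (u v - real_of_int \<lfloor>u v\<rfloor>) *\<^sub>R v)"
    using u unfolding x_def by (simp add: scaleR_left_diff_distrib sum_subtractf)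
  have "x - emb b \<in> sbox (sides (real ?d * r) (real ?d * T))"
    unfolding mult_sides_fun[symmetric] sbox_iff
  proof
    fix k
    have "\<bar>(x - emb b) $ k\<bar> = \<bar>\<Sum>v\<in>B. (u v - real_of_int \<lfloor>u v\<rfloor>) * v $ k\<bar>" unfolding eq by simp
    also have "\<dots> \<le> (\<Sum>v\<in>B. \<bar>(u v - real_of_int \<lfloor>u v\<rfloor>) * v $ k\<bar>)" by (rule sum_abs)
    also have "\<dots> \<le> (\<Sum>v\<in>B. sides r T k)"
    proof (rule sum_mono)
      fix v assume "v \<in> B"
      then have "\<bar>v $ k\<bar> \<le> sides r T k" using B(1) unfolding sbox_def by auto
      moreover have "\<bar>u v - real_of_int \<lfloor>u v\<rfloor>\<bar> \<le> 1" by linarith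
      ultimately have "\<bar>u v - real_of_int \<lfloor>u v\<rfloor>\<bar> * \<bar>v $ k\<bar> \<le> 1 * sides r T k"
        by (intro mult_mono) auto
      then show "\<bar>(u v - real_of_int \<lfloor>u v\<rfloor>) * v $ k\<bar> \<le> sides r T k" by (simp add: abs_mult)
    qed
    also have "\<dots> = real (card B) * sides r T k" by simp
    finally have 1: "\<bar>(x - emb b) $ k\<bar> \<le> real (card B) * sides r T k" .
    show "\<bar>(x - emb b) $ k\<bar> \<le> real ?d * sides r T k"
    \<comment> \<open>The signs of \<open>r\<close> and \<open>T\<close> are not given; an element
      of \<open>B\<close> shows that the side is nonnegative.\<close>
    proof (cases "B = {}")
      case True
      then have "span B \<noteq> (UNIV :: (real ^ ('m + 'n)) set)"
        by (metis UNIV_I axis_eq_0_iff singletonD span_empty zero_neq_one)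
      then show ?thesis using \<open>span B = UNIV\<close> by simp
    next
      case False
      then obtain v where "v \<in> B" by auto
      then have "0 \<le> sides r T k" using B(1) unfolding sbox_def by (auto intro: order_trans[OF abs_ge_zero])
      then have "real (card B) * sides r T k \<le> real ?d * sides r T k" using cB by (intro mult_right_mono) auto
      then show ?thesis using 1 by simp
    qed
  qed
  then show ?thesis using xL unfolding approx_set_def by blast
qed

text \<open>By rounding, the enlarged approximation set is the whole space, of normalized measure 1;
  the upper bound for count times measure is then a bound for the count.\<close>

lemma box_count_le_of_span:
  fixes A :: "real ^ 'n::finite ^ 'm::finite"
  assumes r: "0 < r" and T: "1/2 \<le> T" and sp: "span (Lambda A \<inter> sbox (sides r T)) = UNIV"
  shows "real (box_count A r T)
    \<le> 6 ^ CARD('n) * 4 ^ CARD('m) * real (CARD('m) + CARD('n)) ^ (CARD('m) + CARD('n)) * (r ^ CARD('m) * T ^ CARD('n))"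
proof -
  define d where "d = real (CARD('m) + CARD('n))"
  have d1: "1 \<le> d" unfolding d_def using zero_less_card_finite[where 'a = 'm] by linarith
  have "approx_set A (d * r) (d * T) = UNIV" using rounding_to_lattice[OF sp] unfolding d_def by auto
  then have 1: "real (box_count A (d * r) (d * T)) \<le> 6 ^ CARD('n) * 4 ^ CARD('m) * ((d * r) ^ CARD('m) * (d * T) ^ CARD('n))"
    using unit_measure_approx_set_le[of "d * r" "d * T" A] r T d1 mult_mono[of 1 d "1/2" T]
    by (simp add: unit_measure_UNIV)
  have "r \<le> d * r" "T \<le> d * T" using mult_right_mono[OF d1, of r] mult_right_mono[OF d1, of T] r T by auto
  then have "real (box_count A r T) \<le> real (box_count A (d * r) (d * T))"
    by (intro of_nat_mono box_count_mono)
  also note 1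
  finally show ?thesis unfolding d_def[symmetric] by (simp add: power_mult_distrib power_add mult_ac)
qed

subsection \<open>A second moment bound\<close>

text \<open>For \<open>X = \<Sum>i. 1\<^bsub>B i\<^esub>\<close> the function \<open>2 * t * X - (t * X)\<^sup>2 = 1 - (1 - t * X)\<^sup>2\<close> is at most
  the indicator of \<open>X \<noteq> 0\<close>.\<close>

lemma (in prob_space) prob_Union_ge_second_moment:
  assumes I: "finite I" and B: "\<And>i. i \<in> I \<Longrightarrow> B i \<in> events"
  shows "2 * t * (\<Sum>i\<in>I. prob (B i)) - t\<^sup>2 * (\<Sum>i\<in>I. \<Sum>j\<in>I. prob (B i \<inter> B j)) \<le> prob (\<Union>i\<in>I. B i)"
proof -
  define X where "X x = (\<Sum>i\<in>I. indicator (B i) x :: real)" for x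
  define Y where "Y x = (\<Sum>i\<in>I. \<Sum>j\<in>I. indicator (B i \<inter> B j) x :: real)" for x
  have XY: "Y x = X x ^ 2" for x
    unfolding X_def Y_def power2_eq_square sum_product indicator_inter_arith ..
  have int: "integrable M (\<lambda>x. indicator (B i \<inter> B j) x :: real)" if "i \<in> I" "j \<in> I" for i j
    using B that by (intro integrable_real_indicator) (auto simp: emeasure_eq_measure)
  have int1: "integrable M (\<lambda>x. indicator (B i) x :: real)" if "i \<in> I" for i
    using int[OF that that] by simp
  have exp_ind: "expectation (\<lambda>x. indicator E x) = prob E" if "E \<in> events" for E
    using sets.sets_into_space[OF that] by (simp add: Int_absorb2)
  have intX: "integrable M X" unfolding X_def using int1 by (intro Bochner_Integration.integrable_sum)
  have intY: "integrable M Y" unfolding Y_def using int by (intro Bochner_Integration.integrable_sum)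
  have EX: "expectation X = (\<Sum>i\<in>I. prob (B i))"
  proof -
    have "expectation X = (\<Sum>i\<in>I. expectation (\<lambda>x. indicator (B i) x))"
      unfolding X_def by (rule Bochner_Integration.integral_sum) (rule int1)
    also have "\<dots> = (\<Sum>i\<in>I. prob (B i))" using B by (intro sum.cong refl exp_ind)
    finally show ?thesis .
  qed
  have EY: "expectation Y = (\<Sum>i\<in>I. \<Sum>j\<in>I. prob (B i \<inter> B j))"
  proof -
    have "expectation Y = (\<Sum>i\<in>I. expectation (\<lambda>x. \<Sum>j\<in>I. indicator (B i \<inter> B j) x))"
      unfolding Y_def using int by (intro Bochner_Integration.integral_sum Bochner_Integration.integrable_sum)
    also have "\<dots> = (\<Sum>i\<in>I. \<Sum>j\<in>I. expectation (\<lambda>x. indicator (B i \<inter> B j) x))"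
      using int by (intro sum.cong refl Bochner_Integration.integral_sum)
    also have "\<dots> = (\<Sum>i\<in>I. \<Sum>j\<in>I. prob (B i \<inter> B j))"
      using B by (intro sum.cong refl exp_ind) auto
    finally show ?thesis .
  qed
  have U: "(\<Union>i\<in>I. B i) \<in> events" using I B by auto
  have "expectation (\<lambda>x. 2 * t * X x - t\<^sup>2 * Y x) \<le> expectation (indicator (\<Union>i\<in>I. B i))"
  proof (rule integral_mono)
    show "integrable M (\<lambda>x. 2 * t * X x - t\<^sup>2 * Y x)"
      using intX intY by (intro Bochner_Integration.integrable_diff integrable_mult_right) auto
    show "integrable M (indicator (\<Union>i\<in>I. B i) :: _ \<Rightarrow> real)"
      using U by (intro integrable_real_indicator) (auto simp: emeasure_eq_measure)
    fix x
    show "2 * t * X x - t\<^sup>2 * Y x \<le> indicator (\<Union>i\<in>I. B i) x"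
    proof (cases "x \<in> (\<Union>i\<in>I. B i)")
      case True
      have "0 \<le> (1 - t * X x)\<^sup>2" by simp
      then have "2 * t * X x - t\<^sup>2 * (X x)\<^sup>2 \<le> 1" by (simp add: power2_eq_square algebra_simps)
      then show ?thesis using True by (simp add: XY)
    next
      case False
      then have "X x = 0" unfolding X_def by (intro sum.neutral) auto
      then show ?thesis by (simp add: XY)
    qed
  qed
  also have "expectation (indicator (\<Union>i\<in>I. B i)) = prob (\<Union>i\<in>I. B i)"
    using U by (rule exp_ind)
  also have "expectation (\<lambda>x. 2 * t * X x - t\<^sup>2 * Y x) = 2 * t * expectation X - t\<^sup>2 * expectation Y"
    using intX intY by (subst Bochner_Integration.integral_diff) auto
  finally show ?thesis unfolding EX EY .
qed

lemma sum_power_dist_le: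
  fixes \<delta> :: real
  assumes \<delta>: "0 < \<delta>" "\<delta> < 1" and J: "finite J"
  shows "(\<Sum>l\<in>J. \<delta> ^ nat \<bar>int k - int l\<bar>) \<le> 2 / (1 - \<delta>)"
proof -
  have geo: "(\<Sum>i\<in>F. \<delta> ^ i) \<le> 1 / (1 - \<delta>)" if "finite F" for F
    using sum_le_suminf[of "\<lambda>i. \<delta> ^ i" F] that \<delta> by (simp add: suminf_geometric)
  have "(\<Sum>l\<in>J \<inter> {..k}. \<delta> ^ nat \<bar>int k - int l\<bar>) = (\<Sum>i\<in>(\<lambda>l. k - l) ` (J \<inter> {..k}). \<delta> ^ i)"
    by (subst sum.reindex) (auto simp: inj_on_def intro!: sum.cong arg_cong[of _ _ "\<lambda>i. \<delta> ^ i"])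
  also have "\<dots> \<le> 1 / (1 - \<delta>)" using J by (intro geo) auto
  finally have 1: "(\<Sum>l\<in>J \<inter> {..k}. \<delta> ^ nat \<bar>int k - int l\<bar>) \<le> 1 / (1 - \<delta>)" .
  have "(\<Sum>l\<in>J - {..k}. \<delta> ^ nat \<bar>int k - int l\<bar>) = (\<Sum>i\<in>(\<lambda>l. l - k) ` (J - {..k}). \<delta> ^ i)"
    by (subst sum.reindex) (auto simp: inj_on_def intro!: sum.cong arg_cong[of _ _ "\<lambda>i. \<delta> ^ i"])
  also have "\<dots> \<le> 1 / (1 - \<delta>)" using J by (intro geo) auto
  finally have 2: "(\<Sum>l\<in>J - {..k}. \<delta> ^ nat \<bar>int k - int l\<bar>) \<le> 1 / (1 - \<delta>)" .
  have "(\<Sum>l\<in>J. \<delta> ^ nat \<bar>int k - int l\<bar>)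
    = (\<Sum>l\<in>J \<inter> {..k}. \<delta> ^ nat \<bar>int k - int l\<bar>) + (\<Sum>l\<in>J - {..k}. \<delta> ^ nat \<bar>int k - int l\<bar>)"
    using J by (rule sum.Int_Diff)
  then show ?thesis using 1 2 by (simp add: add_divide_distrib[symmetric])
qed

text \<open>The lower bound \<open>1 / (2 * D)\<close> holds for the union over every tail and so
  survives the decreasing limit. In the double sum the geometric terms contribute a multiple of
  \<open>S\<close>; a finite part of the tail with \<open>S >= 1\<close> is chosen so that
  \<open>S * S\<close> absorbs it.\<close>

lemma (in prob_space) prob_limsup_pos:
  fixes \<delta> C :: real
  assumes B: "\<And>k::nat. B k \<in> events" and \<delta>: "0 < \<delta>" "\<delta> < 1" and C: "1 \<le> C"
    and pair: "\<And>k l. k < l \<Longrightarrow> prob (B k \<inter> B l)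
        \<le> C * (prob (B k) * prob (B l) + \<delta> ^ (l - k) * (prob (B k) + prob (B l)))"
    and div: "\<not> summable (\<lambda>k. prob (B k))"
  shows "0 < prob (\<Inter>n. \<Union>k\<in>{n..}. B k)"
proof -
  define D where "D = C * (1 + 4 / (1 - \<delta>))"
  have D0: "0 < D" unfolding D_def using C \<delta> by (intro mult_pos_pos add_pos_pos) auto
  have pair': "prob (B k \<inter> B l) \<le> C * (prob (B k) * prob (B l) + \<delta> ^ nat \<bar>int k - int l\<bar> * (prob (B k) + prob (B l)))" for k l
  proof (rule linorder_cases[of k l])
    assume "k < l"
    moreover from this have "nat \<bar>int k - int l\<bar> = l - k" by simp
    ultimately show ?thesis using pair[of k l] by simp
  next
    assume "l < k"
    moreover from this have "nat \<bar>int k - int l\<bar> = k - l" by simp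
    ultimately show ?thesis using pair[of l k] by (simp add: Int_commute mult.commute add.commute)
  next
    \<comment> \<open>On the diagonal the power of \<delta> is 1, so the linear term alone
      dominates.\<close>
    assume kl: "k = l"
    have "prob (B k) \<le> prob (B k) * prob (B k) + (prob (B k) + prob (B k))"
      using measure_nonneg[of M "B k"] by (simp add: add_increasing)
    also have "\<dots> \<le> C * (prob (B k) * prob (B k) + (prob (B k) + prob (B k)))"
      using mult_right_mono[OF C, of "prob (B k) * prob (B k) + (prob (B k) + prob (B k))"] by simp
    finally show ?thesis unfolding kl by simp
  qed
  have U: "1 / (2 * D) \<le> prob (\<Union>k\<in>{n..}. B k)" for n
  proof -
    have "\<not> summable (\<lambda>k. prob (B (k + n)))" using div summable_iff_shift[of "\<lambda>k. prob (B k)" n] by simp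
    then have "\<not> (\<exists>c. \<forall>N. (\<Sum>k<N. prob (B (k + n))) \<le> c)"
      using summableI_nonneg_bounded[of "\<lambda>k. prob (B (k + n))"] by auto
    then obtain N where N: "1 < (\<Sum>k<N. prob (B (k + n)))" by (meson not_le)
    define J where "J = (\<lambda>k. k + n) ` {..<N}"
    have finJ: "finite J" unfolding J_def by simp
    define S where "S = (\<Sum>k\<in>J. prob (B k))"
    have S1: "1 \<le> S" using N unfolding S_def J_def by (subst sum.reindex) auto
    have "(\<Sum>k\<in>J. \<Sum>l\<in>J. prob (B k \<inter> B l))
       \<le> (\<Sum>k\<in>J. \<Sum>l\<in>J. C * (prob (B k) * prob (B l) + \<delta> ^ nat \<bar>int k - int l\<bar> * (prob (B k) + prob (B l))))"
      by (intro sum_mono pair')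
    also have "\<dots> = C * ((\<Sum>k\<in>J. \<Sum>l\<in>J. prob (B k) * prob (B l))
         + (\<Sum>k\<in>J. \<Sum>l\<in>J. \<delta> ^ nat \<bar>int k - int l\<bar> * prob (B k))
         + (\<Sum>k\<in>J. \<Sum>l\<in>J. \<delta> ^ nat \<bar>int k - int l\<bar> * prob (B l)))"
      by (simp only: sum_distrib_left[symmetric] sum.distrib distrib_left add.assoc)
    also have "(\<Sum>k\<in>J. \<Sum>l\<in>J. prob (B k) * prob (B l)) = S * S"
      unfolding S_def sum_product ..
    also have "(\<Sum>k\<in>J. \<Sum>l\<in>J. \<delta> ^ nat \<bar>int k - int l\<bar> * prob (B l))
        = (\<Sum>k\<in>J. \<Sum>l\<in>J. \<delta> ^ nat \<bar>int k - int l\<bar> * prob (B k))"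
      by (subst sum.swap) (simp add: abs_minus_commute)
    also have "C * (S * S + (\<Sum>k\<in>J. \<Sum>l\<in>J. \<delta> ^ nat \<bar>int k - int l\<bar> * prob (B k))
         + (\<Sum>k\<in>J. \<Sum>l\<in>J. \<delta> ^ nat \<bar>int k - int l\<bar> * prob (B k))) \<le> C * (S * S + 2 / (1 - \<delta>) * S + 2 / (1 - \<delta>) * S)"
    proof -
      have "(\<Sum>k\<in>J. \<Sum>l\<in>J. \<delta> ^ nat \<bar>int k - int l\<bar> * prob (B k)) \<le> 2 / (1 - \<delta>) * S"
        unfolding S_def sum_distrib_left sum_distrib_right[symmetric]
        by (intro sum_mono mult_right_mono sum_power_dist_le \<delta> finJ) auto
      then show ?thesis using C by (intro mult_left_mono[of _ _ C]) linarith+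
    qed
    also have "\<dots> \<le> C * (S * S + 2 / (1 - \<delta>) * (S * S) + 2 / (1 - \<delta>) * (S * S))"
    proof -
      have "2 / (1 - \<delta>) * S \<le> 2 / (1 - \<delta>) * (S * S)"
        using \<delta> S1 by (intro mult_left_mono) auto
      then show ?thesis using C by (intro mult_left_mono[of _ _ C]) linarith+
    qed
    also have "\<dots> = D * S\<^sup>2" unfolding D_def power2_eq_square by (simp add: algebra_simps)
    finally have 2: "(\<Sum>k\<in>J. \<Sum>l\<in>J. prob (B k \<inter> B l)) \<le> D * S\<^sup>2" .
    \<comment> \<open>The value \<open>t / 2\<close> maximises
      \<open>2 * x * S - x ^ 2 * (2 * (D * S ^ 2))\<close>, where the bound for the double sum is
      weakened by a factor 2.\<close>
    define t where "t = 1 / (D * S)"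
    have "1 / (2 * D) = 2 * (t / 2) * S - (t / 2)\<^sup>2 * (2 * (D * S\<^sup>2))"
      using D0 S1 unfolding t_def by (simp add: field_simps power2_eq_square)
    also have "\<dots> \<le> 2 * (t / 2) * S - (t / 2)\<^sup>2 * (\<Sum>k\<in>J. \<Sum>l\<in>J. prob (B k \<inter> B l))"
    proof -
      have "0 \<le> D * S\<^sup>2" using D0 by simp
      then have "(\<Sum>k\<in>J. \<Sum>l\<in>J. prob (B k \<inter> B l)) \<le> 2 * (D * S\<^sup>2)" using 2 by linarith
      then show ?thesis by (intro diff_left_mono mult_left_mono) auto
    qed
    also have "\<dots> \<le> prob (\<Union>k\<in>J. B k)"
      unfolding S_def by (rule prob_Union_ge_second_moment[OF finJ B])
    also have "\<dots> \<le> prob (\<Union>k\<in>{n..}. B k)"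
    proof (rule finite_measure_mono)
      show "(\<Union>k\<in>J. B k) \<subseteq> (\<Union>k\<in>{n..}. B k)"
        by (rule UN_mono) (auto simp: J_def)
      show "(\<Union>k\<in>{n..}. B k) \<in> events" using B by (intro sets.countable_UN') auto
    qed
    finally show ?thesis .
  qed
  have "(\<lambda>n. prob (\<Union>k\<in>{n..}. B k)) \<longlonglongrightarrow> prob (\<Inter>n. \<Union>k\<in>{n..}. B k)"
  proof (rule finite_Lim_measure_decseq)
    show "range (\<lambda>n. \<Union>k\<in>{n..}. B k) \<subseteq> events" using B by auto
    show "decseq (\<lambda>n. \<Union>k\<in>{n..}. B k)"
      unfolding decseq_def by (intro allI impI UN_mono) auto
  qed
  then have "1 / (2 * D) \<le> prob (\<Inter>n. \<Union>k\<in>{n..}. B k)"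
    by (rule LIMSEQ_le_const) (use U in auto)
  then show ?thesis using D0 by (smt (verit) divide_pos_pos)
qed

subsection \<open>Quasi-independence on average\<close>

lemma unit_measure_eq_prob: "S \<in> sets borel \<Longrightarrow> unit_measure S = measure torus_prob (unit_cube \<inter> S)"
  unfolding unit_measure_def torus_prob_def by (simp add: measure_restrict_space)

text \<open>Greedy construction: the next block starts at the first index that is not bad for the
  start of the current one. Later this index makes boxes reaching across a whole block span, while
  the bad indices before it give the block its hyperplane.\<close>

lemma ex_blocks:
  fixes bad :: "nat \<Rightarrow> nat \<Rightarrow> bool"
  assumes unb: "\<And>k. \<exists>l>k. \<not> bad k l"
  obtains K :: "nat \<Rightarrow> nat" where "K 0 = 0" "strict_mono K" "\<And>i. \<not> bad (K i) (K (Suc i))"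
    "\<And>i l. K i < l \<Longrightarrow> l < K (Suc i) \<Longrightarrow> bad (K i) l"
proof -
  define f where "f k = (LEAST l. k < l \<and> \<not> bad k l)" for k
  have f: "k < f k" "\<not> bad k (f k)" for k
    using LeastI_ex[of "\<lambda>l. k < l \<and> \<not> bad k l"] unb unfolding f_def by blast+
  have f_least: "bad k l" if "k < l" "l < f k" for k l
    using not_less_Least[of l "\<lambda>l. k < l \<and> \<not> bad k l"] that unfolding f_def by blast
  define K where "K i = (f ^^ i) 0" for i
  have KS: "K (Suc i) = f (K i)" for i by (simp add: K_def)
  show ?thesis
  proof (rule that[of K])
    show "strict_mono K" unfolding strict_mono_Suc_iff using f(1) KS by simp
  qed (use f f_least KS in \<open>auto simp: K_def\<close>)
qed

lemma ex_block_index: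
  fixes K :: "nat \<Rightarrow> nat"
  assumes "K 0 = 0" "strict_mono K"
  obtains blk :: "nat \<Rightarrow> nat" where "\<And>k. K (blk k) \<le> k" "\<And>k. k < K (Suc (blk k))" "mono blk"
proof -
  define blk where "blk k = (LEAST i. k < K (Suc i))" for k
  have "\<exists>i. k < K (Suc i)" for k
    using strict_mono_imp_increasing[OF assms(2), of "Suc k"] by (auto intro: exI[of _ k])
  then have 1: "k < K (Suc (blk k))" for k unfolding blk_def by (rule LeastI_ex)
  have least: "K (Suc i) \<le> k" if "i < blk k" for i k
    using not_less_Least[of i "\<lambda>i. k < K (Suc i)"] that unfolding blk_def by auto
  have 2: "K (blk k) \<le> k" for k
  proof (cases "blk k")
    case (Suc i)
    then show ?thesis using least[of i k] by simp
  qed (use assms in simp)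
  have "blk k \<le> blk l" if "k \<le> l" for k l
    using least[of "blk l" k] 1[of l] that by (meson leI le_less_trans not_less order.strict_trans2)
  then have "mono blk" by (rule monoI)
  then show ?thesis using that 1 2 by blast
qed

lemma mult_inverse_bound:
  fixes a b c :: real
  assumes "a * b \<le> c" "0 < b"
  shows "a \<le> c / b"
  using assms by (simp add: pos_le_divide_eq)

definition slab_const :: "nat \<Rightarrow> real" where
  "slab_const d = 4 ^ d * (2 * real d + 2) ^ d"

lemma slab_const_pos: "0 < slab_const d"
  unfolding slab_const_def by (intro mult_pos_pos zero_less_power) auto

text \<open>Points of a box with normal vector \<open>w\<close> stay in a slab of the first factor if \<open>w\<close>, weighted by
  the sides, is largest at a coordinate of the first factor; otherwise they move along the second.\<close>

definition stuck :: "real ^ ('m::finite + 'n::finite) \<Rightarrow> real \<Rightarrow> real \<Rightarrow> bool" where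
  "stuck w r T \<longleftrightarrow> (\<exists>i. \<forall>j. \<bar>w $ j\<bar> * sides r T j \<le> \<bar>w $ Inl i\<bar> * r)"

text \<open>Only the geometric behaviour of the two scales enters from here on. One ratio \<delta>
  serves both, so that either factor yields the same saving; the bound 1/2 is that of
  \<open>six_power_bound\<close>.\<close>

locale approx_scales =
  fixes A :: "real ^ 'n::finite ^ 'm::finite" and r T :: "nat \<Rightarrow> real" and \<delta> :: real
  assumes r_pos: "0 < r k" and T_ge: "1/2 \<le> T k"
    and r_decay: "r (Suc k) \<le> \<delta> * r k" and T_decay: "T k \<le> \<delta> * T (Suc k)"
    and \<delta>: "0 < \<delta>" "\<delta> < 1"
begin

definition M where "M k = r k ^ CARD('m) * T k ^ CARD('n) / real (box_count A (r k) (T k))"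

text \<open>The reciprocal of \<open>M_A\<close> at the mixed sides \<open>r k\<close>,
  \<open>T l\<close>. By \<open>unit_measure_Int_le\<close> it controls how far \<open>U k\<close>
  and \<open>U l\<close> may be from independent.\<close>

definition G where "G k l = real (box_count A (r k) (T l)) / (r k ^ CARD('m) * T l ^ CARD('n))"

definition U where "U k = approx_set A (r k) (T k)"

lemma T_pos: "0 < T k"
  using T_ge[of k] by linarith

lemma r_decays: "k \<le> l \<Longrightarrow> r l \<le> \<delta> ^ (l - k) * r k"
proof (induction l rule: dec_induct)
  case (step l)
  have "r (Suc l) \<le> \<delta> * r l" by (rule r_decay)
  also have "\<dots> \<le> \<delta> * (\<delta> ^ (l - k) * r k)" using step.IH \<delta> by (intro mult_left_mono) auto
  finally show ?case using step.hyps by (simp add: Suc_diff_le mult.assoc)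
qed simp

lemma T_decays: "k \<le> l \<Longrightarrow> T k \<le> \<delta> ^ (l - k) * T l"
proof (induction l rule: dec_induct)
  case (step l)
  have "\<delta> ^ (l - k) * T l \<le> \<delta> ^ (l - k) * (\<delta> * T (Suc l))"
    using T_decay \<delta> by (intro mult_left_mono) auto
  then show ?case using step by (simp add: Suc_diff_le mult_ac)
qed simp

lemma power_\<delta>_le_1: "\<delta> ^ i \<le> 1"
  using \<delta> by (intro power_le_one) auto

lemma r_antimono:
  assumes "k \<le> l"
  shows "r l \<le> r k"
proof -
  have "r l \<le> \<delta> ^ (l - k) * r k" by (rule r_decays[OF assms])
  also have "\<dots> \<le> 1 * r k" using r_pos[of k] power_\<delta>_le_1 by (intro mult_right_mono) auto
  finally show ?thesis by simp
qed

lemma T_mono: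
  assumes "k \<le> l"
  shows "T k \<le> T l"
proof -
  have "T k \<le> \<delta> ^ (l - k) * T l" by (rule T_decays[OF assms])
  also have "\<dots> \<le> 1 * T l" using T_pos[of l] power_\<delta>_le_1 by (intro mult_right_mono) auto
  finally show ?thesis by simp
qed

lemma box_pos: "0 < real (box_count A (r k) (T l))"
  using box_count_pos[of "r k" "T l" A] r_pos[of k] T_pos[of l] by simp

lemma rT_pos: "0 < r k ^ CARD('m) * T l ^ CARD('n)"
  using r_pos T_pos by simp

lemma M_pos: "0 < M k"
  unfolding M_def using box_pos rT_pos by simp

lemma borel_U [measurable]: "U k \<in> sets borel"
  unfolding U_def by (rule borel_approx_set)

lemma M_le_unit_measure: "M k \<le> 6 ^ (CARD('m) + CARD('n)) * unit_measure (U k)"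
  using unit_measure_approx_set_ge[OF r_pos T_pos, of k k A] box_pos[of k k]
  by (simp add: M_def U_def pos_divide_le_eq mult_ac)

text \<open>An approximation set has measure at most 1. As \<open>G\<close> is bounded below, bounds
  for \<open>M * G\<close> become bounds for \<open>M\<close>.\<close>

lemma G_ge: "1 \<le> 6 ^ (CARD('m) + CARD('n)) * G k l"
proof -
  have "r k ^ CARD('m) * T l ^ CARD('n) \<le> 6 ^ (CARD('m) + CARD('n)) * (real (box_count A (r k) (T l)) * unit_measure (approx_set A (r k) (T l)))"
    by (rule unit_measure_approx_set_ge[OF r_pos T_pos])
  also have "\<dots> \<le> 6 ^ (CARD('m) + CARD('n)) * (real (box_count A (r k) (T l)) * 1)"
    by (intro mult_left_mono unit_measure_le_1 borel_approx_set) auto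
  finally show ?thesis unfolding G_def using rT_pos[of k l] by (simp add: field_simps)
qed

lemma unit_measure_Int_le:
  assumes "k \<le> l"
  shows "unit_measure (U k \<inter> U l) \<le> 6 ^ CARD('n) * 4 ^ CARD('m) * 18 ^ (CARD('m) + CARD('n)) * (M k * M l * G k l)"
proof -
  let ?C = "6 ^ CARD('n) * 4 ^ CARD('m) * 18 ^ (CARD('m) + CARD('n)) :: real"
  have "real (box_count A (r k) (T k)) * real (box_count A (r l) (T l)) * unit_measure (U k \<inter> U l)
    \<le> ?C * (T k ^ CARD('n) * r l ^ CARD('m) * real (box_count A (r k) (T l)))"
    unfolding U_def by (intro unit_measure_approx_set_Int_le r_pos r_antimono T_ge assms)
  then have "unit_measure (U k \<inter> U l) \<le> ?C * (T k ^ CARD('n) * r l ^ CARD('m) * real (box_count A (r k) (T l)))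
      / (real (box_count A (r k) (T k)) * real (box_count A (r l) (T l)))"
    using box_pos[of k k] box_pos[of l l] by (subst pos_le_divide_eq) (auto simp: mult_ac)
  also have "\<dots> = ?C * (M k * M l * G k l)"
    unfolding M_def G_def using r_pos[of k] T_pos[of l] by (simp add: field_simps)
  finally show ?thesis .
qed

text \<open>This is \<open>count_hyperplane_le\<close> in terms of points per volume: the ratio of
  the volumes cancels and only the gain in direction \<open>i0\<close> remains.\<close>

lemma box_count_hyperplane_le:
  assumes rr: "0 < r'" "r' \<le> r0" and TT: "0 < T'" "T' \<le> T0"
    and w: "\<And>v. v \<in> Lambda A \<inter> sbox (sides r0 T0) \<Longrightarrow> w \<bullet> v = 0" "w \<noteq> 0"
    and i0: "\<And>i. \<bar>w $ i\<bar> * sides r' T' i \<le> \<bar>w $ i0\<bar> * sides r' T' i0"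
  shows "real (box_count A r0 T0) / (r0 ^ CARD('m) * T0 ^ CARD('n))
    * (sides r0 T0 i0 / sides r' T' i0) * (r' ^ CARD('m) * T' ^ CARD('n))
    \<le> slab_const (CARD('m) + CARD('n)) * real (box_count A r' T')"
proof -
  have "real (box_count A r0 T0) * (sides r0 T0 i0 / sides r' T' i0)
      \<le> slab_const (CARD('m) + CARD('n)) * (\<Prod>i\<in>(UNIV :: ('m + 'n) set). sides r0 T0 i / sides r' T' i) * real (box_count A r' T')"
  proof -
    have "0 < sides r' T' i" "sides r' T' i \<le> sides r0 T0 i" for i :: "'m + 'n"
      using rr TT by (cases i; simp)+
    then show ?thesis
      using discrete_subgroup.count_hyperplane_le[OF discrete_subgroup_Lambda[of A], of "sides r' T'" "sides r0 T0" w i0] w i0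
      unfolding box_count_eq slab_const_def by (simp add: add_ac)
  qed
  also have "(\<Prod>i\<in>(UNIV :: ('m + 'n) set). sides r0 T0 i / sides r' T' i) = (r0 / r') ^ CARD('m) * (T0 / T') ^ CARD('n)"
    unfolding UNIV_Plus_UNIV[symmetric] by (subst prod.Plus) auto
  finally have 1: "real (box_count A r0 T0) * (sides r0 T0 i0 / sides r' T' i0)
      \<le> slab_const (CARD('m) + CARD('n)) * ((r0 / r') ^ CARD('m) * (T0 / T') ^ CARD('n)) * real (box_count A r' T')" .
  define P where "P = r0 ^ CARD('m) * T0 ^ CARD('n)"
  define P' where "P' = r' ^ CARD('m) * T' ^ CARD('n)"
  have P: "0 < P" "0 < P'" unfolding P_def P'_def using rr TT by auto
  have e: "(r0 / r') ^ CARD('m) * (T0 / T') ^ CARD('n) = P / P'"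
    unfolding P_def P'_def by (simp add: power_divide)
  have "real (box_count A r0 T0) / P * (sides r0 T0 i0 / sides r' T' i0) * P'
     = real (box_count A r0 T0) * (sides r0 T0 i0 / sides r' T' i0) * (P' / P)" by simp
  also have "\<dots> \<le> slab_const (CARD('m) + CARD('n)) * (P / P') * real (box_count A r' T') * (P' / P)"
    using 1 P unfolding e by (intro mult_right_mono) auto
  also have "\<dots> = slab_const (CARD('m) + CARD('n)) * real (box_count A r' T')" using P by simp
  finally show ?thesis unfolding P_def P'_def .
qed

lemma not_stuck_ex_Inr:
  assumes "\<not> stuck w (r k) (T k)"
  obtains i where "\<And>j. \<bar>w $ j\<bar> * sides (r k) (T k) j \<le> \<bar>w $ Inr i\<bar> * T k"
proof -
  let ?f = "\<lambda>j. \<bar>w $ j\<bar> * sides (r k) (T k) j"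
  have "Max (range ?f) \<in> range ?f" by (intro Max_in) auto
  then obtain i0 where "Max (range ?f) = ?f i0" by (rule imageE)
  then have i0: "?f j \<le> ?f i0" for j using Max_ge[of "range ?f" "?f j"] by simp
  show ?thesis
  proof (cases i0)
    case (Inl i)
    then have "stuck w (r k) (T k)" using i0 unfolding stuck_def by (intro exI[of _ i]) simp
    then show ?thesis using assms by simp
  next
    case (Inr i)
    then show ?thesis using that[of i] i0 by simp
  qed
qed

text \<open>The mixed box is shrunk to that of scale \<open>l\<close>: the second factor keeps its
  side, and the largest weighted coordinate of \<open>w\<close> lies in the first, where the gain is
  \<open>r k / r l\<close>.\<close>

lemma stuck_bound:
  assumes kl: "k \<le> l" and w: "\<And>v. v \<in> Lambda A \<inter> sbox (sides (r k) (T l)) \<Longrightarrow> w \<bullet> v = 0" "w \<noteq> 0"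
    and st: "stuck w (r l) (T l)"
  shows "M l * G k l \<le> slab_const (CARD('m) + CARD('n)) * \<delta> ^ (l - k)"
proof -
  obtain i where i: "\<And>j. \<bar>w $ j\<bar> * sides (r l) (T l) j \<le> \<bar>w $ Inl i\<bar> * r l"
    using st unfolding stuck_def by blast
  have "G k l * (r k / r l) * (r l ^ CARD('m) * T l ^ CARD('n)) \<le> slab_const (CARD('m) + CARD('n)) * real (box_count A (r l) (T l))"
    using box_count_hyperplane_le[OF r_pos r_antimono[OF kl] T_pos order_refl w, where ?i0.0 = "Inl i"] i unfolding G_def by simp
  then have "G k l * (r k / r l) * (r l ^ CARD('m) * T l ^ CARD('n)) / real (box_count A (r l) (T l))
      \<le> slab_const (CARD('m) + CARD('n))"
    by (subst pos_divide_le_eq[OF box_pos])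
  then have "G k l * (r k / r l) * M l \<le> slab_const (CARD('m) + CARD('n))"
    unfolding M_def by (simp only: times_divide_eq_right)
  then have "M l * G k l * (r k / r l) \<le> slab_const (CARD('m) + CARD('n))" by (simp add: mult_ac)
  then have "M l * G k l \<le> slab_const (CARD('m) + CARD('n)) / (r k / r l)"
    by (rule mult_inverse_bound) (use r_pos[of k] r_pos[of l] in simp)
  also have "\<dots> = slab_const (CARD('m) + CARD('n)) * (r l / r k)" by simp
  also have "\<dots> \<le> slab_const (CARD('m) + CARD('n)) * \<delta> ^ (l - k)"
    using r_decays[OF kl] r_pos[of k] slab_const_pos[of "CARD('m) + CARD('n)"]
    by (intro mult_left_mono) (auto simp: pos_divide_le_eq)
  finally show ?thesis .
qed

text \<open>The counterpart of \<open>stuck_bound\<close> with the box of scale \<open>k\<close>: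
  the first factor keeps its side, and the gain \<open>T l / T k\<close> comes from a coordinate of
  the second.\<close>

lemma moving_bound:
  assumes kl: "k \<le> l" and w: "\<And>v. v \<in> Lambda A \<inter> sbox (sides (r k) (T l)) \<Longrightarrow> w \<bullet> v = 0" "w \<noteq> 0"
    and st: "\<not> stuck w (r k) (T k)"
  shows "M k * G k l \<le> slab_const (CARD('m) + CARD('n)) * \<delta> ^ (l - k)"
proof -
  obtain i where i: "\<And>j. \<bar>w $ j\<bar> * sides (r k) (T k) j \<le> \<bar>w $ Inr i\<bar> * T k"
    using not_stuck_ex_Inr[OF st] by blast
  have "G k l * (T l / T k) * (r k ^ CARD('m) * T k ^ CARD('n)) \<le> slab_const (CARD('m) + CARD('n)) * real (box_count A (r k) (T k))"
    using box_count_hyperplane_le[OF r_pos order_refl T_pos T_mono[OF kl] w, where ?i0.0 = "Inr i"] i unfolding G_def by simp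
  then have "G k l * (T l / T k) * (r k ^ CARD('m) * T k ^ CARD('n)) / real (box_count A (r k) (T k))
      \<le> slab_const (CARD('m) + CARD('n))"
    by (subst pos_divide_le_eq[OF box_pos])
  then have "G k l * (T l / T k) * M k \<le> slab_const (CARD('m) + CARD('n))"
    unfolding M_def by (simp only: times_divide_eq_right)
  then have "M k * G k l * (T l / T k) \<le> slab_const (CARD('m) + CARD('n))" by (simp add: mult_ac)
  then have "M k * G k l \<le> slab_const (CARD('m) + CARD('n)) / (T l / T k)"
    by (rule mult_inverse_bound) (use T_pos[of k] T_pos[of l] in simp)
  also have "\<dots> = slab_const (CARD('m) + CARD('n)) * (T k / T l)" by simp
  also have "\<dots> \<le> slab_const (CARD('m) + CARD('n)) * \<delta> ^ (l - k)"
    using T_decays[OF kl] T_pos[of l] slab_const_pos[of "CARD('m) + CARD('n)"]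
    by (intro mult_left_mono) (auto simp: pos_divide_le_eq)
  finally show ?thesis .
qed

section \<open>Bad pairs of indices, and the classes of indices\<close>

definition bad :: "nat \<Rightarrow> nat \<Rightarrow> bool" where
  "bad k l \<longleftrightarrow> span (Lambda A \<inter> sbox (sides (r k) (T l))) \<noteq> UNIV"

lemma bad_antimono: "bad k l \<Longrightarrow> k \<le> k' \<Longrightarrow> l' \<le> l \<Longrightarrow> bad k' l'"
proof -
  assume b: "bad k l" and kl: "k \<le> k'" "l' \<le> l"
  have "sbox (sides (r k') (T l')) \<subseteq> sbox (sides (r k) (T l))"
    by (intro sbox_mono sides_mono r_antimono T_mono kl)
  then have "span (Lambda A \<inter> sbox (sides (r k') (T l'))) \<subseteq> span (Lambda A \<inter> sbox (sides (r k) (T l)))"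
    by (intro span_mono) auto
  then show ?thesis using b unfolding bad_def by auto
qed

lemma T_unbounded: "\<exists>l\<ge>k. c \<le> T l"
proof -
  have "(\<lambda>i. \<delta> ^ i) \<longlonglongrightarrow> 0" using \<delta> by (intro LIMSEQ_power_zero) auto
  then have "\<forall>\<^sub>F i in sequentially. \<delta> ^ i < T k / (\<bar>c\<bar> + 1)"
    using T_pos[of k] by (intro order_tendstoD(2)) (auto intro!: divide_pos_pos)
  then obtain i where i: "\<delta> ^ i < T k / (\<bar>c\<bar> + 1)" by (meson eventually_sequentially order_refl)
  have "T k \<le> \<delta> ^ i * T (k + i)" using T_decays[of k "k + i"] by simp
  also have "\<dots> \<le> T k / (\<bar>c\<bar> + 1) * T (k + i)" using i T_pos[of "k + i"] by (intro mult_right_mono) auto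
  finally have "T k * (\<bar>c\<bar> + 1) \<le> T k * T (k + i)" by (simp add: field_simps)
  then have "\<bar>c\<bar> + 1 \<le> T (k + i)" using T_pos[of k] by (rule mult_left_le_imp_le)
  then show ?thesis by (intro exI[of _ "k + i"]) auto
qed

text \<open>If no box with first side \<open>r k\<close> spans, all lattice points in the strip of
  that width lie in one hyperplane, whatever their height. Its normal vector \<open>w\<close> serves
  all scales from \<open>k\<close> on. Were \<open>w\<close> not stuck at some \<open>l0\<close>,
  \<open>moving_bound\<close> with the second index tending to infinity would force
  \<open>M l0\<close> to vanish; so \<open>w\<close> is always stuck, and \<open>stuck_bound\<close>
  gives geometric decay of \<open>M\<close>.\<close>

lemma summable_if_always_bad:
  assumes b: "\<And>l. k < l \<Longrightarrow> bad k l"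
  shows "summable M"
proof -
  define S where "S = {v \<in> Lambda A. \<forall>i. \<bar>v $ Inl i\<bar> \<le> r k}"
  have "span S \<noteq> UNIV"
  proof
    assume sp: "span S = UNIV"
    obtain B where B: "B \<subseteq> S" "independent B" "S \<subseteq> span B"
      using basis_exists[of S] by metis
    have finB: "finite B" using B(2) independent_imp_finite by blast
    have spB: "span B = UNIV" using B(3) sp by (metis span_mono span_span top.extremum_uniqueI)
    obtain l where l: "Suc k \<le> l" "(\<Sum>v\<in>B. infnorm v) \<le> T l" using T_unbounded by blast
    have "B \<subseteq> Lambda A \<inter> sbox (sides (r k) (T l))"
    proof
      fix v assume v: "v \<in> B"
      have "infnorm v \<le> (\<Sum>v\<in>B. infnorm v)"
        using v finB by (intro member_le_sum infnorm_pos_le) auto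
      then have "\<bar>v $ Inr j\<bar> \<le> T l" for j
        using component_le_infnorm_cart[of v "Inr j"] l by linarith
      then show "v \<in> Lambda A \<inter> sbox (sides (r k) (T l))"
        using v B(1) unfolding S_def by (auto simp: sbox_sides_iff)
    qed
    then have "span (Lambda A \<inter> sbox (sides (r k) (T l))) = UNIV"
      using spB by (metis span_mono top.extremum_uniqueI)
    then show False using b[of l] l unfolding bad_def by simp
  qed
  then obtain w where w: "w \<noteq> 0" "\<And>v. v \<in> span S \<Longrightarrow> w \<bullet> v = 0"
    using span_not_UNIV_orthogonal by metis
  have orth: "w \<bullet> v = 0" if v: "v \<in> Lambda A \<inter> sbox (sides (r j) (T l))" and j: "k \<le> j" for v j l
  proof -
    have "v \<in> S" unfolding S_def using v r_antimono[OF j] order_trans by (fastforce simp: sbox_sides_iff)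
    then show ?thesis using w(2) span_base by blast
  qed
  have "(\<lambda>i. 6 ^ (CARD('m) + CARD('n)) * slab_const (CARD('m) + CARD('n)) * \<delta> ^ i) \<longlonglongrightarrow> 6 ^ (CARD('m) + CARD('n)) * slab_const (CARD('m) + CARD('n)) * 0"
    using \<delta> by (intro tendsto_mult_left LIMSEQ_power_zero) auto
  then have lim: "(\<lambda>i. 6 ^ (CARD('m) + CARD('n)) * slab_const (CARD('m) + CARD('n)) * \<delta> ^ i) \<longlonglongrightarrow> 0" by simp
  have st: "stuck w (r l0) (T l0)" if l0: "k \<le> l0" for l0
  proof (rule ccontr)
    assume ns: "\<not> stuck w (r l0) (T l0)"
    have "M l0 \<le> 6 ^ (CARD('m) + CARD('n)) * slab_const (CARD('m) + CARD('n)) * \<delta> ^ i" for i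
    proof -
      have "M l0 * 1 \<le> M l0 * (6 ^ (CARD('m) + CARD('n)) * G l0 (l0 + i))" using G_ge M_pos[of l0] by (intro mult_left_mono) auto
      also have "\<dots> = 6 ^ (CARD('m) + CARD('n)) * (M l0 * G l0 (l0 + i))" by simp
      also have "\<dots> \<le> 6 ^ (CARD('m) + CARD('n)) * (slab_const (CARD('m) + CARD('n)) * \<delta> ^ (l0 + i - l0))"
        using orth[OF _ l0] w(1) ns by (intro mult_left_mono moving_bound) auto
      finally show ?thesis by simp
    qed
    then have "M l0 \<le> 0" using lim by (intro LIMSEQ_le_const) auto
    then show False using M_pos[of l0] by simp
  qed
  have "M (i + k) \<le> 6 ^ (CARD('m) + CARD('n)) * slab_const (CARD('m) + CARD('n)) * \<delta> ^ i" for i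
  proof -
    have "M (i + k) * 1 \<le> M (i + k) * (6 ^ (CARD('m) + CARD('n)) * G k (i + k))" using G_ge M_pos[of "i + k"] by (intro mult_left_mono) auto
    also have "\<dots> = 6 ^ (CARD('m) + CARD('n)) * (M (i + k) * G k (i + k))" by simp
    also have "\<dots> \<le> 6 ^ (CARD('m) + CARD('n)) * (slab_const (CARD('m) + CARD('n)) * \<delta> ^ (i + k - k))"
      using orth w(1) st[of "i + k"] by (intro mult_left_mono stuck_bound) auto
    finally show ?thesis by simp
  qed
  moreover have "summable (\<lambda>i. 6 ^ (CARD('m) + CARD('n)) * slab_const (CARD('m) + CARD('n)) * \<delta> ^ i)" using \<delta> by (intro summable_mult summable_geometric) auto
  ultimately have "summable (\<lambda>i. M (i + k))"
    using M_pos by (intro summable_comparison_test[of "\<lambda>i. M (i + k)" "\<lambda>i. 6 ^ (CARD('m) + CARD('n)) * slab_const (CARD('m) + CARD('n)) * \<delta> ^ i"]) (auto intro!: exI[of _ 0] simp: abs_of_pos)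
  then show ?thesis by (simp add: summable_iff_shift)
qed

lemma not_always_bad:
  assumes "\<not> summable M"
  shows "\<exists>l>k. \<not> bad k l"
proof (rule ccontr)
  assume "\<not> ?thesis"
  then have "bad k l" if "k < l" for l using that by simp
  then show False using assms summable_if_always_bad[of k] by simp
qed

text \<open>First \<open>r k\<close> is made so small that rounding costs at most \<epsilon>, then
  \<open>T l\<close> so large that the box spans; divergence provides such an
  \<open>l\<close>.\<close>

lemma dense_if_divergent:
  assumes div: "\<not> summable M" and e: "0 < \<epsilon>"
  obtains p q where "p \<in> int_vecs" "q \<in> int_vecs" "b \<in> cube (A *v q + p) \<epsilon>"
proof -
  have "(\<lambda>i. \<delta> ^ i * r 0) \<longlonglongrightarrow> 0 * r 0" using \<delta> by (intro tendsto_mult_right LIMSEQ_power_zero) auto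
  then have "\<forall>\<^sub>F i in sequentially. \<delta> ^ i * r 0 < \<epsilon> / real (CARD('m) + CARD('n))"
    using e by (intro order_tendstoD(2)) (auto intro!: divide_pos_pos add_pos_pos)
  then obtain k where "\<delta> ^ k * r 0 < \<epsilon> / real (CARD('m) + CARD('n))" by (meson eventually_sequentially order_refl)
  then have "r k \<le> \<epsilon> / real (CARD('m) + CARD('n))" using r_decays[of 0 k] by simp
  moreover have d0: "0 < real (CARD('m) + CARD('n))" using zero_less_card_finite[where 'a = 'm] by linarith
  ultimately have k: "real (CARD('m) + CARD('n)) * r k \<le> \<epsilon>" by (simp add: pos_le_divide_eq mult.commute)
  obtain l where "\<not> bad k l" using not_always_bad[OF div] by metis
  then have "span (Lambda A \<inter> sbox (sides (r k) (T l))) = UNIV" by (simp only: bad_def not_not)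
  then have "b \<in> approx_set A (real (CARD('m) + CARD('n)) * r k) (real (CARD('m) + CARD('n)) * T l)"
    by (rule rounding_to_lattice)
  then obtain p q where pq: "p \<in> int_vecs" "q \<in> int_vecs" "lat_pt A p q - emb b \<in> sbox (sides (real (CARD('m) + CARD('n)) * r k) (real (CARD('m) + CARD('n)) * T l))"
    unfolding approx_set_def Lambda_eq by auto
  have "b \<in> cube (A *v q + p) \<epsilon>"
  proof (unfold cube_iff, intro allI)
    fix i
    have "\<bar>(A *v q + p) $ i - b $ i\<bar> \<le> real (CARD('m) + CARD('n)) * r k" using pq(3) unfolding diff_emb_sbox_iff cube_iff by simp
    then show "\<bar>(A *v q + p) $ i - b $ i\<bar> \<le> \<epsilon>" using k by linarith
  qed
  then show ?thesis using that pq by blast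
qed

lemma quasi_independent_coloring:
  assumes unb: "\<And>k. \<exists>l>k. \<not> bad k l"
  obtains C and col :: "nat \<Rightarrow> bool \<times> bool" where "1 \<le> C"
    "\<And>k l. k < l \<Longrightarrow> col k = col l \<Longrightarrow>
       unit_measure (U k \<inter> U l) \<le> C * (M k * M l + \<delta> ^ (l - k) * (M k + M l))"
proof -
  obtain K where K: "K 0 = 0" "strict_mono K" "\<And>i. \<not> bad (K i) (K (Suc i))"
    "\<And>i l. K i < l \<Longrightarrow> l < K (Suc i) \<Longrightarrow> bad (K i) l" 
    using that by (rule ex_blocks[of bad, OF unb])
  obtain blk where blk: "\<And>k. K (blk k) \<le> k" "\<And>k. k < K (Suc (blk k))" "mono blk"
    using that by (rule ex_block_index[OF K(1,2)])
  \<comment> \<open>The box with sides \<open>r (K i)\<close> and \<open>T (K (Suc i) - 1)\<close>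
    contains the mixed boxes of all pairs in block \<open>i\<close>, and its last index is still bad
    if the block has more than one element. A block of one element contains no pair, so there the
    choice may be arbitrary.\<close>
  define w where "w i = (SOME w. w \<noteq> 0 \<and> (\<forall>v\<in>Lambda A \<inter> sbox (sides (r (K i)) (T (K (Suc i) - 1))). w \<bullet> v = 0))" for i
  have w: "w i \<noteq> 0 \<and> (\<forall>v\<in>Lambda A \<inter> sbox (sides (r (K i)) (T (K (Suc i) - 1))). w i \<bullet> v = 0)"
    if b: "bad (K i) (K (Suc i) - 1)" for i
  proof -
    obtain w0 where w0: "w0 \<noteq> 0"
      "\<forall>v\<in>span (Lambda A \<inter> sbox (sides (r (K i)) (T (K (Suc i) - 1)))). w0 \<bullet> v = 0"
      using span_not_UNIV_orthogonal[OF b[unfolded bad_def]] by auto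
    have "w0 \<noteq> 0 \<and> (\<forall>v\<in>Lambda A \<inter> sbox (sides (r (K i)) (T (K (Suc i) - 1))). w0 \<bullet> v = 0)"
      using w0(1) by (intro conjI ballI w0(2)[rule_format] span_base)
    then show ?thesis unfolding w_def by (rule someI)
  qed
  define col where "col k = (even (blk k), stuck (w (blk k)) (r k) (T k))" for k
  define C1 :: real where "C1 = 6 ^ CARD('n) * 4 ^ CARD('m) * 18 ^ (CARD('m) + CARD('n))"
  define C2 :: real where "C2 = 6 ^ CARD('n) * 4 ^ CARD('m) * real (CARD('m) + CARD('n)) ^ (CARD('m) + CARD('n))"
  define Kc where "Kc = slab_const (CARD('m) + CARD('n))"
  have Kc: "0 < Kc" "0 \<le> Kc" unfolding Kc_def using slab_const_pos less_imp_le by auto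
  define C where "C = 1 + C1 * (C2 + Kc)"
  have C1: "0 < C1" unfolding C1_def by simp
  have C2: "0 \<le> C2" unfolding C2_def by simp
  have "1 \<le> C" unfolding C_def using C1 C2 Kc by simp
  moreover have "unit_measure (U k \<inter> U l) \<le> C * (M k * M l + \<delta> ^ (l - k) * (M k + M l))"
    if kl: "k < l" and c: "col k = col l" for k l
  proof -
    have main: "unit_measure (U k \<inter> U l) \<le> C1 * (M k * M l * G k l)"
      unfolding C1_def using kl by (intro unit_measure_Int_le) simp
    have pos: "0 \<le> M k * M l" "0 \<le> \<delta> ^ (l - k) * M k" "0 \<le> \<delta> ^ (l - k) * M l"
      using M_pos[of k] M_pos[of l] \<delta> by auto
    have posK: "0 \<le> Kc * (\<delta> ^ (l - k) * M k)" "0 \<le> Kc * (\<delta> ^ (l - k) * M l)"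
      using pos Kc by (simp_all only: mult_nonneg_nonneg)
    have MG: "M k * M l * G k l \<le> C2 * (M k * M l) + Kc * (\<delta> ^ (l - k) * (M k + M l))"
    proof (cases "blk k = blk l")
      case True
      let ?i = "blk k"
      have i: "K ?i \<le> k" "l \<le> K (Suc ?i) - 1" using blk(1)[of k] blk(2)[of l] True by auto
      then have "bad (K ?i) (K (Suc ?i) - 1)" using kl by (intro K(4)) auto
      note wi = w[OF this]
      have orth: "w ?i \<bullet> v = 0" if "v \<in> Lambda A \<inter> sbox (sides (r k) (T l))" for v
      proof -
        have "sbox (sides (r k) (T l)) \<subseteq> sbox (sides (r (K ?i)) (T (K (Suc ?i) - 1)))"
          using i by (intro sbox_mono sides_mono r_antimono T_mono)
        then show ?thesis using wi that by blast
      qed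
      have "M k * M l * G k l \<le> Kc * (\<delta> ^ (l - k) * (M k + M l))"
      proof (cases "stuck (w ?i) (r l) (T l)")
        case True
        have "M k * (M l * G k l) \<le> M k * (Kc * \<delta> ^ (l - k))"
          using kl orth wi True M_pos[of k] by (intro mult_left_mono stuck_bound[folded Kc_def]) auto
        also have "\<dots> \<le> Kc * (\<delta> ^ (l - k) * (M k + M l))" using posK by (simp add: algebra_simps)
        finally show ?thesis by (simp add: mult.assoc)
      next
        case False
        \<comment> \<open>Here the colour transfers the failure of stuckness from \<open>l\<close>
          to \<open>k\<close>, where \<open>moving_bound\<close> needs it.\<close>
        then have "\<not> stuck (w ?i) (r k) (T k)" using c True \<open>blk k = blk l\<close> unfolding col_def by simp
        then have "M l * (M k * G k l) \<le> M l * (Kc * \<delta> ^ (l - k))"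
          using kl orth wi M_pos[of l] by (intro mult_left_mono moving_bound[folded Kc_def]) auto
        also have "\<dots> \<le> Kc * (\<delta> ^ (l - k) * (M k + M l))" using posK by (simp add: algebra_simps)
        finally show ?thesis by (simp add: mult_ac)
      qed
      then show ?thesis using C2 pos by (simp add: add_increasing)
    next
      case False
      have "blk k \<le> blk l" using blk(3) kl by (simp add: monoD)
      moreover have "even (blk k) = even (blk l)" using c unfolding col_def by simp
      \<comment> \<open>Two distinct blocks of equal parity have a whole block between them. The box
        of its start and of the start of its successor spans, and it lies inside the box of
        \<open>k\<close> and \<open>l\<close>.\<close>
      ultimately have "Suc (Suc (blk k)) \<le> blk l" using False by (metis Suc_leI even_Suc le_neq_implies_less)
      then have "K (Suc (Suc (blk k))) \<le> K (blk l)" using K(2) by (simp add: strict_mono_less_eq)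
      then have "K (Suc (Suc (blk k))) \<le> l" using blk(1)[of l] by simp
      moreover have "k \<le> K (Suc (blk k))" using blk(2)[of k] by simp
      ultimately have "\<not> bad k l" using K(3)[of "Suc (blk k)"] bad_antimono by blast
      then have "real (box_count A (r k) (T l)) \<le> C2 * (r k ^ CARD('m) * T l ^ CARD('n))"
        unfolding bad_def C2_def by (intro box_count_le_of_span r_pos T_ge) simp
      then have "G k l \<le> C2" unfolding G_def using rT_pos[of k l] by (simp add: pos_divide_le_eq)
      then have "M k * M l * G k l \<le> M k * M l * C2" using pos by (intro mult_left_mono) auto
      moreover have "0 \<le> Kc * (\<delta> ^ (l - k) * (M k + M l))" using pos Kc(2) by (simp add: distrib_left)
      ultimately show ?thesis by (simp add: mult.commute)
    qed
    have "unit_measure (U k \<inter> U l) \<le> C1 * (C2 * (M k * M l) + Kc * (\<delta> ^ (l - k) * (M k + M l)))"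
      using main MG C1 by (meson less_imp_le mult_left_mono order_trans)
    also have "\<dots> \<le> C1 * ((C2 + Kc) * (M k * M l) + (C2 + Kc) * (\<delta> ^ (l - k) * (M k + M l)))"
    proof -
      have "0 \<le> Kc * (M k * M l)" "0 \<le> C2 * (\<delta> ^ (l - k) * (M k + M l))"
        using pos C2 Kc(2) by (auto simp: distrib_left)
      then show ?thesis using C1 by (intro mult_left_mono) (auto simp: algebra_simps)
    qed
    also have "\<dots> = (C - 1) * (M k * M l + \<delta> ^ (l - k) * (M k + M l))"
      unfolding C_def by (simp add: algebra_simps)
    also have "\<dots> \<le> C * (M k * M l + \<delta> ^ (l - k) * (M k + M l))"
      using pos by (intro mult_right_mono) (auto simp: distrib_left)
    finally show ?thesis .
  qed
  ultimately show ?thesis using that by blast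
qed

text \<open>One of the four colours carries a divergent part of the sum, and the second moment
  argument is applied to its sets alone.\<close>

lemma limsup_measure_pos:
  assumes div: "\<not> summable M"
  shows "0 < unit_measure (\<Inter>n. \<Union>k\<in>{n..}. U k)"
proof -
  note unb = not_always_bad[OF div]
  obtain C and col :: "nat \<Rightarrow> bool \<times> bool" where C: "1 \<le> C"
    "\<And>k l. k < l \<Longrightarrow> col k = col l \<Longrightarrow>
       unit_measure (U k \<inter> U l) \<le> C * (M k * M l + \<delta> ^ (l - k) * (M k + M l))"
    using that by (rule quasi_independent_coloring[OF unb])
  have "\<exists>c. \<not> summable (\<lambda>k. if col k = c then M k else 0)"
  proof (rule ccontr)
    assume "\<not> ?thesis"
    then have "summable (\<lambda>k. \<Sum>c\<in>UNIV. if col k = c then M k else 0)" by (intro summable_sum) auto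
    then show False using div by simp
  qed
  then obtain c where c: "\<not> summable (\<lambda>k. if col k = c then M k else 0)" by blast
  \<comment> \<open>Empty sets replace those of the other colours; a pair with an empty member
    satisfies the pair bound trivially.\<close>
  define B where "B k = (if col k = c then unit_cube \<inter> U k else {})" for k
  interpret P: prob_space "torus_prob :: (real ^ 'm) measure" by (rule prob_space_torus_prob)
  have ev: "B k \<in> P.events" for k
    unfolding B_def torus_prob_def by (auto simp: sets_restrict_space)
  have prob: "P.prob (B k) = (if col k = c then unit_measure (U k) else 0)" for k
    unfolding B_def by (simp add: unit_measure_eq_prob)
  \<comment> \<open>The comparison of \<open>M k\<close> with \<open>D * unit_measure (U k)\<close>
    serves twice: it turns the pair bound into one for probabilities, and it carries divergence over
    to them.\<close>
  define D :: real where "D = 6 ^ (CARD('m) + CARD('n))"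
  have D: "1 \<le> D" unfolding D_def by simp
  have MP: "M k \<le> D * unit_measure (U k)" for k unfolding D_def by (rule M_le_unit_measure)
  have pair: "P.prob (B k \<inter> B l) \<le> (C * D\<^sup>2) * (P.prob (B k) * P.prob (B l) + \<delta> ^ (l - k) * (P.prob (B k) + P.prob (B l)))"
    if kl: "k < l" for k l
  proof (cases "col k = c \<and> col l = c")
    case True
    let ?p = "unit_measure (U k)" and ?q = "unit_measure (U l)"
    have p0: "0 \<le> ?p" "0 \<le> ?q" by (simp_all add: unit_measure_nonneg)
    have "P.prob (B k \<inter> B l) = unit_measure (U k \<inter> U l)"
      using True unfolding B_def by (simp add: unit_measure_eq_prob Int_ac)
    also have "\<dots> \<le> C * (M k * M l + \<delta> ^ (l - k) * (M k + M l))" using True kl by (intro C(2)) auto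
    also have "\<dots> \<le> C * ((D * ?p) * (D * ?q) + \<delta> ^ (l - k) * (D * ?p + D * ?q))"
      using MP M_pos less_imp_le D p0 C(1) \<delta> by (intro mult_left_mono add_mono mult_mono) (auto simp: less_imp_le)
    also have "\<dots> \<le> C * (D\<^sup>2 * (?p * ?q) + D\<^sup>2 * (\<delta> ^ (l - k) * (?p + ?q)))"
    proof -
      have "D * (\<delta> ^ (l - k) * (?p + ?q)) \<le> D\<^sup>2 * (\<delta> ^ (l - k) * (?p + ?q))"
        using D p0 \<delta> by (intro mult_right_mono self_le_power) auto
      then show ?thesis using C(1) by (intro mult_left_mono) (auto simp: power2_eq_square algebra_simps)
    qed
    finally show ?thesis using True by (simp add: prob algebra_simps)
  next
    case False
    then have "B k \<inter> B l = {}" unfolding B_def by auto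
    moreover have "0 \<le> (C * D\<^sup>2) * (P.prob (B k) * P.prob (B l) + \<delta> ^ (l - k) * (P.prob (B k) + P.prob (B l)))"
      using C(1) \<delta> by (intro mult_nonneg_nonneg add_nonneg_nonneg) auto
    ultimately show ?thesis by simp
  qed
  have "\<not> summable (\<lambda>k. P.prob (B k))"
  proof
    assume "summable (\<lambda>k. P.prob (B k))"
    then have "summable (\<lambda>k. D * P.prob (B k))" by (rule summable_mult)
    then have "summable (\<lambda>k. if col k = c then M k else 0)"
    proof (rule summable_comparison_test'[where N = 0])
      fix k show "norm (if col k = c then M k else 0) \<le> D * P.prob (B k)"
        using MP[of k] M_pos[of k] by (simp add: prob)
    qed
    then show False using c by simp
  qed
  moreover have "1 \<le> C * D\<^sup>2" using C(1) D mult_mono[of 1 C 1 "D\<^sup>2"] by (simp add: one_le_power)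
  ultimately have "0 < P.prob (\<Inter>n. \<Union>k\<in>{n..}. B k)"
    using P.prob_limsup_pos[OF ev \<delta> _ pair] by blast
  also have "\<dots> \<le> P.prob (unit_cube \<inter> (\<Inter>n. \<Union>k\<in>{n..}. U k))"
  proof (rule P.finite_measure_mono)
    show "(\<Inter>n. \<Union>k\<in>{n..}. B k) \<subseteq> unit_cube \<inter> (\<Inter>n. \<Union>k\<in>{n..}. U k)"
      unfolding B_def by (auto split: if_splits)
    have "(\<Inter>n. \<Union>k\<in>{n..}. U k) \<in> sets borel" by measurable
    then show "unit_cube \<inter> (\<Inter>n. \<Union>k\<in>{n..}. U k) \<in> P.events"
      unfolding torus_prob_def by (auto simp: sets_restrict_space)
  qed
  also have "\<dots> = unit_measure (\<Inter>n. \<Union>k\<in>{n..}. U k)"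
    by (rule unit_measure_eq_prob[symmetric]) measurable
  finally show ?thesis .
qed

end

subsection \<open>Translates of sets of positive measure\<close>

lemma nn_integral_lborel_reflect:
  fixes f :: "'a::euclidean_space \<Rightarrow> ennreal"
  assumes [measurable]: "f \<in> borel_measurable borel"
  shows "(\<integral>\<^sup>+x. f (y - x) \<partial>lborel) = (\<integral>\<^sup>+x. f x \<partial>lborel)"
proof -
  have "lborel = distr lborel borel (\<lambda>x. y - x)"
    using lborel_affine[of "-1" y] by (simp add: density_1)
  then have "(\<integral>\<^sup>+x. f x \<partial>lborel) = (\<integral>\<^sup>+x. f x \<partial>distr lborel borel (\<lambda>x. y - x))" by simp
  also have "\<dots> = (\<integral>\<^sup>+x. f (y - x) \<partial>lborel)" by (rule nn_integral_distr) measurable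
  finally show ?thesis by simp
qed

lemma emeasure_lborel_translate:
  fixes S :: "'a::euclidean_space set"
  assumes "S \<in> sets borel"
  shows "emeasure lborel {x. x - h \<in> S} = emeasure lborel S"
proof -
  have [measurable]: "S \<in> sets borel" by fact
  have "emeasure lborel S = emeasure (distr lborel borel ((+) (- h))) S" by (simp add: lborel_distr_plus)
  also have "\<dots> = emeasure lborel ((+) (- h) -` S \<inter> space lborel)" by (rule emeasure_distr) measurable
  also have "(+) (- h) -` S \<inter> space lborel = {x. x - h \<in> S}" by auto
  finally show ?thesis by simp
qed

text \<open>Outer regularity is applied to the complement of \<open>S\<close>: the complement of the
  open set obtained is closed, lies in \<open>S\<close> and retains positive measure.\<close>

lemma inner_compact_pos:
  fixes S :: "'a::euclidean_space set"
  assumes S: "S \<in> sets borel" "bounded S" and pos: "0 < emeasure lborel S"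
  obtains K where "compact K" "K \<subseteq> S" "0 < emeasure lborel K"
proof -
  obtain e :: real where e: "0 < e" "ennreal e < emeasure lborel S"
  proof -
    obtain q where "0 < q" "q < emeasure lborel S" using dense[OF pos] by blast
    then show ?thesis using that[of "enn2real q"] by (cases q) (auto simp: less_top[symmetric])
  qed
  obtain G where G: "open G" "- S \<subseteq> G" "emeasure lborel (G - - S) < ennreal e"
    using outer_regular_lborel[of "- S" e] S(1) e(1) by auto
  have K: "- G \<subseteq> S" using G(2) by auto
  have "compact (- G)" using K G(1) S(2) bounded_subset compact_eq_bounded_closed by (metis closed_Compl)
  moreover have "0 < emeasure lborel (- G)"
  proof (rule ccontr)
    assume "\<not> ?thesis"
    then have z: "emeasure lborel (- G) = 0" by simp
    have "emeasure lborel S \<le> emeasure lborel (- G \<union> (G - - S))"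
      using G(1) S(1) by (intro emeasure_mono) auto
    also have "\<dots> \<le> emeasure lborel (- G) + emeasure lborel (G - - S)"
      using G(1) S(1) by (intro emeasure_subadditive) auto
    also have "\<dots> < ennreal e" using G(3) z by simp
    finally show False using e(2) by simp
  qed
  ultimately show ?thesis using that K by blast
qed

text \<open>By Tonelli the measures of the overlaps integrate over all translations to the product
  of the two measures, which is positive.\<close>

lemma ex_translate_Int_pos:
  fixes K Z :: "'a::euclidean_space set"
  assumes [measurable]: "K \<in> sets borel" "Z \<in> sets borel"
    and pos: "0 < emeasure lborel K" "0 < emeasure lborel Z"
  obtains x where "0 < emeasure lborel (Z \<inter> {y. y - x \<in> K})"
proof (rule ccontr)
  assume "\<not> thesis"
  then have z: "emeasure lborel (Z \<inter> {y. y - x \<in> K}) = 0" for x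
    using that[of x] by (auto simp: zero_less_iff_neq_zero)
  have "(\<integral>\<^sup>+y. (\<integral>\<^sup>+x. indicator Z y * indicator K (y - x) \<partial>lborel) \<partial>lborel)
     = (\<integral>\<^sup>+x. (\<integral>\<^sup>+y. indicator Z y * indicator K (y - x) \<partial>lborel) \<partial>lborel)"
    by (rule lborel_pair.Fubini') measurable
  also have "\<dots> = (\<integral>\<^sup>+x. emeasure lborel (Z \<inter> {y. y - x \<in> K}) \<partial>lborel)"
  proof (rule nn_integral_cong)
    fix x :: 'a
    have "(\<integral>\<^sup>+y. indicator Z y * indicator K (y - x) \<partial>lborel) = (\<integral>\<^sup>+y. indicator (Z \<inter> {y. y - x \<in> K}) y \<partial>lborel)"
      by (rule nn_integral_cong) (simp add: indicator_def)
    also have "\<dots> = emeasure lborel (Z \<inter> {y. y - x \<in> K})" by (rule nn_integral_indicator) measurable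
    finally show "(\<integral>\<^sup>+y. indicator Z y * indicator K (y - x) \<partial>lborel) = emeasure lborel (Z \<inter> {y. y - x \<in> K})" .
  qed
  also have "\<dots> = 0" unfolding z by simp
  also have "(\<integral>\<^sup>+y. (\<integral>\<^sup>+x. indicator Z y * indicator K (y - x) \<partial>lborel) \<partial>lborel)
      = (\<integral>\<^sup>+y. indicator Z y * (\<integral>\<^sup>+x. indicator K (y - x) \<partial>lborel) \<partial>lborel)"
    by (intro nn_integral_cong nn_integral_cmult) measurable
  also have "\<dots> = (\<integral>\<^sup>+y. indicator Z y * emeasure lborel K \<partial>lborel)"
    by (subst nn_integral_lborel_reflect) auto
  also have "\<dots> = emeasure lborel Z * emeasure lborel K" by (simp add: nn_integral_multc)
  finally show False using pos by auto
qed

text \<open>A form of the theorem of Steinhaus for two sets. Some translate of a compact part of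
  \<open>V\<close> meets \<open>Z\<close> in measure greater than \<open>e\<close>; a nearby
  translate differs from it by measure less than \<open>e\<close>, so it cannot avoid
  \<open>Z\<close>.\<close>

lemma steinhaus_two_sets:
  fixes V Z :: "'a::euclidean_space set"
  assumes V: "V \<in> sets borel" "bounded V" "0 < emeasure lborel V"
    and Z: "Z \<in> sets borel" "0 < emeasure lborel Z"
  obtains x0 \<epsilon> where "0 < \<epsilon>" "\<And>x. x \<in> ball x0 \<epsilon> \<Longrightarrow> \<exists>v\<in>V. v + x \<in> Z"
proof -
  obtain K where K: "compact K" "K \<subseteq> V" "0 < emeasure lborel K" using inner_compact_pos[OF V] by metis
  have Kb [measurable]: "K \<in> sets borel" using K(1) by (simp add: borel_closed compact_imp_closed)
  have [measurable]: "Z \<in> sets borel" by (rule Z(1))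
  obtain x0 where x0: "0 < emeasure lborel (Z \<inter> {y. y - x0 \<in> K})"
    using ex_translate_Int_pos[OF Kb Z(1) K(3) Z(2)] by metis
  obtain e :: real where e: "0 < e" "ennreal e < emeasure lborel (Z \<inter> {y. y - x0 \<in> K})"
  proof -
    obtain q where "0 < q" "q < emeasure lborel (Z \<inter> {y. y - x0 \<in> K})" using dense[OF x0] by blast
    then show ?thesis using that[of "enn2real q"] by (cases q) (auto simp: less_top[symmetric])
  qed
  obtain G where G: "open G" "K \<subseteq> G" "emeasure lborel (G - K) < ennreal e"
    using outer_regular_lborel[OF Kb e(1)] by blast
  have [measurable]: "G \<in> sets borel" using G(1) by simp
  obtain \<epsilon> where eps: "0 < \<epsilon>" "(\<Union>x\<in>K. ball x \<epsilon>) \<subseteq> G"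
    using compact_subset_open_imp_ball_epsilon_subset[OF K(1) G(1,2)] by metis
  have finK: "emeasure lborel K \<noteq> \<infinity>" using emeasure_compact_finite[OF K(1)] by simp
  have "\<exists>v\<in>V. v + x \<in> Z" if x: "x \<in> ball x0 \<epsilon>" for x
  proof (rule ccontr)
    assume no: "\<not> (\<exists>v\<in>V. v + x \<in> Z)"
    define S where "S = {y. y - x0 \<in> K}"
    define S' where "S' = {y. y - x \<in> K}"
    have [measurable]: "S \<in> sets borel" "S' \<in> sets borel" unfolding S_def S'_def by measurable
    have mS: "emeasure lborel S = emeasure lborel K" "emeasure lborel S' = emeasure lborel K"
      unfolding S_def S'_def by (rule emeasure_lborel_translate[OF Kb])+
    have "y \<notin> Z" if "y \<in> S'" for y
      using no that K(2) unfolding S'_def by force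
    then have sub: "Z \<inter> S \<subseteq> S - S'" by auto
    have "emeasure lborel (S' - S) \<le> emeasure lborel {y. y - x0 \<in> G - K}"
    proof (rule emeasure_mono)
      show "S' - S \<subseteq> {y. y - x0 \<in> G - K}"
      proof
        fix y assume y: "y \<in> S' - S"
        have "dist (y - x) (y - x0) < \<epsilon>" using x by (simp add: dist_norm norm_minus_commute)
        then have "y - x0 \<in> (\<Union>x\<in>K. ball x \<epsilon>)"
          using y unfolding S'_def by (intro UN_I[of "y - x"]) auto
        then have "y - x0 \<in> G" using eps(2) by blast
        then show "y \<in> {y. y - x0 \<in> G - K}" using y unfolding S_def by simp
      qed
    qed measurable
    also have "\<dots> = emeasure lborel (G - K)" by (rule emeasure_lborel_translate) measurable
    finally have 1: "emeasure lborel (S' - S) < ennreal e" using G(3) by simp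
    \<comment> \<open>The open set \<open>G\<close> controls only \<open>S' - S\<close>; since both
      translates have the same finite measure, \<open>S - S'\<close> is equally small.\<close>
    have eq: "emeasure lborel (S - S') = emeasure lborel (S' - S)"
    proof -
      have fin: "emeasure lborel (S \<inter> S') \<noteq> \<infinity>"
        using emeasure_mono[of "S \<inter> S'" S lborel] finK mS by (auto simp: top_unique)
      have "emeasure lborel (S - S') = emeasure lborel S - emeasure lborel (S \<inter> S')"
        using emeasure_Diff[OF fin, of S] by (simp add: Diff_Int)
      moreover have "emeasure lborel (S' - S) = emeasure lborel S' - emeasure lborel (S \<inter> S')"
        using emeasure_Diff[OF fin, of S'] by (simp add: Diff_Int)
      ultimately show ?thesis using mS by simp
    qed
    have "emeasure lborel (Z \<inter> S) \<le> emeasure lborel (S - S')" using sub by (rule emeasure_mono) measurable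
    then show False using 1 e(2) unfolding eq S_def[symmetric] by simp
  qed
  then show ?thesis using that eps(1) by blast
qed

subsection \<open>Diagonal images of lattices\<close>

definition diag_map :: "('d \<Rightarrow> real) \<Rightarrow> real ^ 'd::finite \<Rightarrow> real ^ 'd" where
  "diag_map e x = (\<chi> k. e k * x $ k)"

lemma diag_map_image_Int_sbox:
  assumes "\<And>k. 0 < e k"
  shows "diag_map e ` L \<inter> sbox s = diag_map e ` (L \<inter> sbox (\<lambda>k. s k / e k))"
proof -
  have "diag_map e x \<in> sbox s \<longleftrightarrow> x \<in> sbox (\<lambda>k. s k / e k)" for x
    using assms by (simp add: sbox_iff diag_map_def abs_mult abs_of_pos pos_le_divide_eq mult.commute)
  then show ?thesis by auto
qed

lemma inj_diag_map: "(\<And>k. 0 < e k) \<Longrightarrow> inj (diag_map e)"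
  by (auto simp: inj_def diag_map_def vec_eq_iff) (metis less_irrefl)

lemma linear_diag_map: "linear (diag_map e)"
  by (intro linearI) (auto simp: diag_map_def vec_eq_iff algebra_simps)

lemma full_lattice_diag_map:
  assumes "full_lattice L" and e: "\<And>k. 0 < e k"
  shows "full_lattice (diag_map e ` L)"
proof -
  interpret full_lattice L by fact
  show ?thesis
  proof
    have "diag_map e 0 = 0" by (simp add: diag_map_def vec_eq_iff)
    then show "0 \<in> diag_map e ` L" using zero by (metis imageI)
    fix x y assume "x \<in> diag_map e ` L" "y \<in> diag_map e ` L"
    then show "x - y \<in> diag_map e ` L"
      using diff by (auto simp: linear_diff[OF linear_diag_map, symmetric])
  next
    fix s show "finite (diag_map e ` L \<inter> sbox s)"
      unfolding diag_map_image_Int_sbox[OF e] by (intro finite_imageI fin)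
  next
    have "surj (diag_map e)"
      using linear_injective_imp_surjective[OF linear_diag_map inj_diag_map[OF e]] by simp
    then show "span (diag_map e ` L) = UNIV"
      using span_linear_image[OF linear_diag_map, of e L] full by simp
  qed
qed

lemma full_lattice_Lambda: "full_lattice (Lambda A)"
  using discrete_subgroup_Lambda[of A] span_Lambda[of A] by (simp add: full_lattice_def full_lattice_axioms_def)

lemma a_mat_mult:
  "a_mat t *v x = diag_map (\<lambda>k. case k of Inl _ \<Rightarrow> exp (t / real CARD('m)) | Inr _ \<Rightarrow> exp (- t / real CARD('n))) x"
  for x :: "real ^ ('m::finite + 'n::finite)"
  by (simp add: vec_eq_iff matrix_vector_mult_def a_mat_def diag_map_def if_distrib[of "\<lambda>y. y * _"] cong: if_cong)

text \<open>The parameters solve \<open>R = exp (t / m) * r = exp (- t / n) * T\<close>, with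
  \<open>r = \<psi> (2 ^ k)\<close> and \<open>T = 2 ^ k\<close>. Eliminating \<open>t\<close> gives
  \<open>R ^ d = r ^ m * T ^ n\<close>, the numerator of \<open>M_ratio\<close>, so that the bounds
  for the cube apply with \<open>N_count\<close> as the number of points.\<close>

lemma minima_product_bounds_M_ratio:
  fixes A :: "real ^ 'n::finite ^ 'm::finite"
  assumes \<psi>: "0 < \<psi> (2 ^ k)"
  defines "d \<equiv> CARD('m) + CARD('n)"
  shows "minima_product A \<psi> k \<le> real (8 * d ^ 2) ^ (d * d) * M_ratio A (\<psi> (2 ^ k)) (2 ^ k)"
    and "M_ratio A (\<psi> (2 ^ k)) (2 ^ k) \<le> real d ^ d * minima_product A \<psi> k"
proof -
  define m where "m = real CARD('m)"
  define n where "n = real CARD('n)"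
  have mn: "0 < m" "0 < n" unfolding m_def n_def by simp_all
  define r where "r = \<psi> (2 ^ k)"
  define T where "T = (2 ^ k :: real)"
  have rT: "0 < r" "0 < T" unfolding r_def T_def using \<psi> by auto
  define R where "R = R_param CARD('m) CARD('n) \<psi> k"
  define t where "t = t_param CARD('m) CARD('n) \<psi> k"
  define N where "N = box_count A r T"
  have d: "real d = m + n" unfolding d_def m_def n_def by simp
  have base: "2 ^ (k * CARD('n)) * \<psi> (2 ^ k) ^ CARD('m) = r ^ CARD('m) * T ^ CARD('n)"
    by (simp add: r_def T_def power_mult mult.commute)
  have pos: "0 < r ^ CARD('m) * T ^ CARD('n)" using rT by simp
  have R: "R = exp ((m * ln r + n * ln T) / (m + n))"
  proof -
    have "R = (r ^ CARD('m) * T ^ CARD('n)) powr (1 / (m + n))"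
      unfolding R_def R_param_def base by (simp add: m_def n_def)
    also have "\<dots> = exp (1 / (m + n) * ln (r ^ CARD('m) * T ^ CARD('n)))"
      using rT by (simp add: powr_def)
    also have "ln (r ^ CARD('m) * T ^ CARD('n)) = m * ln r + n * ln T"
      using rT by (simp add: ln_mult ln_realpow m_def n_def)
    finally show ?thesis by simp
  qed
  have R0: "0 < R" unfolding R by simp
  have Rd: "R ^ d = r ^ CARD('m) * T ^ CARD('n)"
  proof -
    have "R ^ d = exp (real d * ((m * ln r + n * ln T) / (m + n)))" unfolding R by (rule exp_of_nat_mult[symmetric])
    also have "\<dots> = exp (m * ln r + n * ln T)" using mn unfolding d by simp
    also have "\<dots> = r ^ CARD('m) * T ^ CARD('n)"
      using rT by (simp add: exp_add exp_of_nat_mult m_def n_def)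
    finally show ?thesis .
  qed
  have t: "t = m * n / (m + n) * (ln T - ln r)"
    using rT unfolding t_def t_param_def by (simp add: m_def n_def r_def T_def ln_div)
  define e :: "'m + 'n \<Rightarrow> real" where "e k = (case k of Inl _ \<Rightarrow> exp (t / m) | Inr _ \<Rightarrow> exp (- t / n))" for k
  have e0: "0 < e k" for k unfolding e_def by (cases k) auto
  have er: "R / exp (t / m) = r"
  proof -
    have "t / m = n * (ln T - ln r) / (m + n)" using mn unfolding t by simp
    then have "(m * ln r + n * ln T) / (m + n) - t / m = (m + n) * ln r / (m + n)"
      by (simp only: diff_divide_distrib[symmetric]) (simp add: algebra_simps)
    then have "(m * ln r + n * ln T) / (m + n) - t / m = ln r" using mn by simp
    then have "R / exp (t / m) = exp (ln r)" unfolding R exp_diff[symmetric] by simp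
    then show ?thesis using rT by simp
  qed
  have eT: "R / exp (- t / n) = T"
  proof -
    have "- t / n = - (m * (ln T - ln r)) / (m + n)" using mn unfolding t by simp
    then have "(m * ln r + n * ln T) / (m + n) - (- t / n) = (m + n) * ln T / (m + n)"
      by (simp only: diff_divide_distrib[symmetric]) (simp add: algebra_simps)
    then have "(m * ln r + n * ln T) / (m + n) - (- t / n) = ln T" using mn by simp
    then have "R / exp (- t / n) = exp (ln T)" unfolding R exp_diff[symmetric] by simp
    then show ?thesis using rT by simp
  qed
  have eR: "(\<lambda>k. R / e k) = sides r T"
  proof
    fix k show "R / e k = sides r T k"
    proof (cases k)
      case (Inl i)
      show ?thesis unfolding Inl e_def sum.case sides_simps by (rule er)
    next
      case (Inr j)
      show ?thesis unfolding Inr e_def sum.case sides_simps by (rule eT)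
    qed
  qed
  define L where "L = (\<lambda>x. a_mat t *v x) ` Lambda A"
  have L: "L = diag_map e ` Lambda A"
    unfolding L_def a_mat_mult e_def m_def n_def by (rule refl)
  interpret full_lattice L unfolding L by (rule full_lattice_diag_map[OF full_lattice_Lambda e0])
  have N: "count (\<lambda>_. R) = N"
    unfolding count_def N_def box_count_def eR[symmetric]
    unfolding L diag_map_image_Int_sbox[OF e0]
    by (rule card_image[OF inj_on_subset[OF inj_diag_map[OF e0]]]) simp
  have P: "minima_product A \<psi> k = (\<Prod>i=1..CARD('m + 'n). min R (successive_min i L))"
    unfolding minima_product_def R_def t_def L_def by simp
  have card: "CARD('m + 'n) = d" unfolding d_def by simp
  have N1: "1 \<le> real N" unfolding N_def using box_count_pos[of r T A] rT by simp
  have Mr: "M_ratio A (\<psi> (2 ^ k)) (2 ^ k) = R ^ d / real N"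
    unfolding M_ratio_def N_count_eq_box_count Rd N_def r_def T_def by simp
  have "minima_product A \<psi> k * real N \<le> real (8 * d ^ 2) ^ (d * d) * R ^ d"
    using minima_product_bounds(1)[OF R0] unfolding N P[symmetric] unfolding card by simp
  then show "minima_product A \<psi> k \<le> real (8 * d ^ 2) ^ (d * d) * M_ratio A (\<psi> (2 ^ k)) (2 ^ k)"
    unfolding Mr using N1 by (simp add: pos_le_divide_eq)
  have "R ^ d \<le> real d ^ d * (minima_product A \<psi> k * real N)"
    using minima_product_bounds(2)[OF R0] unfolding N P[symmetric] unfolding card by simp
  then show "M_ratio A (\<psi> (2 ^ k)) (2 ^ k) \<le> real d ^ d * minima_product A \<psi> k"
    unfolding Mr using N1 by (simp add: pos_divide_le_eq mult.assoc)
qed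

subsection \<open>The set of well approximable points\<close>

lemma dist_int_vecs_less_iff: "dist_int_vecs x < c \<longleftrightarrow> (\<exists>p\<in>int_vecs. infnorm (x - p) < c)"
proof -
  have "bdd_below ((\<lambda>p. infnorm (x - p)) ` int_vecs)" by (intro bdd_belowI[of _ 0]) (auto simp: infnorm_pos_le)
  then show ?thesis unfolding dist_int_vecs_def using int_vecs_0 by (subst cINF_less_iff) auto
qed

text \<open>By \<open>vimage_W_set\<close> this is the full preimage of \<open>W_set\<close>, so
  measurability and measure can be studied in the covering space.\<close>

definition W_lift :: "real ^ 'n ^ 'm \<Rightarrow> (real \<Rightarrow> real) \<Rightarrow> (real ^ 'm::finite) set" where
  "W_lift A \<psi> = {b. infinite {q \<in> int_vecs. q \<noteq> 0 \<and> dist_int_vecs (A *v q - b) < \<psi> (infnorm q)}}"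

lemma dist_int_vecs_add:
  assumes "p \<in> int_vecs"
  shows "dist_int_vecs (x + p) = dist_int_vecs x"
proof -
  have "(\<lambda>p'. infnorm (x + p - p')) ` int_vecs = (\<lambda>p'. infnorm (x - p')) ` int_vecs"
  proof (intro equalityI subsetI; elim imageE)
    fix y p' assume "y = infnorm (x + p - p')" "p' \<in> int_vecs"
    then show "y \<in> (\<lambda>p'. infnorm (x - p')) ` int_vecs"
      using assms int_vecs_diff by (intro image_eqI[of _ _ "p' - p"]) (auto simp: algebra_simps)
  next
    fix y p' assume "y = infnorm (x - p')" "p' \<in> int_vecs"
    then show "y \<in> (\<lambda>p'. infnorm (x + p - p')) ` int_vecs"
      using assms int_vecs_add by (intro image_eqI[of _ _ "p' + p"]) (auto simp: algebra_simps)
  qed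
  then show ?thesis unfolding dist_int_vecs_def by simp
qed

lemma W_lift_periodic:
  assumes "b - b' \<in> int_vecs"
  shows "b \<in> W_lift A \<psi> \<longleftrightarrow> b' \<in> W_lift A \<psi>"
proof -
  have "dist_int_vecs (A *v q - b') = dist_int_vecs (A *v q - b)" for q
    using dist_int_vecs_add[OF assms, of "A *v q - b"] by simp
  then show ?thesis unfolding W_lift_def by simp
qed

lemma vimage_W_set: "to_torus -` W_set A \<psi> = W_lift A \<psi>"
proof -
  have W: "W_set A \<psi> = to_torus ` W_lift A \<psi>" unfolding W_set_def W_lift_def ..
  show ?thesis
  proof (intro equalityI subsetI)
    fix b assume "b \<in> to_torus -` W_set A \<psi>"
    then obtain b' where "b' \<in> W_lift A \<psi>" "to_torus b = to_torus b'" unfolding W by auto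
    then show "b \<in> W_lift A \<psi>" using W_lift_periodic[of b b' A \<psi>] by (simp add: torus.abs_eq_iff)
  qed (auto simp: W)
qed

text \<open>A box contains only finitely many integer vectors, so an infinite set is an unbounded
  one. The condition runs over countably many \<open>c\<close>, which shows below that
  \<open>W_lift\<close> is a countable intersection of open sets.\<close>

lemma infinite_int_vecs_iff:
  fixes X :: "(real ^ 'n::finite) set"
  assumes "X \<subseteq> int_vecs"
  shows "infinite X \<longleftrightarrow> (\<forall>c::nat. \<exists>q\<in>X. real c < infnorm q)"
proof
  assume inf: "infinite X"
  show "\<forall>c::nat. \<exists>q\<in>X. real c < infnorm q"
  proof (rule ccontr)
    assume "\<not> ?thesis"
    then obtain c :: nat where "\<And>q. q \<in> X \<Longrightarrow> infnorm q \<le> real c" by (auto simp: not_less)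
    then have "X \<subseteq> int_vecs \<inter> sbox (\<lambda>_. real c)" using assms by (auto simp: sbox_iff infnorm_le_iff_cart)
    then show False using inf finite_int_vecs_sbox finite_subset by blast
  qed
next
  assume *: "\<forall>c::nat. \<exists>q\<in>X. real c < infnorm q"
  show "infinite X"
  proof
    assume fin: "finite X"
    obtain c :: nat where c: "(\<Sum>q\<in>X. infnorm q) \<le> real c" using real_arch_simple by blast
    obtain q where q: "q \<in> X" "real c < infnorm q" using * by blast
    have "infnorm q \<le> (\<Sum>q\<in>X. infnorm q)" using fin q(1) by (intro member_le_sum infnorm_pos_le) auto
    then show False using c q(2) by simp
  qed
qed

lemma borel_W_lift [measurable]: "W_lift A \<psi> \<in> sets borel"
proof -
  define O' where "O' q = {b. q \<noteq> 0 \<and> dist_int_vecs (A *v q - b) < \<psi> (infnorm q)}" for q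
  have O': "open (O' q)" for q
  proof (cases "q = 0")
    case False
    then have "O' q = (\<Union>p\<in>int_vecs. {b. infnorm (A *v q - b - p) < \<psi> (infnorm q)})"
      unfolding O'_def dist_int_vecs_less_iff by auto
    also have "open \<dots>" by (intro open_UN ballI open_Collect_less continuous_intros)
    finally show ?thesis .
  qed (simp add: O'_def)
  have "W_lift A \<psi> = (\<Inter>c::nat. \<Union>q\<in>{q\<in>int_vecs. real c < infnorm q}. O' q)"
  proof (rule set_eqI)
    fix b
    have "b \<in> W_lift A \<psi> \<longleftrightarrow> (\<forall>c::nat. \<exists>q\<in>{q \<in> int_vecs. b \<in> O' q}. real c < infnorm q)"
      unfolding W_lift_def O'_def mem_Collect_eq by (rule infinite_int_vecs_iff) auto
    also have "\<dots> \<longleftrightarrow> b \<in> (\<Inter>c::nat. \<Union>q\<in>{q\<in>int_vecs. real c < infnorm q}. O' q)" by auto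
    finally show "b \<in> W_lift A \<psi> \<longleftrightarrow> b \<in> (\<Inter>c::nat. \<Union>q\<in>{q\<in>int_vecs. real c < infnorm q}. O' q)" .
  qed
  also have "\<dots> \<in> sets borel" using O' by (intro sets.countable_INT'' borel_open open_UN ballI) auto
  finally show ?thesis .
qed

lemma W_set_measurable: "W_set A \<psi> \<in> sets torus_measure"
  unfolding torus_measure_def sets_distr
  by (rule sets_measure_of_conv[THEN equalityD2, THEN subsetD, OF _ ])
     (auto simp: vimage_W_set)

lemma emeasure_W_set:
  fixes A :: "real ^ 'n::finite ^ 'm::finite"
  shows "emeasure torus_measure (W_set A \<psi>) = ennreal (unit_measure (W_lift A \<psi>))"
proof -
  have m: "to_torus \<in> measurable (lebesgue_on (cbox 0 1)) (sigma UNIV {B :: 'm torus set. to_torus -` B \<in> sets lebesgue})"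
    by (rule measurable_to_torus)
  have sub: "unit_cube \<subseteq> cbox 0 (1 :: real ^ 'm)"
    unfolding unit_cube_def subset_iff mem_box_cart mem_Collect_eq by (simp add: less_imp_le)
  have null: "cbox 0 (1 :: real ^ 'm) - unit_cube \<in> null_sets lborel"
  proof -
    have "emeasure lborel (cbox 0 (1 :: real ^ 'm)) = 1"
      by (subst emeasure_lborel_cbox) (auto simp: Basis_vec_def inner_axis intro!: prod.neutral)
    then have "emeasure lborel (cbox 0 (1 :: real ^ 'm) - unit_cube) = 1 - 1"
      using emeasure_Diff[of lborel unit_cube "cbox 0 (1 :: real ^ 'm)"] sub emeasure_unit_cube[where 'm = 'm] by simp
    then show ?thesis by (intro null_setsI) auto
  qed
  have "emeasure torus_measure (W_set A \<psi>)
      = emeasure (lebesgue_on (cbox 0 1)) (W_lift A \<psi> \<inter> cbox 0 1)"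
    unfolding torus_measure_def
    by (subst emeasure_distr[OF m]) (use W_set_measurable[of A \<psi>] in \<open>auto simp: torus_measure_def vimage_W_set\<close>)
  also have "\<dots> = emeasure lebesgue (W_lift A \<psi> \<inter> cbox 0 1)"
    by (rule emeasure_restrict_space) auto
  also have "\<dots> = emeasure lborel (W_lift A \<psi> \<inter> cbox 0 1)" by simp
  also have "W_lift A \<psi> \<inter> cbox 0 1 = (unit_cube \<inter> W_lift A \<psi>) \<union> (W_lift A \<psi> \<inter> (cbox 0 1 - unit_cube))"
    using sub by auto
  also have "emeasure lborel \<dots> = emeasure lborel (unit_cube \<inter> W_lift A \<psi>)"
    by (rule emeasure_Un_null_set) (auto intro!: null_set_Int1[OF null])
  also have "\<dots> = ennreal (unit_measure (W_lift A \<psi>))" by (rule emeasure_unit_eq) measurable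
  finally show ?thesis .
qed

section \<open>Dyadic decomposition, and the convergence and divergence cases\<close>

lemma ex_dyadic:
  fixes x :: real
  assumes "1 \<le> x"
  obtains k :: nat where "2 ^ k \<le> x" "x < 2 ^ (k + 1)"
proof -
  define k where "k = (LEAST k. x < 2 ^ Suc k)"
  obtain n where "x < 2 ^ n" using real_arch_pow[of 2 x] by auto
  then have "x < 2 ^ Suc n" by (rule less_le_trans) simp
  then have 1: "x < 2 ^ Suc k" unfolding k_def by (rule LeastI)
  have "2 ^ k \<le> x"
  proof (cases k)
    case (Suc j)
    then have "\<not> x < 2 ^ Suc j" using not_less_Least[of j "\<lambda>k. x < 2 ^ Suc k"] unfolding k_def[symmetric] by simp
    then show ?thesis using Suc by simp
  qed (use assms in simp)
  then show ?thesis using that[of k] 1 by simp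
qed

text \<open>For \<open>q\<close> of norm in \<open>[2 ^ k, 2 ^ (k + 1))\<close> monotonicity bounds
  \<psi> by its value at the left end, while the height is bounded by the right end; hence the two
  sides belong to different dyadic levels.\<close>

lemma W_lift_subset_limsup:
  fixes A :: "real ^ 'n::finite ^ 'm::finite"
  assumes \<psi>: "antimono_on {0<..} \<psi>"
  shows "W_lift A \<psi> \<subseteq> (\<Inter>n. \<Union>k\<in>{n..}. approx_set A (\<psi> (2 ^ k)) (2 ^ (k + 1)))"
proof
  fix b assume b: "b \<in> W_lift A \<psi>"
  show "b \<in> (\<Inter>n. \<Union>k\<in>{n..}. approx_set A (\<psi> (2 ^ k)) (2 ^ (k + 1)))"
  proof
    fix n :: nat
    have "\<forall>c::nat. \<exists>q\<in>{q \<in> int_vecs. q \<noteq> 0 \<and> dist_int_vecs (A *v q - b) < \<psi> (infnorm q)}. real c < infnorm q"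
      using b unfolding W_lift_def mem_Collect_eq by (subst (asm) infinite_int_vecs_iff) auto
    then obtain q where q: "q \<in> int_vecs" "dist_int_vecs (A *v q - b) < \<psi> (infnorm q)" "real (2 ^ n) < infnorm q"
      by blast
    have "(1 :: real) \<le> 2 ^ n" by simp
    moreover have q3: "2 ^ n < infnorm q" using q(3) by simp
    ultimately have "1 \<le> infnorm q" by linarith
    then obtain k where k: "2 ^ k \<le> infnorm q" "infnorm q < 2 ^ (k + 1)" using ex_dyadic by metis
    have "(2 :: real) ^ n < 2 ^ (k + 1)" using q3 k(2) by (rule less_trans)
    then have nk: "n \<le> k" by (simp del: power_Suc)
    have "\<psi> (infnorm q) \<le> \<psi> (2 ^ k)"
      using monotone_onD[OF \<psi>, of "2 ^ k" "infnorm q"] k(1) \<open>1 \<le> infnorm q\<close> by simp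
    then have "dist_int_vecs (A *v q - b) < \<psi> (2 ^ k)" using q(2) by simp
    then obtain p where p: "p \<in> int_vecs" "infnorm (A *v q - b - p) < \<psi> (2 ^ k)"
      unfolding dist_int_vecs_less_iff by blast
    have "lat_pt A (- p) q - emb b \<in> sbox (sides (\<psi> (2 ^ k)) (2 ^ (k + 1)))"
      unfolding diff_emb_sbox_iff cube_iff
    proof (intro conjI allI)
      fix i
      have "\<bar>(A *v q - b - p) $ i\<bar> \<le> \<psi> (2 ^ k)" using component_le_infnorm_cart[of "A *v q - b - p" i] p(2) by linarith
      then show "\<bar>fst_part (lat_pt A (- p) q) $ i - b $ i\<bar> \<le> \<psi> (2 ^ k)" by (simp add: algebra_simps)
    next
      fix j show "\<bar>lat_pt A (- p) q $ Inr j\<bar> \<le> 2 ^ (k + 1)"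
        using component_le_infnorm_cart[of q j] k(2) by simp
    qed
    then have "b \<in> approx_set A (\<psi> (2 ^ k)) (2 ^ (k + 1))"
      unfolding approx_set_def using lat_pt_in_Lambda[OF int_vecs_minus[OF p(1)] q(1)] by blast
    then show "b \<in> (\<Union>k\<in>{n..}. approx_set A (\<psi> (2 ^ k)) (2 ^ (k + 1)))" using nk by blast
  qed
qed

lemma M_ratio_eq: "M_ratio A r T = r ^ CARD('m) * T ^ CARD('n) / real (box_count A r T)"
  for A :: "real ^ 'n::finite ^ 'm::finite"
  by (simp add: M_ratio_def N_count_eq_box_count)

lemma unit_measure_W_lift_convergent:
  fixes A :: "real ^ 'n::finite ^ 'm::finite"
  assumes pos: "\<And>x. 0 < x \<Longrightarrow> 0 < \<psi> x" and \<psi>: "antimono_on {0<..} \<psi>"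
    and sum: "summable (\<lambda>k. M_ratio A (\<psi> (2 ^ k)) (2 ^ k))"
  shows "unit_measure (W_lift A \<psi>) = 0"
proof -
  define E where "E k = approx_set A (\<psi> (2 ^ k)) (2 ^ (k + 1))" for k
  define C :: real where "C = 6 ^ CARD('n) * 4 ^ CARD('m) * 2 ^ CARD('n)"
  have [measurable]: "E k \<in> sets borel" for k unfolding E_def by measurable
  have le: "unit_measure (E k) \<le> C * M_ratio A (\<psi> (2 ^ k)) (2 ^ k)" for k
  proof -
    let ?r = "\<psi> (2 ^ k)"
    have r: "0 < ?r" by (rule pos) simp
    have N: "0 < real (box_count A ?r (2 ^ k))" using box_count_pos[of ?r "2 ^ k" A] r by simp
    \<comment> \<open>The height \<open>2 ^ (k + 1)\<close> of \<open>E k\<close> costs only the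
      factor \<open>2 ^ CARD('n)\<close> in \<open>C\<close>, because the count stands in the
      denominator and grows with the height.\<close>
    have "real (box_count A ?r (2 ^ k)) \<le> real (box_count A ?r (2 ^ (k + 1)))"
      by (intro of_nat_mono box_count_mono) auto
    then have "unit_measure (E k) * real (box_count A ?r (2 ^ k)) \<le> unit_measure (E k) * real (box_count A ?r (2 ^ (k + 1)))"
      by (intro mult_left_mono unit_measure_nonneg)
    also have "\<dots> \<le> 6 ^ CARD('n) * 4 ^ CARD('m) * (?r ^ CARD('m) * (2 ^ (k + 1)) ^ CARD('n))"
    proof -
      have "1 / 2 \<le> (2 :: real) ^ (k + 1)" using one_le_power[of "2 :: real" "k + 1"] by linarith
      then show ?thesis using unit_measure_approx_set_le[of ?r "2 ^ (k + 1)" A] r unfolding E_def by (simp add: mult.commute)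
    qed
    also have "\<dots> = C * (?r ^ CARD('m) * (2 ^ k) ^ CARD('n))" unfolding C_def by (simp add: power_mult_distrib)
    finally have "unit_measure (E k) \<le> C * (?r ^ CARD('m) * (2 ^ k) ^ CARD('n)) / real (box_count A ?r (2 ^ k))"
      using N by (rule mult_inverse_bound)
    then show ?thesis unfolding M_ratio_eq by simp
  qed
  have "summable (\<lambda>k. unit_measure (E k))"
    using summable_mult[OF sum, of C]
    by (rule summable_comparison_test'[where N = 0]) (simp add: le unit_measure_nonneg)
  then have "limsup (\<lambda>k. unit_cube \<inter> E k) \<in> null_sets lborel"
    by (intro borel_cantelli_limsup1) (auto simp: emeasure_unit_eq unit_measure_def)
  moreover have "unit_cube \<inter> W_lift A \<psi> \<subseteq> limsup (\<lambda>k. unit_cube \<inter> E k)"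
    using W_lift_subset_limsup[OF \<psi>, of A] unfolding E_def limsup_INF_SUP by fastforce
  ultimately have "emeasure lborel (unit_cube \<inter> W_lift A \<psi>) = 0"
    by (metis emeasure_mono le_zero_eq null_setsD1 null_setsD2)
  then show ?thesis unfolding unit_measure_def measure_def by simp
qed

text \<open>The limsup set \<open>V0\<close> has positive measure, and outside a null set its points
  stay in \<open>W_lift\<close> when translated by any \<open>A *v q0 + p0\<close>. If
  \<open>W_lift\<close> lacked full measure, \<open>steinhaus_two_sets\<close> and the density of
  these translations would carry such a point into its complement.\<close>

lemma unit_measure_W_lift_divergent:
  fixes A :: "real ^ 'n::finite ^ 'm::finite"
  assumes pos: "\<And>x. 0 < x \<Longrightarrow> 0 < \<psi> x" and \<psi>: "antimono_on {0<..} \<psi>" and reg: "dyadically_regular \<psi>"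
    and div: "\<not> summable (\<lambda>k. M_ratio A (\<psi> (2 ^ k)) (2 ^ k))"
  shows "unit_measure (W_lift A \<psi>) = 1"
proof -
  obtain \<rho> k0 where \<rho>: "0 < \<rho>" "\<rho> < 1" "\<And>k::nat. k0 \<le> k \<Longrightarrow> \<psi> (2 ^ (k + 1)) \<le> \<rho> * \<psi> (2 ^ k)"
    using reg unfolding dyadically_regular_def by blast
  \<comment> \<open>The 1/2 belongs to the doubling of \<open>T\<close>, the \<rho> to the decay of
    \<psi>; the shift by \<open>k0\<close> below skips the indices before regularity sets
    in.\<close>
  define \<delta> where "\<delta> = max (1/2) \<rho>"
  \<comment> \<open>Halving \<open>r\<close> turns a closed inequality into the strict one with
    \<psi>; halving \<open>T\<close> leaves room for adding \<open>q0\<close>.\<close>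
  define r where "r k = \<psi> (2 ^ (k + k0)) / 2" for k
  define T :: "nat \<Rightarrow> real" where "T k = 2 ^ (k + k0) / 2" for k
  interpret S: approx_scales A r T \<delta>
  proof
    fix k
    show "0 < r k" unfolding r_def using pos by simp
    show "1/2 \<le> T k" unfolding T_def by simp
    have "\<psi> (2 ^ (Suc k + k0)) \<le> \<rho> * \<psi> (2 ^ (k + k0))" using \<rho>(3)[of "k + k0"] by simp
    also have "\<dots> \<le> \<delta> * \<psi> (2 ^ (k + k0))"
      unfolding \<delta>_def using pos[of "2 ^ (k + k0)"] by (intro mult_right_mono) auto
    finally show "r (Suc k) \<le> \<delta> * r k" unfolding r_def by simp
    have "1/2 * T (Suc k) \<le> \<delta> * T (Suc k)" unfolding \<delta>_def T_def by (intro mult_right_mono) auto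
    then show "T k \<le> \<delta> * T (Suc k)" unfolding T_def by simp
  qed (use \<rho> in \<open>auto simp: \<delta>_def\<close>)
  have divS: "\<not> summable S.M"
  proof
    assume "summable S.M"
    then have "summable (\<lambda>k. 2 ^ (CARD('m) + CARD('n)) * S.M k)" by (rule summable_mult)
    then have "summable (\<lambda>k. M_ratio A (\<psi> (2 ^ (k + k0))) (2 ^ (k + k0)))"
    proof (rule summable_comparison_test'[where N = 0])
      fix k
      let ?r = "\<psi> (2 ^ (k + k0))" and ?T = "2 ^ (k + k0) :: real"
      have r0: "0 < ?r" by (rule pos) simp
      have "real (box_count A (r k) (T k)) \<le> real (box_count A ?r ?T)"
        unfolding r_def T_def using r0 by (intro of_nat_mono box_count_mono) auto
      then have "?r ^ CARD('m) * ?T ^ CARD('n) / real (box_count A ?r ?T)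
         \<le> ?r ^ CARD('m) * ?T ^ CARD('n) / real (box_count A (r k) (T k))"
        using r0 S.box_pos[of k k] by (intro divide_left_mono) (auto intro!: mult_pos_pos less_le_trans)
      also have "\<dots> = 2 ^ (CARD('m) + CARD('n)) * S.M k"
        unfolding S.M_def by (simp add: r_def T_def power_divide power_add)
      finally show "norm (M_ratio A ?r ?T) \<le> 2 ^ (CARD('m) + CARD('n)) * S.M k"
        using r0 unfolding M_ratio_eq by simp
    qed
    then have "summable (\<lambda>k. M_ratio A (\<psi> (2 ^ k)) (2 ^ k))"
      using summable_iff_shift[of "\<lambda>k. M_ratio A (\<psi> (2 ^ k)) (2 ^ k)" k0] by simp
    then show False using div by simp
  qed
  define V0 where "V0 = (\<Inter>n. \<Union>k\<in>{n..}. S.U k)"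
  have [measurable]: "V0 \<in> sets borel" unfolding V0_def by measurable
  \<comment> \<open>If \<open>v\<close> has the form \<open>A *v q + p\<close>, a single lattice
    point may serve infinitely many \<open>k\<close>. Off this countable set, infinitely many
    \<open>k\<close> yield infinitely many lattice points.\<close>
  define Gs where "Gs = (\<lambda>(p, q). A *v q + p) ` (int_vecs \<times> int_vecs)"
  have Gs: "Gs \<in> null_sets lborel"
    unfolding Gs_def
    by (intro countable_imp_null_set_lborel countable_image countable_SIGMA countable_int_vecs)
  have lim: "(\<lambda>k. \<delta> ^ k * r 0) \<longlonglongrightarrow> 0"
    using tendsto_mult_right[OF LIMSEQ_power_zero[of \<delta>], of "r 0"] S.\<delta> by simp
  have shift: "v + (A *v q0 + p0) \<in> W_lift A \<psi>"
    if v: "v \<in> V0" "v \<notin> Gs" and pq: "p0 \<in> int_vecs" "q0 \<in> int_vecs" for v p0 q0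
  proof -
    define b where "b = v + (A *v q0 + p0)"
    obtain k1 where k1: "infnorm q0 \<le> T k1" using S.T_unbounded by blast
    define X where "X = {w \<in> Lambda A. \<exists>k\<ge>k1. w - emb b \<in> sbox (sides (r k) (2 * T k))}"
    have bG: "fst_part w \<noteq> b" if wL: "w \<in> Lambda A" for w
    proof
      assume eq: "fst_part w = b"
      obtain p q where w: "p \<in> int_vecs" "q \<in> int_vecs" "w = lat_pt A p q" using wL unfolding Lambda_eq by auto
      have "fst_part w = A *v q + p" unfolding w by (simp add: vec_eq_iff)
      then have "v = A *v (q - q0) + (p - p0)"
        using eq unfolding b_def by (simp add: matrix_vector_mult_diff_distrib algebra_simps)
      then have "v \<in> Gs" unfolding Gs_def using int_vecs_diff[OF w(1) pq(1)] int_vecs_diff[OF w(2) pq(2)]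
        by (intro image_eqI[of _ _ "(p - p0, q - q0)"]) auto
      then show False using v by simp
    qed
    have infX: "infinite X"
    proof
      assume fin: "finite X"
      \<comment> \<open>All members of a finite \<open>X\<close> keep distance at least
        \<open>e\<close> from \<open>b\<close>, while an index with \<open>r k < e\<close> produces
        a member that is closer. The entry 1 covers the case of empty \<open>X\<close>.\<close>
      define e where "e = Min (insert 1 ((\<lambda>w. infnorm (fst_part w - b)) ` X))"
      have "0 < infnorm (fst_part w - b)" if "w \<in> X" for w
        using that bG[of w] unfolding X_def by (simp add: infnorm_pos_lt)
      then have e0: "0 < e" unfolding e_def using fin by (subst Min_gr_iff) auto
      have "\<forall>\<^sub>F k in sequentially. \<delta> ^ k * r 0 < e" using lim e0 by (rule order_tendstoD(2))
      then obtain k2 where k2: "\<And>k. k2 \<le> k \<Longrightarrow> \<delta> ^ k * r 0 < e" unfolding eventually_sequentially by blast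
      have "v \<in> (\<Union>k\<in>{max k1 k2..}. S.U k)" using v(1) unfolding V0_def by blast
      then obtain k where k: "k1 \<le> k" "k2 \<le> k" "v \<in> S.U k" by auto
      then obtain w0 where w0: "w0 \<in> Lambda A" "w0 - emb v \<in> sbox (sides (r k) (T k))"
        unfolding S.U_def approx_set_def by blast
      define w where "w = w0 + lat_pt A p0 q0"
      have wL: "w \<in> Lambda A"
        unfolding w_def by (intro discrete_subgroup.add discrete_subgroup_Lambda w0 lat_pt_in_Lambda pq)
      have wb: "b \<in> cube (fst_part w) (r k)"
        using w0(2) unfolding diff_emb_sbox_iff by (simp add: cube_iff w_def b_def algebra_simps)
      have "\<bar>w $ Inr j\<bar> \<le> 2 * T k" for j
      proof -
        have "\<bar>w0 $ Inr j\<bar> \<le> T k" using w0(2) unfolding diff_emb_sbox_iff by simp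
        moreover have "\<bar>q0 $ j\<bar> \<le> T k"
          using component_le_infnorm_cart[of q0 j] k1 S.T_mono[OF k(1)] by linarith
        ultimately show ?thesis unfolding w_def by simp
      qed
      then have "w - emb b \<in> sbox (sides (r k) (2 * T k))" unfolding diff_emb_sbox_iff using wb by simp
      then have wX: "w \<in> X" unfolding X_def using wL k(1) by blast
      have "infnorm (fst_part w - b) \<le> r k"
        using wb unfolding infnorm_le_iff_cart cube_iff by simp
      also have "\<dots> \<le> \<delta> ^ k * r 0" using S.r_decays[of 0 k] by simp
      also have "\<dots> < e" by (rule k2[OF k(2)])
      also have "e \<le> infnorm (fst_part w - b)" unfolding e_def using fin wX by (intro Min_le) auto
      finally show False by simp
    qed
    have "infinite {q \<in> int_vecs. q \<noteq> 0 \<and> dist_int_vecs (A *v q - b) < \<psi> (infnorm q)}"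
    proof (subst infinite_int_vecs_iff, blast, intro allI)
      fix c :: nat
      \<comment> \<open>Only finitely many lattice points near \<open>b\<close> have bounded height,
        so \<open>X\<close> contains points with arbitrarily long \<open>q\<close>. This yields
        infinitely many distinct \<open>q\<close>, not merely distinct pairs
        \<open>(p, q)\<close>.\<close>
      have "\<not> X \<subseteq> {w \<in> Lambda A. w - emb b \<in> sbox (sides (r 0) (real c))}"
      proof
        assume "X \<subseteq> {w \<in> Lambda A. w - emb b \<in> sbox (sides (r 0) (real c))}"
        then have "finite X" by (rule finite_subset) (rule discrete_subgroup.finite_near[OF discrete_subgroup_Lambda])
        then show False using infX by simp
      qed
      then obtain w k where w: "w \<in> Lambda A" "w - emb b \<in> sbox (sides (r k) (2 * T k))"
        "w - emb b \<notin> sbox (sides (r 0) (real c))" unfolding X_def by auto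
      obtain p q where wpq: "p \<in> int_vecs" "q \<in> int_vecs" "w = lat_pt A p q" using w(1) unfolding Lambda_eq by auto
      have wr: "b \<in> cube (fst_part w) (r k)" and wT: "\<And>j. \<bar>q $ j\<bar> \<le> 2 * T k"
        using w(2) unfolding diff_emb_sbox_iff wpq by auto
      have "b \<in> cube (fst_part w) (r 0)"
        using wr S.r_antimono[of 0 k] unfolding cube_iff by (meson le0 order_trans)
      then obtain j where "real c < \<bar>q $ j\<bar>"
        using w(3) unfolding diff_emb_sbox_iff wpq by (auto simp: not_le)
      then have qc: "real c < infnorm q" using component_le_infnorm_cart[of q j] by linarith
      then have q0: "0 < infnorm q" by (rule le_less_trans[rotated]) simp
      have "infnorm q \<le> 2 * T k" unfolding infnorm_le_iff_cart using wT by blast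
      then have qT: "infnorm q \<le> 2 ^ (k + k0)" unfolding T_def by simp
      have "infnorm (A *v q - b - (- p)) \<le> r k"
        using wr unfolding infnorm_le_iff_cart cube_iff wpq by (simp add: algebra_simps)
      also have "\<dots> < \<psi> (2 ^ (k + k0))" unfolding r_def using pos[of "2 ^ (k + k0)"] by simp
      also have "\<dots> \<le> \<psi> (infnorm q)" using monotone_onD[OF \<psi>, of "infnorm q" "2 ^ (k + k0)"] q0 qT by simp
      finally have "dist_int_vecs (A *v q - b) < \<psi> (infnorm q)"
        unfolding dist_int_vecs_less_iff using int_vecs_minus[OF wpq(1)] by blast
      moreover have "q \<noteq> 0" using q0 by (auto simp: infnorm_0)
      ultimately show "\<exists>q\<in>{q \<in> int_vecs. q \<noteq> 0 \<and> dist_int_vecs (A *v q - b) < \<psi> (infnorm q)}. real c < infnorm q"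
        using wpq(2) qc by blast
    qed
    then show ?thesis unfolding W_lift_def b_def by simp
  qed
  define V where "V = unit_cube \<inter> V0 - Gs"
  have [measurable]: "Gs \<in> sets borel" using Gs by auto
  have V: "V \<in> sets borel" unfolding V_def by measurable
  have "unit_cube \<subseteq> cbox 0 (1 :: real ^ 'm)"
    unfolding unit_cube_def subset_iff mem_box_cart mem_Collect_eq by (simp add: less_imp_le)
  then have "V \<subseteq> cbox 0 1" unfolding V_def by blast
  then have bV: "bounded V" by (rule bounded_subset[OF bounded_cbox])
  have "emeasure lborel V = emeasure lborel (unit_cube \<inter> V0)"
    unfolding V_def by (rule emeasure_Diff_null_set[OF Gs]) measurable
  also have "\<dots> = ennreal (unit_measure V0)" by (rule emeasure_unit_eq) measurable
  finally have pV: "0 < emeasure lborel V" using S.limsup_measure_pos[OF divS] unfolding V0_def by simp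
  show ?thesis
  proof (rule ccontr)
    assume n1: "unit_measure (W_lift A \<psi>) \<noteq> 1"
    define Z where "Z = unit_cube - W_lift A \<psi>"
    have Z: "Z \<in> sets borel" unfolding Z_def by measurable
    have pZ: "0 < emeasure lborel Z"
    proof (rule ccontr)
      assume "\<not> ?thesis"
      then have "Z \<in> null_sets lborel" using Z by (intro null_setsI) auto
      then have "emeasure lborel (unit_cube - Z) = emeasure lborel (unit_cube :: (real ^ 'm) set)"
        by (rule emeasure_Diff_null_set) measurable
      moreover have "unit_cube - Z = unit_cube \<inter> W_lift A \<psi>" unfolding Z_def by auto
      ultimately have "unit_measure (W_lift A \<psi>) = 1"
        unfolding unit_measure_def measure_def by (simp add: emeasure_unit_cube)
      then show False using n1 by simp
    qed
    obtain x0 \<epsilon> where eps: "0 < \<epsilon>" "\<And>x. x \<in> ball x0 \<epsilon> \<Longrightarrow> \<exists>v\<in>V. v + x \<in> Z"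
      using steinhaus_two_sets[OF V bV pV Z pZ] by metis
    have m0: "0 < real CARD('m)" by simp
    \<comment> \<open>Density is known in the supremum norm but the ball is Euclidean; the norm is
      at most the sum of \<open>CARD('m)\<close> coordinates, here at most
      \<open>\<epsilon> / 2\<close>.\<close>
    have "0 < \<epsilon> / (2 * real CARD('m))" using eps(1) by simp
    then obtain p q where pq: "p \<in> int_vecs" "q \<in> int_vecs" "x0 \<in> cube (A *v q + p) (\<epsilon> / (2 * real CARD('m)))"
      using S.dense_if_divergent[OF divS] by metis
    have "norm (A *v q + p - x0) \<le> (\<Sum>i\<in>UNIV. \<bar>(A *v q + p - x0) $ i\<bar>)" by (rule norm_le_l1_cart)
    also have "\<dots> \<le> (\<Sum>i\<in>(UNIV :: 'm set). \<epsilon> / (2 * real CARD('m)))"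
      using pq(3) unfolding cube_iff by (intro sum_mono) simp
    also have "\<dots> = \<epsilon> / 2" using m0 by simp
    also have "\<dots> < \<epsilon>" using eps(1) by simp
    finally have "A *v q + p \<in> ball x0 \<epsilon>" by (simp add: dist_norm norm_minus_commute)
    then obtain v where "v \<in> V" "v + (A *v q + p) \<in> Z" using eps(2) by blast
    then show False using shift[OF _ _ pq(1,2), of v] unfolding V_def Z_def by blast
  qed
qed

theorem corollary1p4:
  fixes A :: "real ^ 'n::finite ^ 'm::finite" and \<psi> :: "real \<Rightarrow> real"
  assumes "\<And>x. x > 0 \<Longrightarrow> \<psi> x > 0"
    and "antimono_on {0<..} \<psi>"
    and "dyadically_regular \<psi>"
  shows "(\<exists>C>0. \<forall>k::nat.
            inverse C * minima_product A \<psi> k \<le> M_ratio A (\<psi> (2 ^ k)) (2 ^ k)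
            \<and> M_ratio A (\<psi> (2 ^ k)) (2 ^ k) \<le> C * minima_product A \<psi> k)
       \<and> W_set A \<psi> \<in> sets torus_measure
       \<and> (summable (minima_product A \<psi>) \<longrightarrow> emeasure torus_measure (W_set A \<psi>) = 0)
       \<and> (\<not> summable (minima_product A \<psi>) \<longrightarrow> emeasure torus_measure (W_set A \<psi>) = 1)"
proof -
  define d where "d = CARD('m) + CARD('n)"
  define C1 where "C1 = real (8 * d ^ 2) ^ (d * d)"
  define C2 where "C2 = real d ^ d"
  define M where "M k = M_ratio A (\<psi> (2 ^ k)) (2 ^ k)" for k :: nat
  let ?P = "minima_product A \<psi>"
  have d1: "1 \<le> d" unfolding d_def using zero_less_card_finite[where 'a = 'm] by linarith
  have C: "0 < C1" "0 < C2" unfolding C1_def C2_def using d1 by simp_all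
  have PM: "?P k \<le> C1 * M k" and MP: "M k \<le> C2 * ?P k" for k
    using minima_product_bounds_M_ratio[of \<psi> k A] assms(1)[of "2 ^ k"] unfolding C1_def C2_def M_def d_def by auto
  have M0: "0 \<le> M k" for k
    unfolding M_def M_ratio_def using assms(1)[of "2 ^ k"] by simp
  have P0: "0 \<le> ?P k" for k
    using order_trans[OF M0 MP] C by (simp add: zero_le_mult_iff)
  have "\<exists>C>0. \<forall>k. inverse C * ?P k \<le> M k \<and> M k \<le> C * ?P k"
  proof (intro exI[of _ "C1 + C2"] conjI allI)
    fix k
    have "?P k \<le> (C1 + C2) * M k"
      using PM[of k] mult_nonneg_nonneg[OF less_imp_le[OF C(2)] M0[of k]] by (simp add: distrib_right)
    then show "inverse (C1 + C2) * ?P k \<le> M k" using C by (simp add: field_simps)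
    show "M k \<le> (C1 + C2) * ?P k"
      using MP[of k] mult_nonneg_nonneg[OF less_imp_le[OF C(1)] P0[of k]] by (simp add: distrib_right)
  qed (use C in simp)
  moreover have "summable M \<longleftrightarrow> summable ?P"
  proof
    assume "summable M"
    then have "summable (\<lambda>k. C1 * M k)" by (rule summable_mult)
    then show "summable ?P" by (rule summable_comparison_test'[where N = 0]) (simp add: PM P0)
  next
    assume "summable ?P"
    then have "summable (\<lambda>k. C2 * ?P k)" by (rule summable_mult)
    then show "summable M" by (rule summable_comparison_test'[where N = 0]) (simp add: MP M0)
  qed
  moreover have "emeasure torus_measure (W_set A \<psi>) = 0" if "summable M"
    using unit_measure_W_lift_convergent[of \<psi> A, OF assms(1,2)] that unfolding M_def by (simp add: emeasure_W_set)
  moreover have "emeasure torus_measure (W_set A \<psi>) = 1" if "\<not> summable M"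
    using unit_measure_W_lift_divergent[of \<psi> A, OF assms] that unfolding M_def by (simp add: emeasure_W_set)
  ultimately show ?thesis using W_set_measurable[of A \<psi>] unfolding M_def by blast
qed

end
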